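(* Let $c_1, c_2 \in \{1, 0, -1\}$ with $c_1 \neq c_2$, and let $\Sigma$ be an isoparametric hypersurface in the Riemannian product $\mathbb{Q}^2_{c_1} \times \mathbb{Q}^2_{c_2}$, with unit normal vector field $N = N_1 + N_2$, where $N_i$ denotes the component of $N$ tangent to the factor $\mathbb{Q}^2_{c_i}$, $i = 1, 2$. Then the principal curvatures of $\Sigma$ are constant on $\Sigma$ if and only if the functions $|N_1|$ and $|N_2|$ are constant on $\Sigma$.
   Context: $\mathbb{Q}^2_{c}$ denotes the 2-dimensional space form (simply connected complete Riemannian surface) of constant sectional curvature $c$: $\mathbb{S}^2$ if $c = 1$, $\mathbb{R}^2$ if $c = 0$, $\mathbb{H}^2$ if $c = -1$. The product $\mathbb{Q}^2_{c_1} \times \mathbb{Q}^2_{c_2}$ carries the product metric, and every tangent vector $Y$ decomposes as the sum of its components tangent to the two factors. A hypersurface $\Sigma$ (oriented by a unit normal field $N$) of a Riemannian manifold $\widetilde{M}^{n+1}$ is called isoparametric if it has constant mean curvature and its nearby equidistant hypersurfaces also have constant mean curvature. That is, for some $\varepsilon > 0$ and all $r \in (-\varepsilon, \varepsilon)$, the parallel hypersurface $\Sigma_r = \{\exp_p(r N_p) : p \in \Sigma\}$ is a hypersurface whose mean curvature $h(r)$ (the trace of the shape operator divided by $n$, with respect to the unit normal $\dot\gamma_p(r)$, $\gamma_p(r) = \exp_p(rN_p)$) depends only on $r$ and not on the point $p$. The principal curvatures of $\Sigma$ are the eigenvalues of its shape operator $A$, $AY = -\widetilde{\nabla}_Y N$,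 where $\widetilde{\nabla}$ is the Levi-Civita connection of the ambient space. *)

theory Defs
  imports "HOL-Analysis.Analysis"
begin

section \<open>Smooth maps and submanifolds of Euclidean space\<close>

text \<open>Meant for open \<open>S\<close> only: derivatives are taken at points of \<open>S\<close> in the full space.\<close>

fun Ck_on :: "nat \<Rightarrow> 'a::real_normed_vector set \<Rightarrow> ('a \<Rightarrow> 'b::real_normed_vector) \<Rightarrow> bool" where
  "Ck_on 0 S f \<longleftrightarrow> continuous_on S f"
| "Ck_on (Suc k) S f \<longleftrightarrow> (\<forall>x\<in>S. f differentiable (at x)) \<and>
     (\<forall>v. Ck_on k S (\<lambda>x. frechet_derivative f (at x) v))"

definition smooth_on :: "'a::real_normed_vector set \<Rightarrow> ('a \<Rightarrow> 'b::real_normed_vector) \<Rightarrow> bool" where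
  "smooth_on S f \<longleftrightarrow> (\<forall>k. Ck_on k S f)"

text \<open>Smoothness on an arbitrary subset: local extendability to a smooth map on an open set.\<close>

definition smooth_map :: "'a::real_normed_vector set \<Rightarrow> ('a \<Rightarrow> 'b::real_normed_vector) \<Rightarrow> bool" where
  "smooth_map M g \<longleftrightarrow>
     (\<forall>p\<in>M. \<exists>V G. open V \<and> p \<in> V \<and> smooth_on V G \<and> (\<forall>q\<in>M \<inter> V. G q = g q))"

text \<open>\<open>M\<close> is locally diffeomorphic to open subsets of three-dimensional Euclidean space. By Whitney's
  theorem every abstract smooth 3-manifold is diffeomorphic to such a set. Neither connectedness
  nor completeness is required.\<close>

definition manifold3 :: "'a::euclidean_space set \<Rightarrow> bool" where
  "manifold3 M \<longleftrightarrow>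
     (\<forall>p\<in>M. \<exists>V (U :: (real^3) set) x y. open V \<and> p \<in> V \<and> open U \<and> smooth_on U x \<and> smooth_on V y \<and>
        x ` U = M \<inter> V \<and> (\<forall>u\<in>U. y (x u) = u))"

definition tangent_space :: "'a::real_normed_vector set \<Rightarrow> 'a \<Rightarrow> 'a set" where
  "tangent_space M p =
     {v. \<exists>\<alpha> e. 0 < e \<and> (\<forall>t\<in>{-e<..<e}. \<alpha> t \<in> M) \<and> \<alpha> 0 = p \<and> (\<alpha> has_vector_derivative v) (at (0::real))}"

text \<open>The differential of \<open>g\<close> at \<open>p \<in> M\<close>. On all of the surrounding space a derivative within \<open>M\<close>
  is not unique, but its values on \<open>tangent_space M p\<close> are, and only those are used below.\<close>

definition differential ::
    "'a::real_normed_vector set \<Rightarrow> ('a \<Rightarrow> 'b::real_normed_vector) \<Rightarrow> 'a \<Rightarrow> 'a \<Rightarrow> 'b" where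
  "differential M g p = frechet_derivative g (at p within M)"


section \<open>Geometry of a Riemannian submanifold of a pseudo-Euclidean space\<close>

text \<open>Throughout, the ambient Riemannian manifold is a submanifold \<open>P\<close> of a vector space with a
  constant symmetric bilinear form \<open>B\<close> that is positive definite on the tangent spaces of \<open>P\<close>; its
  metric is the restriction of \<open>B\<close>. By the Gauss formula its Levi-Civita connection is the
  \<open>B\<close>-orthogonal projection of the flat derivative to the tangent spaces of \<open>P\<close>.\<close>

definition tangential_part ::
    "('b::real_normed_vector \<Rightarrow> 'b \<Rightarrow> real) \<Rightarrow> 'b set \<Rightarrow> 'b \<Rightarrow> 'b \<Rightarrow> 'b" where
  "tangential_part B P q w =
     (THE u. u \<in> tangent_space P q \<and> (\<forall>t\<in>tangent_space P q. B (w - u) t = 0))"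

text \<open>The Levi-Civita derivative, in the direction \<open>v \<in> tangent_space M p\<close>, of a vector field \<open>W\<close> of
  \<open>P\<close> along a map \<open>g\<close> from \<open>M\<close> to \<open>P\<close>, that is, \<open>W p \<in> tangent_space P (g p)\<close>.\<close>

definition covariant_derivative ::
    "('b::real_normed_vector \<Rightarrow> 'b \<Rightarrow> real) \<Rightarrow> 'b set \<Rightarrow> 'a::real_normed_vector set \<Rightarrow>
     ('a \<Rightarrow> 'b) \<Rightarrow> ('a \<Rightarrow> 'b) \<Rightarrow> 'a \<Rightarrow> 'a \<Rightarrow> 'b" where
  "covariant_derivative B P M g W p v = tangential_part B P (g p) (differential M W p v)"

definition geodesic :: "('b::real_normed_vector \<Rightarrow> 'b \<Rightarrow> real) \<Rightarrow> 'b set \<Rightarrow> (real \<Rightarrow> 'b) \<Rightarrow> bool" where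
  "geodesic B P \<gamma> \<longleftrightarrow> smooth_on UNIV \<gamma> \<and> range \<gamma> \<subseteq> P \<and>
     (\<forall>t. covariant_derivative B P UNIV \<gamma> (\<lambda>s. vector_derivative \<gamma> (at s)) t 1 = 0)"

text \<open>Total for complete \<open>P\<close>, since geodesics are defined on the whole line.\<close>

definition riemannian_exp :: "('b::real_normed_vector \<Rightarrow> 'b \<Rightarrow> real) \<Rightarrow> 'b set \<Rightarrow> 'b \<Rightarrow> 'b \<Rightarrow> 'b" where
  "riemannian_exp B P q v =
     (THE z. \<exists>\<gamma>. geodesic B P \<gamma> \<and> \<gamma> 0 = q \<and> vector_derivative \<gamma> (at 0) = v \<and> \<gamma> 1 = z)"


section \<open>Hypersurfaces of a four-dimensional Riemannian manifold\<close>

text \<open>A hypersurface is an immersion \<open>f\<close> of a 3-manifold \<open>M\<close> with a unit normal field \<open>N\<close> along it.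
  Embedded hypersurfaces are the case where \<open>f\<close> is the inclusion of a subset of \<open>P\<close>.\<close>

definition hypersurface ::
    "('b::real_normed_vector \<Rightarrow> 'b \<Rightarrow> real) \<Rightarrow> 'b set \<Rightarrow> 'a::euclidean_space set \<Rightarrow>
     ('a \<Rightarrow> 'b) \<Rightarrow> ('a \<Rightarrow> 'b) \<Rightarrow> bool" where
  "hypersurface B P M f N \<longleftrightarrow>
     manifold3 M \<and> smooth_map M f \<and> smooth_map M N \<and> f ` M \<subseteq> P \<and>
     (\<forall>p\<in>M. inj_on (differential M f p) (tangent_space M p) \<and>
            N p \<in> tangent_space P (f p) \<and> B (N p) (N p) = 1 \<and>
            (\<forall>v\<in>tangent_space M p. B (N p) (differential M f p v) = 0))"

text \<open>The shape operator as an endomorphism of the tangent space of \<open>M\<close>, which the differential of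
  \<open>f\<close> identifies with the tangent space of the immersed hypersurface.\<close>

definition shape_operator ::
    "('b::real_normed_vector \<Rightarrow> 'b \<Rightarrow> real) \<Rightarrow> 'b set \<Rightarrow> 'a::euclidean_space set \<Rightarrow>
     ('a \<Rightarrow> 'b) \<Rightarrow> ('a \<Rightarrow> 'b) \<Rightarrow> 'a \<Rightarrow> 'a \<Rightarrow> 'a" where
  "shape_operator B P M f N p v =
     (THE w. w \<in> tangent_space M p \<and> differential M f p w = - covariant_derivative B P M f N p v)"

text \<open>The trace of an endomorphism \<open>L\<close> of a finite-dimensional subspace \<open>S\<close>; it does not depend on the
  chosen basis.\<close>

definition trace_on :: "'a::euclidean_space set \<Rightarrow> ('a \<Rightarrow> 'a) \<Rightarrow> real" where
  "trace_on S L =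
     (let E = (SOME E. independent E \<and> span E = S) in \<Sum>e\<in>E. representation E (L e) e)"

definition mean_curvature ::
    "('b::real_normed_vector \<Rightarrow> 'b \<Rightarrow> real) \<Rightarrow> 'b set \<Rightarrow> 'a::euclidean_space set \<Rightarrow>
     ('a \<Rightarrow> 'b) \<Rightarrow> ('a \<Rightarrow> 'b) \<Rightarrow> 'a \<Rightarrow> real" where
  "mean_curvature B P M f N p =
     trace_on (tangent_space M p) (shape_operator B P M f N p) / real (dim (tangent_space M p))"

text \<open>The multiplicity of the real number \<open>k\<close> as a principal curvature at \<open>p\<close>, that is, as an
  eigenvalue of the shape operator; it is 0 if \<open>k\<close> is not a principal curvature.\<close>

definition principal_multiplicity ::
    "('b::real_normed_vector \<Rightarrow> 'b \<Rightarrow> real) \<Rightarrow> 'b set \<Rightarrow> 'a::euclidean_space set \<Rightarrow>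
     ('a \<Rightarrow> 'b) \<Rightarrow> ('a \<Rightarrow> 'b) \<Rightarrow> 'a \<Rightarrow> real \<Rightarrow> nat" where
  "principal_multiplicity B P M f N p k =
     dim {v \<in> tangent_space M p. shape_operator B P M f N p v = k *\<^sub>R v}"

definition constant_principal_curvatures ::
    "('b::real_normed_vector \<Rightarrow> 'b \<Rightarrow> real) \<Rightarrow> 'b set \<Rightarrow> 'a::euclidean_space set \<Rightarrow>
     ('a \<Rightarrow> 'b) \<Rightarrow> ('a \<Rightarrow> 'b) \<Rightarrow> bool" where
  "constant_principal_curvatures B P M f N \<longleftrightarrow>
     (\<forall>p\<in>M. \<forall>q\<in>M. \<forall>k. principal_multiplicity B P M f N p k = principal_multiplicity B P M f N q k)"

definition parallel_map ::
    "('b::real_normed_vector \<Rightarrow> 'b \<Rightarrow> real) \<Rightarrow> 'b set \<Rightarrow> ('a \<Rightarrow> 'b) \<Rightarrow> ('a \<Rightarrow> 'b) \<Rightarrow> real \<Rightarrow> 'a \<Rightarrow> 'b" where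
  "parallel_map B P f N r p = riemannian_exp B P (f p) (r *\<^sub>R N p)"

definition parallel_normal ::
    "('b::real_normed_vector \<Rightarrow> 'b \<Rightarrow> real) \<Rightarrow> 'b set \<Rightarrow> ('a \<Rightarrow> 'b) \<Rightarrow> ('a \<Rightarrow> 'b) \<Rightarrow> real \<Rightarrow> 'a \<Rightarrow> 'b" where
  "parallel_normal B P f N r p = vector_derivative (\<lambda>s. parallel_map B P f N s p) (at r)"

text \<open>The parallel hypersurfaces are parametrized over the same \<open>M\<close>, so they are required to be
  immersed only. The case \<open>r = 0\<close> says that the mean curvature of the hypersurface itself is
  constant.\<close>

definition isoparametric ::
    "('b::real_normed_vector \<Rightarrow> 'b \<Rightarrow> real) \<Rightarrow> 'b set \<Rightarrow> 'a::euclidean_space set \<Rightarrow>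
     ('a \<Rightarrow> 'b) \<Rightarrow> ('a \<Rightarrow> 'b) \<Rightarrow> bool" where
  "isoparametric B P M f N \<longleftrightarrow> hypersurface B P M f N \<and>
     (\<exists>\<epsilon>>0. \<exists>h :: real \<Rightarrow> real. \<forall>r\<in>{-\<epsilon><..<\<epsilon>}.
        hypersurface B P M (parallel_map B P f N r) (parallel_normal B P f N r) \<and>
        (\<forall>p\<in>M. mean_curvature B P M (parallel_map B P f N r) (parallel_normal B P f N r) p = h r))"


section \<open>Two-dimensional space forms and their products\<close>

text \<open>The Euclidean inner product, replaced by the Lorentzian one for \<open>c = -1\<close>.\<close>

definition space_form_metric :: "real \<Rightarrow> real^3 \<Rightarrow> real^3 \<Rightarrow> real" where
  "space_form_metric c v w = v$1 * w$1 + v$2 * w$2 + (if c = -1 then - (v$3 * w$3) else v$3 * w$3)"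

text \<open>The unit sphere for \<open>c = 1\<close>, a Euclidean plane for \<open>c = 0\<close>, and the upper sheet of the
  hyperboloid for \<open>c = -1\<close>; only these values of \<open>c\<close> are used.\<close>

definition space_form :: "real \<Rightarrow> (real^3) set" where
  "space_form c =
     (if c = 0 then {x. x$3 = 0}
      else if c = -1 then {x. space_form_metric c x x = -1 \<and> x$3 > 0}
      else {x. space_form_metric c x x = 1})"

definition product_metric ::
    "real \<Rightarrow> real \<Rightarrow> (real^3) \<times> (real^3) \<Rightarrow> (real^3) \<times> (real^3) \<Rightarrow> real" where
  "product_metric c1 c2 v w =
     space_form_metric c1 (fst v) (fst w) + space_form_metric c2 (snd v) (snd w)"

definition space_form_norm :: "real \<Rightarrow> real^3 \<Rightarrow> real" where
  "space_form_norm c v = sqrt (space_form_metric c v v)"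

end

(*
  Choose a frame e1, e2, e3 of the tangent space of the hypersurface at a point, with e1 and e2
  tangent to the two factors and orthogonal to N1 and N2. It consists of eigenvectors of the Jacobi
  operator R(-, N)N, with eigenvalues a1 = c1 t, a2 = c2 (1 - t) and 0, where t = |N1|^2.
  If A is the symmetric matrix of the shape operator in this frame, the differential of the parallel
  map at distance r is D(r) = diag(cs a_i r) - diag(sn a_i r) A in the parallel frame, and the shape
  operator of the parallel hypersurface is - D' D^(-1). Hence (det D)' = - 3 h det D: the
  hypersurface being isoparametric, det D is the same function of r at all points, and so are its
  Taylor coefficients.

  The coefficients of order 1 and 2 are - tr A and sigma2(A) - (a1 + a2) / 2. If the principal
  curvatures are constant, then a1 + a2 = c2 + (c1 - c2) t is constant, and so is t. Conversely, if t
  is constant, then these two coefficients make tr A and sigma2(A) constant, and those of order 3, 5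
  and 7 determine det A. As A is symmetric, the three numbers determine the multiplicities of its
  eigenvalues. The argument compares two points only, so that M need not be connected.
*)
theory Submission
  imports Defs
begin

text \<open>No curvature tensor occurs. The space forms are quadrics or planes in three-space, where
  geodesics are explicit, and the formula for D(r) results from differentiating them in a chart. The
  obstacle is that N1 or N2 may vanish at a point, so that nothing may be divided by the speed of a
  component geodesic. Hence the trigonometric functions take c times the squared speed as parameter,
  and unit vectors n1, n2 with N = (b1 n1, b2 n2) are chosen even where b1 or b2 is zero; e3 is (b2
  n1, - b1 n2). Order 3 alone does not give det A: there it is mixed with a1 A11 + a2 A22, which the
  trace does not determine. Now det D is a combination of eight functions, the products of a cs or
  sn for a1 with one for a2, times 1 or r. Four of them are even in r and invisible in odd orders.
  For the difference between two points with the same t, orders 1, 3, 5 and 7 are thus four linear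
  equations in the four odd coefficients, and they force the one that belongs to det A to
  vanish.\<close>

section \<open>Generalized trigonometric functions\<close>

text \<open>\<open>gcos z = cos (sqrt z)\<close> and \<open>gsin z = sin (sqrt z) / sqrt z\<close>, extended to all real \<open>z\<close>, so that
  the three curvature signs and the zero velocity are treated at once.\<close>

definition gcos :: "real \<Rightarrow> real" where
  "gcos z = (\<Sum>n. ((-1) ^ n / fact (2 * n)) * z ^ n)"

definition gsin :: "real \<Rightarrow> real" where
  "gsin z = (\<Sum>n. ((-1) ^ n / fact (2 * n + 1)) * z ^ n)"

definition gsin' :: "real \<Rightarrow> real" where
  "gsin' z = (\<Sum>n. diffs (\<lambda>n. (-1) ^ n / fact (2 * n + 1)) n * z ^ n)"

text \<open>Domination by the exponential series at |z|.\<close>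

lemma summable_gtrig:
  fixes z :: real
  assumes "\<And>n. m n \<ge> n"
  shows "summable (\<lambda>n. ((-1) ^ n / fact (m n)) * z ^ n)"
proof (rule summable_comparison_test')
  show "summable (\<lambda>n. inverse (fact n) * \<bar>z\<bar> ^ n)"
    by (rule summable_exp)
  fix n :: nat
  assume "n \<ge> 0"
  have "fact n \<le> (fact (m n) :: real)"
    using assms[of n] by (simp add: fact_mono)
  then have "inverse (fact (m n)) \<le> inverse (fact n :: real)"
    by (simp add: le_imp_inverse_le)
  then have "inverse (fact (m n)) * \<bar>z\<bar> ^ n \<le> inverse (fact n) * \<bar>z\<bar> ^ n"
    by (intro mult_right_mono) auto
  then show "norm (((-1) ^ n / fact (m n)) * z ^ n) \<le> inverse (fact n) * \<bar>z\<bar> ^ n"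
    by (simp add: abs_mult power_abs divide_inverse)
qed

lemma summable_gcos: "summable (\<lambda>n. ((-1) ^ n / fact (2 * n)) * (z :: real) ^ n)"
  and summable_gsin: "summable (\<lambda>n. ((-1) ^ n / fact (2 * n + 1)) * z ^ n)"
  by (rule summable_gtrig; simp)+

lemma gcos_0 [simp]: "gcos 0 = 1" and gsin_0 [simp]: "gsin 0 = 1"
  unfolding gcos_def gsin_def using powser_zero[of "\<lambda>n. (-1) ^ n / fact (2 * n) :: real"]
    powser_zero[of "\<lambda>n. (-1) ^ n / fact (2 * n + 1) :: real"] by simp_all

lemma DERIV_gcos: "(gcos has_real_derivative - gsin z / 2) (at z)"
proof -
  let ?c = "\<lambda>n. (-1) ^ n / fact (2 * n) :: real"
  have d: "diffs ?c n = (- 1 / 2) * ((-1) ^ n / fact (2 * n + 1))" for n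
  proof -
    have f: "fact (2 * Suc n) = (2 * real (Suc n)) * fact (2 * n + 1)"
      by (simp add: algebra_simps)
    have "real (Suc n) * (a / (2 * real (Suc n) * F)) = (1 / 2) * (a / F)" for a F :: real
      by (simp add: divide_simps)
    then show ?thesis unfolding diffs_def f by simp
  qed
  have "(gcos has_real_derivative (\<Sum>n. diffs ?c n * z ^ n)) (at z)"
    unfolding gcos_def
    by (rule termdiffs_strong_converges_everywhere) (rule summable_gcos)
  also have "(\<Sum>n. diffs ?c n * z ^ n) = (\<Sum>n. (- 1 / 2) * (((-1) ^ n / fact (2 * n + 1)) * z ^ n))"
    unfolding d by (simp only: mult.assoc)
  also have "\<dots> = - gsin z / 2"
    unfolding gsin_def by (subst suminf_mult[OF summable_gsin]) simp
  finally show ?thesis .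
qed

lemma DERIV_gsin: "(gsin has_real_derivative gsin' z) (at z)"
  unfolding gsin_def gsin'_def
  by (rule termdiffs_strong_converges_everywhere) (rule summable_gsin)

text \<open>Compare coefficients: \<open>2 * n * ?d n = (2 * n + 1) * ?d n - ?d n\<close>, and
  \<open>(2 * n + 1) * ?d n\<close> is the coefficient of \<open>gcos\<close>. Multiplying by
  \<open>z\<close> instead of dividing keeps \<open>z = 0\<close> included.\<close>

lemma gsin'_eq: "2 * z * gsin' z = gcos z - gsin z"
proof -
  let ?d = "\<lambda>n. (-1) ^ n / fact (2 * n + 1) :: real"
  have s: "summable (\<lambda>n. diffs ?d n * z ^ n)"
    by (rule termdiff_converges_all) (rule summable_gsin)
  have "(\<lambda>n. real n * ?d n * z ^ (n - Suc 0)) sums (\<Sum>n. diffs ?d n * z ^ n)"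
    by (rule diffs_equiv[OF s])
  then have "(\<lambda>n. 2 * z * (real n * ?d n * z ^ (n - Suc 0))) sums (2 * z * gsin' z)"
    unfolding gsin'_def by (rule sums_mult)
  moreover have "2 * z * (real n * ?d n * z ^ (n - Suc 0))
      = ((-1) ^ n / fact (2 * n)) * z ^ n - ?d n * z ^ n" for n
  proof (cases n)
    case (Suc m)
    have f: "fact (2 * n + 1) = (2 * real n + 1) * fact (2 * n)" by simp
    have zz: "z * z ^ (n - Suc 0) = z ^ n" using Suc by simp
    have "2 * z * (real n * ?d n * z ^ (n - Suc 0)) = 2 * real n * ?d n * z ^ n"
      unfolding zz[symmetric] by (simp only: mult_ac)
    also have "2 * a * b * y = ((2 * a + 1) * b - b) * y" for a b y :: real
      by (simp add: algebra_simps)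
    also have "(2 * real n + 1) * ?d n = (-1) ^ n / fact (2 * n)"
    proof -
      have "2 * real n + 1 \<noteq> 0" by (metis add_nonneg_eq_0_iff of_nat_0_le_iff zero_neq_one mult_nonneg_nonneg zero_le_numeral zero_le_one)
      then show ?thesis unfolding f times_divide_eq_right by (rule mult_divide_mult_cancel_left)
    qed
    finally show ?thesis by (simp add: left_diff_distrib)
  qed simp
  ultimately have "(\<lambda>n. ((-1) ^ n / fact (2 * n)) * z ^ n - ?d n * z ^ n) sums (2 * z * gsin' z)"
    by simp
  moreover have "(\<lambda>n. ((-1) ^ n / fact (2 * n)) * z ^ n - ?d n * z ^ n) sums (gcos z - gsin z)"
    unfolding gcos_def gsin_def
    by (intro sums_diff summable_sums summable_gcos summable_gsin)
  ultimately show ?thesis by (rule sums_unique2)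
qed

text \<open>The derivative is \<open>gsin z\<close> times
  \<open>2 * z * gsin' z + gsin z - gcos z\<close>, which is zero by
  \<open>gsin'_eq\<close>.\<close>

lemma gcos_gsin_squared: "(gcos z)\<^sup>2 + z * (gsin z)\<^sup>2 = 1"
proof -
  have "((\<lambda>z. (gcos z)\<^sup>2 + z * (gsin z)\<^sup>2) has_real_derivative 0) (at z)" for z
  proof -
    have "((\<lambda>z. (gcos z)\<^sup>2 + z * (gsin z)\<^sup>2) has_real_derivative
        2 * gcos z * (- gsin z / 2) + ((gsin z)\<^sup>2 + gsin z * (2 * z * gsin' z))) (at z)"
      by (auto intro!: derivative_eq_intros DERIV_gcos DERIV_gsin simp: power2_eq_square algebra_simps)
    then show ?thesis unfolding gsin'_eq by (simp add: power2_eq_square algebra_simps)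
  qed
  then have "(gcos z)\<^sup>2 + z * (gsin z)\<^sup>2 = (gcos 0)\<^sup>2 + 0 * (gsin 0)\<^sup>2"
    by (intro DERIV_isconst_all[of "\<lambda>z. (gcos z)\<^sup>2 + z * (gsin z)\<^sup>2"]) blast
  then show ?thesis by simp
qed

text \<open>\<open>cs k\<close> and \<open>sn k\<close> solve y'' = - k y with initial data (1, 0)
  and (0, 1): trigonometric for k > 0, hyperbolic for k < 0.\<close>

definition cs :: "real \<Rightarrow> real \<Rightarrow> real" where "cs k t = gcos (k * t\<^sup>2)"
definition sn :: "real \<Rightarrow> real \<Rightarrow> real" where "sn k t = t * gsin (k * t\<^sup>2)"

lemma cs_zero [simp]: "cs k 0 = 1" "cs 0 t = 1" and sn_zero [simp]: "sn k 0 = 0" "sn 0 t = t"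
  by (simp_all add: cs_def sn_def)

lemma cs_sn_squared: "(cs k t)\<^sup>2 + k * (sn k t)\<^sup>2 = 1"
  using gcos_gsin_squared[of "k * t\<^sup>2"] by (simp add: cs_def sn_def power_mult_distrib algebra_simps)

lemma DERIV_cs: "(cs k has_real_derivative - k * sn k t) (at t)"
proof -
  have "((\<lambda>t. gcos (k * t\<^sup>2)) has_real_derivative - gsin (k * t\<^sup>2) / 2 * (k * (2 * t))) (at t)"
    by (rule DERIV_chain2[OF DERIV_gcos]) (auto intro!: derivative_eq_intros)
  then show ?thesis
    unfolding cs_def[abs_def] sn_def by (simp add: algebra_simps)
qed

lemma DERIV_sn: "(sn k has_real_derivative cs k t) (at t)"
proof -
  have "((\<lambda>t. gsin (k * t\<^sup>2)) has_real_derivative gsin' (k * t\<^sup>2) * (k * (2 * t))) (at t)"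
    by (rule DERIV_chain2[OF DERIV_gsin]) (auto intro!: derivative_eq_intros)
  then have "((\<lambda>t. t * gsin (k * t\<^sup>2)) has_real_derivative
      1 * gsin (k * t\<^sup>2) + gsin' (k * t\<^sup>2) * (k * (2 * t)) * t) (at t)"
    by (intro DERIV_mult' derivative_eq_intros) (auto simp: algebra_simps)
  moreover have "gsin' (k * t\<^sup>2) * (k * (2 * t)) * t = gcos (k * t\<^sup>2) - gsin (k * t\<^sup>2)"
    unfolding gsin'_eq[symmetric] by (simp add: power2_eq_square)
  ultimately show ?thesis
    unfolding sn_def[abs_def] cs_def by simp
qed

section \<open>Symmetry of second derivatives\<close>

text \<open>The mean value theorem is applied in the direction \<open>v\<close> only; then the
  expansion of \<open>g' _ v\<close> at \<open>u\<close> is used at two points. The quotient is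
  symmetric in \<open>v\<close> and \<open>w\<close>, so its limit is too, without continuity of
  second derivatives.\<close>

lemma second_difference_limit:
  fixes g :: "'a::real_normed_vector \<Rightarrow> real"
  assumes U: "open U" "u \<in> U" and g: "\<And>z. z \<in> U \<Longrightarrow> (g has_derivative g' z) (at z)"
    and L: "((\<lambda>z. g' z v) has_derivative L) (at u)"
  shows "((\<lambda>t. (g (u + t *\<^sub>R v + t *\<^sub>R w) - g (u + t *\<^sub>R v) - g (u + t *\<^sub>R w) + g u) / t\<^sup>2) \<longlongrightarrow> L w) (at_right 0)"
proof (rule tendstoI)
  fix e :: real
  assume e: "e > 0"
  obtain \<rho> where \<rho>: "\<rho> > 0" "ball u \<rho> \<subseteq> U" using U open_contains_ball by blast
  define K where "K = norm v + norm w + 1"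
  have K: "K > 0" unfolding K_def by (smt (verit) norm_ge_zero)
  \<comment> \<open>Displacements have length at most \<open>t * K\<close>, so the two errors
    \<open>\<eta> * (t * K)\<close> add up to \<open>t * (e / 2)\<close>.\<close>
  define \<eta> where "\<eta> = e / (4 * K)"
  have \<eta>: "\<eta> > 0" using e K by (simp add: \<eta>_def)
  obtain d where d: "d > 0" "\<And>y. norm (y - u) < d \<Longrightarrow> norm (g' y v - g' u v - L (y - u)) \<le> \<eta> * norm (y - u)"
    using L \<eta> unfolding has_derivative_at_alt by blast
  have linL: "linear L" using L has_derivative_linear by blast
  define b where "b = min \<rho> d / K"
  have b: "b > 0" using \<rho> d K by (simp add: b_def)
  have est: "dist ((g (u + t *\<^sub>R v + t *\<^sub>R w) - g (u + t *\<^sub>R v) - g (u + t *\<^sub>R w) + g u) / t\<^sup>2) (L w) < e"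
    if t: "0 < t" "t < b" for t
  proof -
    have small: "norm (s *\<^sub>R v + r *\<^sub>R w) \<le> t * K \<and> norm (s *\<^sub>R v + r *\<^sub>R w) < min \<rho> d"
      if "0 \<le> s" "s \<le> t" "0 \<le> r" "r \<le> t" for s r
    proof -
      have "norm (s *\<^sub>R v + r *\<^sub>R w) \<le> s * norm v + r * norm w"
        using norm_triangle_ineq[of "s *\<^sub>R v" "r *\<^sub>R w"] that by simp
      also have "\<dots> \<le> t * norm v + t * norm w"
        using that by (intro add_mono mult_right_mono) auto
      also have "\<dots> \<le> t * K" unfolding K_def using t by (simp add: algebra_simps)
      finally have "norm (s *\<^sub>R v + r *\<^sub>R w) \<le> t * K" .
      moreover have "t * K < min \<rho> d" using t K by (simp add: b_def pos_less_divide_eq)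
      ultimately show ?thesis by linarith
    qed
    define \<phi> where "\<phi> = (\<lambda>s. g (u + s *\<^sub>R v + t *\<^sub>R w) - g (u + s *\<^sub>R v))"
    define \<phi>' where "\<phi>' = (\<lambda>s. g' (u + s *\<^sub>R v + t *\<^sub>R w) v - g' (u + s *\<^sub>R v) v)"
    have inU: "u + s *\<^sub>R v + r *\<^sub>R w \<in> U" if "0 \<le> s" "s \<le> t" "0 \<le> r" "r \<le> t" for s r
    proof -
      have "dist u (u + s *\<^sub>R v + r *\<^sub>R w) = norm (s *\<^sub>R v + r *\<^sub>R w)"
        by (simp add: dist_norm norm_minus_commute add.assoc add.commute[of "r *\<^sub>R w"])
      then show ?thesis using small[OF that] \<rho>(2) by (auto simp: mem_ball subset_iff)
    qed
    have der1: "((\<lambda>s. g (u + s *\<^sub>R v + r *\<^sub>R w)) has_real_derivative g' (u + s *\<^sub>R v + r *\<^sub>R w) v) (at s)"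
      if "0 \<le> s" "s \<le> t" "0 \<le> r" "r \<le> t" for s r
    proof -
      have "((\<lambda>s. u + s *\<^sub>R v + r *\<^sub>R w) has_derivative (\<lambda>h. h *\<^sub>R v)) (at s)"
        by (auto intro!: derivative_eq_intros)
      from has_derivative_compose[OF this g[OF inU[OF that]]]
      have "((\<lambda>s. g (u + s *\<^sub>R v + r *\<^sub>R w)) has_derivative (\<lambda>h. g' (u + s *\<^sub>R v + r *\<^sub>R w) (h *\<^sub>R v))) (at s)" .
      moreover have "g' (u + s *\<^sub>R v + r *\<^sub>R w) (h *\<^sub>R v) = g' (u + s *\<^sub>R v + r *\<^sub>R w) v * h" for h
        using linear_scale[OF has_derivative_linear[OF g[OF inU[OF that]]], of h v] by simp
      ultimately show ?thesis by (simp add: has_field_derivative_def)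
    qed
    have der: "(\<phi> has_real_derivative \<phi>' s) (at s)" if "0 \<le> s" "s \<le> t" for s
      unfolding \<phi>_def \<phi>'_def
      using der1[of s t] der1[of s 0] that t by (intro DERIV_diff) auto
    obtain s where s: "0 < s" "s < t" "\<phi> t - \<phi> 0 = (t - 0) * \<phi>' s"
      using MVT2[of 0 t \<phi> \<phi>'] t der by auto
    have q: "\<phi> t - \<phi> 0 = g (u + t *\<^sub>R v + t *\<^sub>R w) - g (u + t *\<^sub>R v) - g (u + t *\<^sub>R w) + g u"
      unfolding \<phi>_def by simp
    have e1: "\<bar>g' (u + s *\<^sub>R v + t *\<^sub>R w) v - g' u v - L (s *\<^sub>R v + t *\<^sub>R w)\<bar> \<le> \<eta> * (t * K)"
    proof -
      have "norm (g' (u + s *\<^sub>R v + t *\<^sub>R w) v - g' u v - L (u + s *\<^sub>R v + t *\<^sub>R w - u)) \<le> \<eta> * norm (u + s *\<^sub>R v + t *\<^sub>R w - u)"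
        using small[of s t] s t by (intro d(2)) (auto simp: add.assoc)
      also have "u + s *\<^sub>R v + t *\<^sub>R w - u = s *\<^sub>R v + t *\<^sub>R w" by simp
      also have "\<eta> * norm (s *\<^sub>R v + t *\<^sub>R w) \<le> \<eta> * (t * K)"
        using small[of s t] s t \<eta> by (intro mult_left_mono) auto
      finally show ?thesis by simp
    qed
    have e2: "\<bar>g' (u + s *\<^sub>R v) v - g' u v - L (s *\<^sub>R v)\<bar> \<le> \<eta> * (t * K)"
    proof -
      have "norm (g' (u + s *\<^sub>R v) v - g' u v - L (u + s *\<^sub>R v - u)) \<le> \<eta> * norm (u + s *\<^sub>R v - u)"
        using small[of s 0] s t by (intro d(2)) (auto simp: add.assoc)
      also have "u + s *\<^sub>R v - u = s *\<^sub>R v" by simp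
      also have "\<eta> * norm (s *\<^sub>R v) \<le> \<eta> * (t * K)"
        using small[of s 0] s t \<eta> by (intro mult_left_mono) auto
      finally show ?thesis by simp
    qed
    have Lw: "L (s *\<^sub>R v + t *\<^sub>R w) = L (s *\<^sub>R v) + t * L w"
      using linL by (simp add: linear_add linear_scale)
    have "\<bar>\<phi>' s - t * L w\<bar> \<le> 2 * (\<eta> * (t * K))"
      using e1 e2 unfolding \<phi>'_def Lw by linarith
    also have "2 * (\<eta> * (t * K)) = t * (e / 2)" using K by (simp add: \<eta>_def)
    finally have "\<bar>\<phi>' s - t * L w\<bar> \<le> t * (e / 2)" .
    moreover have "(\<phi> t - \<phi> 0) / t\<^sup>2 - L w = (\<phi>' s - t * L w) / t"
      using t s(3) by (simp add: power2_eq_square field_simps)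
    ultimately have "\<bar>(\<phi> t - \<phi> 0) / t\<^sup>2 - L w\<bar> \<le> e / 2"
      using t by (simp add: abs_divide pos_divide_le_eq mult.commute)
    then show ?thesis using e unfolding q dist_real_def by linarith
  qed
  show "\<forall>\<^sub>F t in at_right 0. dist ((g (u + t *\<^sub>R v + t *\<^sub>R w) - g (u + t *\<^sub>R v) - g (u + t *\<^sub>R w) + g u) / t\<^sup>2) (L w) < e"
    unfolding eventually_at_right_field using est b by blast
qed

lemma symmetric_second_derivative_real:
  fixes g :: "'a::real_normed_vector \<Rightarrow> real"
  assumes U: "open U" "u \<in> U" and g: "\<And>z. z \<in> U \<Longrightarrow> (g has_derivative g' z) (at z)"
    and L: "((\<lambda>z. g' z v) has_derivative L) (at u)"
    and L': "((\<lambda>z. g' z w) has_derivative L') (at u)"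
  shows "L w = L' v"
proof -
  have "((\<lambda>t. (g (u + t *\<^sub>R v + t *\<^sub>R w) - g (u + t *\<^sub>R v) - g (u + t *\<^sub>R w) + g u) / t\<^sup>2) \<longlongrightarrow> L w) (at_right 0)"
    by (rule second_difference_limit[OF U g L])
  moreover have "((\<lambda>t. (g (u + t *\<^sub>R v + t *\<^sub>R w) - g (u + t *\<^sub>R v) - g (u + t *\<^sub>R w) + g u) / t\<^sup>2) \<longlongrightarrow> L' v) (at_right 0)"
    using second_difference_limit[OF U g L', of v] by (simp add: algebra_simps)
  ultimately show ?thesis
    by (rule tendsto_unique[OF trivial_limit_at_right_real])
qed

lemma symmetric_second_derivative:
  fixes g :: "'a::real_normed_vector \<Rightarrow> 'b::euclidean_space"
  assumes U: "open U" "u \<in> U" and g: "\<And>z. z \<in> U \<Longrightarrow> (g has_derivative g' z) (at z)"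
    and L: "((\<lambda>z. g' z v) has_derivative L) (at u)"
    and L': "((\<lambda>z. g' z w) has_derivative L') (at u)"
  shows "L w = L' v"
proof (rule euclidean_eqI)
  fix b :: 'b
  assume "b \<in> Basis"
  show "L w \<bullet> b = L' v \<bullet> b"
    by (rule symmetric_second_derivative_real[OF U, of "\<lambda>z. g z \<bullet> b" "\<lambda>z x. g' z x \<bullet> b"])
      (auto intro!: has_derivative_inner_left g L L')
qed

section \<open>Charts, tangent spaces and differentials\<close>

lemma smooth_on_has_derivative:
  assumes "smooth_on U f" "z \<in> U"
  shows "(f has_derivative frechet_derivative f (at z)) (at z)"
proof -
  have "Ck_on (Suc 0) U f" using assms(1) unfolding smooth_on_def by blast
  then show ?thesis using assms(2) by (simp flip: frechet_derivative_works)
qed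

lemma smooth_on_derivative_differentiable:
  assumes "smooth_on U f" "z \<in> U"
  shows "(\<lambda>y. frechet_derivative f (at y) v) differentiable (at z)"
proof -
  have "Ck_on (Suc (Suc 0)) U f" using assms(1) unfolding smooth_on_def by blast
  then show ?thesis using assms(2) by simp
qed

lemma smooth_on_continuous:
  assumes "smooth_on U f"
  shows "continuous_on U f"
  using assms smooth_on_def[of U f] Ck_on.simps(1)[of U f] by blast

text \<open>Differentiating \<open>x (y (\<alpha> t)) = \<alpha> t\<close> at 0 gives
  \<open>v = x' (y' v)\<close>.\<close>

lemma vector_derivative_in_tangent_space_range:
  fixes x :: "'c::real_normed_vector \<Rightarrow> 'a::real_normed_vector"
  assumes x: "(x has_derivative x') (at (y (\<alpha> 0)))" and y: "(y has_derivative y') (at (\<alpha> 0))"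
    and e: "0 < e" "\<And>t. t \<in> {-e<..<e} \<Longrightarrow> x (y (\<alpha> t)) = \<alpha> t"
    and \<alpha>: "(\<alpha> has_vector_derivative v) (at (0::real))"
  shows "v \<in> range x'"
proof -
  have "((\<lambda>t. x (y (\<alpha> t))) has_derivative (\<lambda>h. x' (y' (h *\<^sub>R v)))) (at 0)"
    using has_derivative_compose[OF has_derivative_compose[OF \<alpha>[unfolded has_vector_derivative_def] y] x] .
  then have "(\<alpha> has_derivative (\<lambda>h. x' (y' (h *\<^sub>R v)))) (at 0)"
    by (rule has_derivative_transform_within_open[of _ _ _ _ "{-e<..<e}"]) (use e in auto)
  then have "(\<lambda>h. h *\<^sub>R v) = (\<lambda>h. x' (y' (h *\<^sub>R v)))"
    using \<alpha> unfolding has_vector_derivative_def by (rule has_derivative_unique[rotated])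
  then have "v = x' (y' v)" by (metis scaleR_one)
  then show ?thesis by blast
qed

text \<open>The left inverse \<open>y\<close> makes the derivative of \<open>x\<close> injective and
  puts velocities of curves in \<open>M\<close> into its range; images of straight lines through
  \<open>u\<close> give the other inclusion.\<close>

lemma manifold3_chart:
  fixes M :: "'a::euclidean_space set"
  assumes "manifold3 M" "p \<in> M"
  obtains U :: "(real^3) set" and x u where "open U" "u \<in> U" "x u = p" "x ` U \<subseteq> M" "smooth_on U x"
    "inj (frechet_derivative x (at u))" "tangent_space M p = range (frechet_derivative x (at u))"
proof -
  obtain V and U :: "(real^3) set" and x y where V: "open V" "p \<in> V" and U: "open U"
    and sx: "smooth_on U x" and sy: "smooth_on V y" and xU: "x ` U = M \<inter> V" and yx: "\<And>u. u \<in> U \<Longrightarrow> y (x u) = u"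
    using assms unfolding manifold3_def by metis
  obtain u where u: "u \<in> U" "x u = p" using xU V assms by (metis IntI imageE)
  let ?L = "frechet_derivative x (at u)"
  have dx: "(x has_derivative ?L) (at u)" using smooth_on_has_derivative[OF sx u(1)] .
  have dy: "(y has_derivative frechet_derivative y (at p)) (at p)" using smooth_on_has_derivative[OF sy V(2)] .
  have "((\<lambda>z. y (x z)) has_derivative (\<lambda>h. frechet_derivative y (at p) (?L h))) (at u)"
    using has_derivative_compose[OF dx] dy u by simp
  then have "((\<lambda>z. z) has_derivative (\<lambda>h. frechet_derivative y (at p) (?L h))) (at u)"
    by (rule has_derivative_transform_within_open[OF _ U u(1)]) (simp add: yx)
  then have yL: "frechet_derivative y (at p) (?L h) = h" for h
    using has_derivative_unique[OF has_derivative_ident] by metis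
  have inj: "inj ?L" by (metis injI yL)
  have "v \<in> range ?L" if tv: "v \<in> tangent_space M p" for v
  proof -
    obtain \<alpha> e where \<alpha>: "0 < e" "\<And>t. t \<in> {-e<..<e} \<Longrightarrow> \<alpha> t \<in> M" "\<alpha> 0 = p" "(\<alpha> has_vector_derivative v) (at (0::real))"
      using tv unfolding tangent_space_def by blast
    have "continuous (at 0) \<alpha>" using \<alpha>(4) has_derivative_continuous has_vector_derivative_def by blast
    then have "\<forall>\<^sub>F t in at 0. \<alpha> t \<in> V"
      using V \<alpha>(3) by (simp add: continuous_at topological_tendstoD)
    then obtain d where d: "d > 0" "\<And>t. t \<noteq> 0 \<Longrightarrow> dist t 0 < d \<Longrightarrow> \<alpha> t \<in> V"
      unfolding eventually_at by auto
    show ?thesis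
    proof (rule vector_derivative_in_tangent_space_range[OF _ _ _ _ \<alpha>(4)])
      show "(x has_derivative ?L) (at (y (\<alpha> 0)))" using dx yx[OF u(1)] u \<alpha>(3) by simp
      show "(y has_derivative frechet_derivative y (at p)) (at (\<alpha> 0))" using dy \<alpha>(3) by simp
      show "0 < min d e" using d \<alpha> by simp
      fix t assume t: "t \<in> {-min d e<..<min d e}"
      \<comment> \<open>The eventuality at 0 says nothing about \<open>t = 0\<close> itself, where
        \<open>\<alpha> 0 = p\<close> lies in \<open>V\<close>.\<close>
      have "\<alpha> t \<in> M \<inter> V" using t d(2)[of t] \<alpha>(2)[of t] \<alpha>(3) V by (cases "t = 0") auto
      then obtain z where "z \<in> U" "x z = \<alpha> t" using xU by (metis imageE)
      then show "x (y (\<alpha> t)) = \<alpha> t" using yx by metis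
    qed
  qed
  moreover have "?L w \<in> tangent_space M p" for w
  proof -
    have c: "((\<lambda>t. u + t *\<^sub>R w) has_derivative (\<lambda>h. h *\<^sub>R w)) (at (0::real))"
      by (auto intro!: derivative_eq_intros)
    have "((\<lambda>t. x (u + t *\<^sub>R w)) has_derivative (\<lambda>h. ?L (h *\<^sub>R w))) (at 0)"
      using has_derivative_compose[OF c] dx by simp
    then have dv: "((\<lambda>t. x (u + t *\<^sub>R w)) has_vector_derivative ?L w) (at 0)"
      unfolding has_vector_derivative_def
      using linear_scale[OF has_derivative_linear[OF dx]] by simp
    have "continuous (at 0) (\<lambda>t::real. u + t *\<^sub>R w)" by (intro continuous_intros)
    then have "\<forall>\<^sub>F t in at (0::real). u + t *\<^sub>R w \<in> U"
      using U u(1) by (simp add: continuous_at topological_tendstoD)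
    then obtain d where d: "d > 0" "\<And>t::real. t \<noteq> 0 \<Longrightarrow> dist t 0 < d \<Longrightarrow> u + t *\<^sub>R w \<in> U"
      unfolding eventually_at by auto
    have "\<forall>t\<in>{-d<..<d}. x (u + t *\<^sub>R w) \<in> M"
    proof
      fix t :: real assume "t \<in> {-d<..<d}"
      then have "u + t *\<^sub>R w \<in> U" using d(2)[of t] u(1) by (cases "t = 0") (auto simp: dist_real_def)
      then show "x (u + t *\<^sub>R w) \<in> M" using xU by blast
    qed
    then show ?thesis unfolding tangent_space_def mem_Collect_eq
      using dv d(1) u by (intro exI[of _ "\<lambda>t. x (u + t *\<^sub>R w)"] exI[of _ d]) auto
  qed
  ultimately have "tangent_space M p = range ?L" by blast
  moreover have "x ` U \<subseteq> M" using xU by blast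
  ultimately show thesis using that[OF U u(1) u(2) _ sx inj] by blast
qed

section \<open>Smooth maps on M read in a chart\<close>

lemma smooth_map_local:
  assumes "smooth_map M g" "open U" "u \<in> U" "x ` U \<subseteq> M" "continuous_on U x"
  obtains W V G where "open W" "u \<in> W" "W \<subseteq> U" "smooth_on V G" "open V" "\<And>z. z \<in> W \<Longrightarrow> x z \<in> V \<and> G (x z) = g (x z)"
proof -
  have "x u \<in> M" using assms by blast
  then obtain V G where V: "open V" "x u \<in> V" "smooth_on V G" "\<forall>q\<in>M \<inter> V. G q = g q"
    using assms(1) unfolding smooth_map_def by blast
  have "open (x -` V \<inter> U)" using assms V continuous_on_open_vimage by blast
  then show thesis using that[of "x -` V \<inter> U" V G] V assms by blast
qed

lemma smooth_map_comp_has_derivative: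
  assumes "smooth_map M g" "open U" "u \<in> U" "x ` U \<subseteq> M" "smooth_on U x"
  shows "((\<lambda>z. g (x z)) has_derivative frechet_derivative (\<lambda>z. g (x z)) (at u)) (at u)"
proof -
  obtain W V G where W: "open W" "u \<in> W" "W \<subseteq> U" "smooth_on V G" "open V" "\<And>z. z \<in> W \<Longrightarrow> x z \<in> V \<and> G (x z) = g (x z)"
    using smooth_map_local[OF assms(1-4) smooth_on_continuous[OF assms(5)]] by metis
  have "((\<lambda>z. G (x z)) has_derivative (\<lambda>h. frechet_derivative G (at (x u)) (frechet_derivative x (at u) h))) (at u)"
    using has_derivative_compose[OF smooth_on_has_derivative[OF assms(5,3)] smooth_on_has_derivative[OF W(4)]] W(2,6)
    by blast
  then have "((\<lambda>z. g (x z)) has_derivative (\<lambda>h. frechet_derivative G (at (x u)) (frechet_derivative x (at u) h))) (at u)"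
    by (rule has_derivative_transform_within_open[OF _ W(1,2)]) (use W in simp)
  then show ?thesis by (metis differentiable_def frechet_derivative_works)
qed

lemma smooth_map_comp_derivative_differentiable:
  fixes x :: "'c::euclidean_space \<Rightarrow> 'a::euclidean_space" and g :: "'a \<Rightarrow> 'b::real_normed_vector"
  assumes "smooth_map M g" "open U" "u \<in> U" "x ` U \<subseteq> M" "smooth_on U x"
  shows "(\<lambda>z. frechet_derivative (\<lambda>z. g (x z)) (at z) v) differentiable (at u)"
proof -
  obtain W V G where W: "open W" "u \<in> W" "W \<subseteq> U" "smooth_on V G" "open V" "\<And>z. z \<in> W \<Longrightarrow> x z \<in> V \<and> G (x z) = g (x z)"
    using smooth_map_local[OF assms(1-4) smooth_on_continuous[OF assms(5)]] by metis
  \<comment> \<open>\<open>smooth_on\<close> controls \<open>frechet_derivative G (at y) b\<close>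
    for a fixed vector \<open>b\<close>, but the chain rule inserts one that varies with
    \<open>z\<close>; expanding it in the basis reduces to fixed vectors.\<close>
  define H where "H = (\<lambda>z. \<Sum>b\<in>Basis. (frechet_derivative x (at z) v \<bullet> b) *\<^sub>R frechet_derivative G (at (x z)) b)"
  have H: "H z = frechet_derivative (\<lambda>z. g (x z)) (at z) v" if z: "z \<in> W" for z
  proof -
    have G: "(G has_derivative frechet_derivative G (at (x z))) (at (x z))"
      using smooth_on_has_derivative[OF W(4)] W(6) z by blast
    have "((\<lambda>z. G (x z)) has_derivative (\<lambda>h. frechet_derivative G (at (x z)) (frechet_derivative x (at z) h))) (at z)"
      using has_derivative_compose[OF smooth_on_has_derivative[OF assms(5)] G] W(3) z by blast
    then have "((\<lambda>z. g (x z)) has_derivative (\<lambda>h. frechet_derivative G (at (x z)) (frechet_derivative x (at z) h))) (at z)"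
      by (rule has_derivative_transform_within_open[OF _ W(1) z]) (use W in simp)
    then have "frechet_derivative (\<lambda>z. g (x z)) (at z) v = frechet_derivative G (at (x z)) (frechet_derivative x (at z) v)"
      using frechet_derivative_at by (metis (no_types, lifting))
    also have "\<dots> = frechet_derivative G (at (x z)) (\<Sum>b\<in>Basis. (frechet_derivative x (at z) v \<bullet> b) *\<^sub>R b)"
      by (simp add: euclidean_representation)
    also have "\<dots> = H z"
      using has_derivative_linear[OF G] unfolding H_def by (simp add: linear_sum linear_scale)
    finally show ?thesis by simp
  qed
  have "H differentiable (at u)"
    unfolding H_def
  proof (intro differentiable_sum finite_Basis ballI differentiable_scaleR)
    fix b :: 'a
    show "(\<lambda>z. frechet_derivative x (at z) v \<bullet> b) differentiable (at u)"
      using smooth_on_derivative_differentiable[OF assms(5,3)] by (simp add: differentiable_inner)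
    have "x differentiable (at u)"
      using smooth_on_has_derivative[OF assms(5,3)] differentiable_def by blast
    then show "(\<lambda>z. frechet_derivative G (at (x z)) b) differentiable (at u)"
      using smooth_on_derivative_differentiable[OF W(4), of "x u" b] W(2,6)
        differentiable_chain_at[of x u "\<lambda>y. frechet_derivative G (at y) b"] by (simp add: o_def)
  qed
  then obtain D where "(H has_derivative D) (at u)" unfolding differentiable_def by blast
  then have "((\<lambda>z. frechet_derivative (\<lambda>z. g (x z)) (at z) v) has_derivative D) (at u)"
    by (rule has_derivative_transform_within_open[OF _ W(1,2) H])
  then show ?thesis unfolding differentiable_def by blast
qed

lemma smooth_map_has_differential:
  assumes "smooth_map M g" "p \<in> M"
  shows "(g has_derivative differential M g p) (at p within M)"
proof -
  obtain V G where V: "open V" "p \<in> V" "smooth_on V G" "\<forall>q\<in>M \<inter> V. G q = g q"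
    using assms unfolding smooth_map_def by blast
  obtain d where d: "d > 0" "ball p d \<subseteq> V" using V open_contains_ball by blast
  have "(G has_derivative frechet_derivative G (at p)) (at p within M)"
    using smooth_on_has_derivative[OF V(3,2)] has_derivative_at_withinI by blast
  then have "(g has_derivative frechet_derivative G (at p)) (at p within M)"
    by (rule has_derivative_transform_within[OF _ d(1) assms(2)])
      (use d V in \<open>auto simp: dist_commute subset_iff\<close>)
  then show ?thesis unfolding differential_def
    by (metis differentiable_def frechet_derivative_works)
qed

text \<open>A derivative within \<open>M\<close> is not unique, but composed with the chart it is a
  derivative at a point of an open set, where uniqueness holds.\<close>

lemma differential_chart:
  assumes "smooth_map M g" "open U" "u \<in> U" "x ` U \<subseteq> M" "(x has_derivative x') (at u)"
    and "((\<lambda>z. g (x z)) has_derivative D) (at u)"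
  shows "differential M g (x u) (x' w) = D w"
proof -
  have "(g has_derivative differential M g (x u)) (at (x u) within x ` U)"
    using smooth_map_has_differential[OF assms(1)] assms(3,4) has_derivative_subset by blast
  then have "((\<lambda>z. g (x z)) has_derivative (\<lambda>h. differential M g (x u) (x' h))) (at u within U)"
    by (rule has_derivative_in_compose[OF has_derivative_at_withinI[OF assms(5)]])
  then have "((\<lambda>z. g (x z)) has_derivative (\<lambda>h. differential M g (x u) (x' h))) (at u)"
    using at_within_open[OF assms(3,2)] by simp
  then show ?thesis using has_derivative_unique[OF assms(6)] by metis
qed

section \<open>The geometry of a space form\<close>

abbreviation smet :: "real \<Rightarrow> real^3 \<Rightarrow> real^3 \<Rightarrow> real" where
  "smet \<equiv> space_form_metric"

text \<open>The normal vector of the space form in its vector space: the position vector of a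
  quadric, a constant for the plane. The tangent plane at \<open>q\<close> is its orthogonal
  complement, and \<open>ssign c\<close> is its square.\<close>

definition snormal :: "real \<Rightarrow> real^3 \<Rightarrow> real^3" where
  "snormal c q = (if c = 0 then axis 3 1 else q)"

definition ssign :: "real \<Rightarrow> real" where
  "ssign c = (if c = -1 then -1 else 1)"

lemma bounded_bilinear_smet: "bounded_bilinear (smet c)"
proof
  show "\<exists>K. \<forall>a b. norm (smet c a b) \<le> norm a * norm b * K"
  proof (intro exI allI)
    fix a b :: "real^3"
    have *: "\<bar>a $ i * b $ i\<bar> \<le> norm a * norm b" for i
      unfolding abs_mult by (intro mult_mono component_le_norm_cart) auto
    have "\<bar>smet c a b\<bar> \<le> \<bar>a$1 * b$1\<bar> + \<bar>a$2 * b$2\<bar> + \<bar>a$3 * b$3\<bar>"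
      unfolding space_form_metric_def by (smt (verit))
    then show "norm (smet c a b) \<le> norm a * norm b * 3"
      using *[of 1] *[of 2] *[of 3] by simp
  qed
qed (auto simp: space_form_metric_def algebra_simps)

interpretation smet: bounded_bilinear "smet c" for c
  by (rule bounded_bilinear_smet)

lemmas smet_linear =
  smet.add_left smet.add_right smet.diff_left smet.diff_right smet.minus_left smet.minus_right
  smet.scaleR_left smet.scaleR_right smet.zero_left smet.zero_right

lemma smet_commute: "smet c v w = smet c w v"
  by (simp add: space_form_metric_def mult.commute)

lemma smet_snormal:
  assumes "c \<in> {1, 0, -1}" "q \<in> space_form c"
  shows "smet c (snormal c q) (snormal c q) = ssign c"
  using assms by (auto simp: space_form_def snormal_def ssign_def space_form_metric_def axis_def)

lemma smet_self:
  assumes "q \<in> space_form c" "c \<in> {1, -1}"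
  shows "smet c q q = c"
  using assms by (auto simp: space_form_def)

lemma smet_tangent_pos:
  assumes "c \<in> {1, 0, -1}" "q \<in> space_form c" "smet c v (snormal c q) = 0" "v \<noteq> 0"
  shows "smet c v v > 0"
proof -
  have v: "v$1 \<noteq> 0 \<or> v$2 \<noteq> 0 \<or> v$3 \<noteq> 0"
    using assms(4) by (auto simp: vec_eq_iff forall_3)
  show ?thesis
  proof (cases "c = -1")
    case True
    then have q: "(q$3)\<^sup>2 = 1 + (q$1)\<^sup>2 + (q$2)\<^sup>2" "q$3 > 0" and o: "v$3 * q$3 = v$1 * q$1 + v$2 * q$2"
      using assms by (auto simp: space_form_def snormal_def space_form_metric_def power2_eq_square)
    \<comment> \<open>The last coordinate of \<open>v\<close> is eliminated by orthogonality to
      \<open>q\<close>; what remains is Lagrange's identity in the plane.\<close>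
    have id: "(v$1 * v$1 + v$2 * v$2 - v$3 * v$3) * (q$3)\<^sup>2
        = (v$1)\<^sup>2 + (v$2)\<^sup>2 + (v$1 * q$2 - v$2 * q$1)\<^sup>2"
    proof -
      have "(v$1 * v$1 + v$2 * v$2 - v$3 * v$3) * (q$3)\<^sup>2
          = (v$1 * v$1 + v$2 * v$2) * (q$3)\<^sup>2 - (v$3 * q$3)\<^sup>2"
        by (simp add: power2_eq_square algebra_simps)
      also have "\<dots> = (v$1)\<^sup>2 + (v$2)\<^sup>2 + (v$1 * q$2 - v$2 * q$1)\<^sup>2"
        unfolding o q(1) by (simp add: power2_eq_square algebra_simps)
      finally show ?thesis .
    qed
    have "v$1 \<noteq> 0 \<or> v$2 \<noteq> 0" using v o q(2) by auto
    then have "(v$1)\<^sup>2 + (v$2)\<^sup>2 > 0" by (simp add: sum_power2_gt_zero_iff)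
    then have "(v$1 * v$1 + v$2 * v$2 - v$3 * v$3) * (q$3)\<^sup>2 > 0"
      unfolding id by (simp add: add_pos_nonneg)
    then have "v$1 * v$1 + v$2 * v$2 - v$3 * v$3 > 0"
      using q(2) by (simp add: zero_less_mult_iff)
    then show ?thesis using True by (simp add: space_form_metric_def)
  next
    case False
    have "v$1 * v$1 + v$2 * v$2 + v$3 * v$3 > 0"
      using v by (metis add_nonneg_pos add_pos_nonneg not_real_square_gt_zero zero_le_square add_nonneg_nonneg)
    then show ?thesis using False by (simp add: space_form_metric_def)
  qed
qed

text \<open>The Euclidean or Lorentzian cross product, according to the signature of the metric.\<close>

definition scross :: "real \<Rightarrow> real^3 \<Rightarrow> real^3 \<Rightarrow> real^3" where
  "scross c a b = vector [a$2 * b$3 - a$3 * b$2, a$3 * b$1 - a$1 * b$3, ssign c * (a$1 * b$2 - a$2 * b$1)]"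

lemma scross_orthogonal: "smet c (scross c a b) a = 0" "smet c (scross c a b) b = 0"
  by (simp_all add: scross_def space_form_metric_def ssign_def algebra_simps)

lemma smet_scross:
  "smet c (scross c a b) (scross c a b) = ssign c * (smet c a a * smet c b b - (smet c a b)\<^sup>2)"
  by (simp add: scross_def space_form_metric_def ssign_def power2_eq_square algebra_simps)

lemma scross_scross:
  "scross c z (scross c a b) = ssign c *\<^sub>R (smet c z b *\<^sub>R a - smet c z a *\<^sub>R b)"
  by (simp add: vec_eq_iff forall_3 scross_def space_form_metric_def ssign_def algebra_simps)

text \<open>\<open>n\<close> is the direction of \<open>v\<close>, or any unit tangent vector when
  \<open>v = 0\<close>, in which case \<open>b = 0\<close>; \<open>e\<close> is the cross product of
  the normal and \<open>n\<close>.\<close>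

lemma space_form_frame:
  assumes c: "c \<in> {1, 0, -1}" and q: "q \<in> space_form c" and v: "smet c v (snormal c q) = 0"
  obtains e n b where "smet c e (snormal c q) = 0" "smet c n (snormal c q) = 0"
    "smet c e e = 1" "smet c n n = 1" "smet c e n = 0" "v = b *\<^sub>R n"
    "\<And>w. smet c w (snormal c q) = 0 \<Longrightarrow> w = smet c w e *\<^sub>R e + smet c w n *\<^sub>R n"
proof -
  let ?\<nu> = "snormal c q"
  have "\<exists>w. w \<noteq> 0 \<and> smet c w ?\<nu> = 0 \<and> (\<exists>b. v = b *\<^sub>R w)"
  proof (cases "v = 0")
    case True
    define w :: "real^3" where
      "w = (if ?\<nu>$1 = 0 \<and> ?\<nu>$2 = 0 then vector [1, 0, 0] else vector [- ?\<nu>$2, ?\<nu>$1, 0])"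
    have "w \<noteq> 0" "smet c w ?\<nu> = 0"
      by (auto simp: w_def vec_eq_iff forall_3 space_form_metric_def)
    then show ?thesis using True by (metis scaleR_zero_left)
  next
    case False
    then show ?thesis using v by (metis scaleR_one)
  qed
  then obtain w b where w: "w \<noteq> 0" "smet c w ?\<nu> = 0" "v = b *\<^sub>R w" by blast
  have pos: "smet c w w > 0" by (rule smet_tangent_pos[OF c q w(2,1)])
  define n where "n = (1 / sqrt (smet c w w)) *\<^sub>R w"
  have n: "smet c n ?\<nu> = 0" "smet c n n = 1"
    using w pos by (auto simp: n_def smet_linear power2_eq_square simp flip: real_sqrt_mult)
  have vn: "v = (b * sqrt (smet c w w)) *\<^sub>R n" using w pos by (simp add: n_def)
  define e where "e = scross c ?\<nu> n"
  have s: "ssign c * ssign c = 1" by (simp add: ssign_def)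
  have e: "smet c e ?\<nu> = 0" "smet c e n = 0" unfolding e_def by (rule scross_orthogonal)+
  have ee: "smet c e e = 1"
    using smet_scross[of c ?\<nu> n] n smet_snormal[OF c q] s smet_commute[of c ?\<nu> n] by (simp add: e_def)
  have "w = smet c w e *\<^sub>R e + smet c w n *\<^sub>R n" if w: "smet c w ?\<nu> = 0" for w
  proof (rule ccontr)
    \<comment> \<open>The residue \<open>z\<close> is orthogonal to \<open>e\<close>,
      \<open>n\<close> and the normal. The double cross product formula gives
      \<open>scross c z e = 0\<close>, so \<open>z\<close> is a null vector, which positivity on the
      tangent plane excludes.\<close>
    define z where "z = w - smet c w e *\<^sub>R e - smet c w n *\<^sub>R n"
    assume "w \<noteq> smet c w e *\<^sub>R e + smet c w n *\<^sub>R n"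
    then have z0: "z \<noteq> 0" unfolding z_def by (simp add: algebra_simps)
    have z: "smet c z ?\<nu> = 0" "smet c z n = 0" "smet c z e = 0"
      unfolding z_def using w n e ee smet_commute[of c n e] by (auto simp: smet_linear)
    have "scross c z e = 0" unfolding e_def scross_scross using z by simp
    then have "0 = smet c (scross c z e) (scross c z e)" by (simp add: smet_linear)
    also have "\<dots> = ssign c * smet c z z" unfolding smet_scross using ee z by simp
    finally have "smet c z z = 0" by (simp add: ssign_def split: if_splits)
    then show False using smet_tangent_pos[OF c q z(1) z0] by simp
  qed
  then show thesis using that[OF e(1) n(1) ee n(2) e(2) vn] by blast
qed

text \<open>The geodesic through \<open>q\<close> with velocity \<open>v\<close> of any length; the
  frequency parameter is \<open>c\<close> times the squared speed, so that \<open>v = 0\<close> is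
  no exception.\<close>

definition sgeo :: "real \<Rightarrow> real^3 \<Rightarrow> real^3 \<Rightarrow> real \<Rightarrow> real^3" where
  "sgeo c q v t = cs (c * smet c v v) t *\<^sub>R q + sn (c * smet c v v) t *\<^sub>R v"

definition sgeo' :: "real \<Rightarrow> real^3 \<Rightarrow> real^3 \<Rightarrow> real \<Rightarrow> real^3" where
  "sgeo' c q v t = (- (c * smet c v v) * sn (c * smet c v v) t) *\<^sub>R q + cs (c * smet c v v) t *\<^sub>R v"

lemma has_vector_derivative_cs_sn:
  "((\<lambda>t. cs k t *\<^sub>R A + sn k t *\<^sub>R B) has_vector_derivative (cs k t *\<^sub>R B + sn k t *\<^sub>R (- k *\<^sub>R A))) (at t)"
  by (auto intro!: derivative_eq_intros DERIV_cs DERIV_sn simp: algebra_simps)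

lemma sgeo_has_vector_derivative: "(sgeo c q v has_vector_derivative sgeo' c q v t) (at t)"
  unfolding sgeo_def[abs_def] sgeo'_def
  using has_vector_derivative_cs_sn[of "c * smet c v v" q v t] by (simp add: algebra_simps)

lemma sgeo'_has_vector_derivative:
  "(sgeo' c q v has_vector_derivative - (c * smet c v v) *\<^sub>R sgeo c q v t) (at t)"
  unfolding sgeo_def sgeo'_def[abs_def]
  using has_vector_derivative_cs_sn[of "c * smet c v v" v "- (c * smet c v v) *\<^sub>R q" t]
  by (simp add: algebra_simps)

lemma sgeo_0 [simp]: "sgeo c q v 0 = q" "sgeo' c q v 0 = v"
  by (simp_all add: sgeo_def sgeo'_def)

lemma sgeo_scale: "sgeo c q (r *\<^sub>R v) 1 = sgeo c q v r"
  by (simp add: sgeo_def cs_def sn_def smet_linear power2_eq_square mult_ac)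

text \<open>Differentiation in the direction \<open>h\<close> replaces (A, B) by (h B, - h k A), so
  the induction stays within the family.\<close>

lemma Ck_on_cs_sn:
  fixes A B :: "'a::real_normed_vector"
  shows "Ck_on n UNIV (\<lambda>t. cs k t *\<^sub>R A + sn k t *\<^sub>R B)"
proof (induction n arbitrary: A B)
  case 0
  have "isCont (\<lambda>t. cs k t *\<^sub>R A + sn k t *\<^sub>R B) t" for t
    using has_vector_derivative_cs_sn[of k A B t] has_derivative_continuous has_vector_derivative_def by blast
  then show ?case by (simp add: continuous_at_imp_continuous_on)
next
  case (Suc n)
  have d: "((\<lambda>t. cs k t *\<^sub>R A + sn k t *\<^sub>R B) has_derivative (\<lambda>h. h *\<^sub>R (cs k t *\<^sub>R B + sn k t *\<^sub>R (- k *\<^sub>R A)))) (at t)" for t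
    using has_vector_derivative_cs_sn[of k A B t] unfolding has_vector_derivative_def .
  have "frechet_derivative (\<lambda>t. cs k t *\<^sub>R A + sn k t *\<^sub>R B) (at t) h
      = cs k t *\<^sub>R (h *\<^sub>R B) + sn k t *\<^sub>R (h *\<^sub>R (- k *\<^sub>R A))" for t h
    unfolding frechet_derivative_at[OF d, symmetric] by (simp add: algebra_simps)
  moreover have "(\<lambda>t. cs k t *\<^sub>R A + sn k t *\<^sub>R B) differentiable (at t)" for t
    using d unfolding differentiable_def by blast
  ultimately show ?case using Suc unfolding Ck_on.simps by presburger
qed

lemma Ck_on_Pair:
  assumes "Ck_on n UNIV f" "Ck_on n UNIV g"
  shows "Ck_on n UNIV (\<lambda>x. (f x, g x))"
  using assms
proof (induction n arbitrary: f g)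
  case 0
  then show ?case by (simp add: continuous_on_Pair)
next
  case (Suc n)
  have d: "((\<lambda>x. (f x, g x)) has_derivative (\<lambda>h. (frechet_derivative f (at x) h, frechet_derivative g (at x) h))) (at x)" for x
    using Suc.prems by (intro has_derivative_Pair) (auto simp flip: frechet_derivative_works)
  then have "(\<lambda>x. (f x, g x)) differentiable (at x)" for x
    unfolding differentiable_def by blast
  then show ?case using Suc unfolding Ck_on.simps frechet_derivative_at[OF d, symmetric] by blast
qed

lemma smet_sgeo:
  assumes c: "c \<in> {1, 0, -1}" and q: "q \<in> space_form c" and v: "smet c v (snormal c q) = 0"
  shows "smet c (sgeo' c q v t) (snormal c (sgeo c q v t)) = 0"
    and "c \<noteq> 0 \<Longrightarrow> smet c (sgeo c q v t) (sgeo c q v t) = c"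
proof -
  define k where "k = c * smet c v v"
  have "smet c (sgeo' c q v t) (snormal c (sgeo c q v t)) = 0 \<and>
      (c \<noteq> 0 \<longrightarrow> smet c (sgeo c q v t) (sgeo c q v t) = c)"
  proof (cases "c = 0")
    case True
    then show ?thesis using v by (simp add: snormal_def sgeo'_def smet_linear)
  next
    case False
    then have qq: "smet c q q = c" and vq: "smet c v q = 0" "smet c q v = 0"
      using smet_self[OF q] c v by (auto simp: snormal_def smet_commute)
    have cc: "c * c = 1" using False c by auto
    have vv: "smet c v v = c * k" using cc by (simp add: k_def flip: mult.assoc)
    have "smet c (sgeo c q v t) (sgeo c q v t) = c * ((cs k t)\<^sup>2 + k * (sn k t)\<^sup>2)"
      unfolding sgeo_def k_def[symmetric]
      by (simp add: smet_linear qq vq vv power2_eq_square algebra_simps)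
    moreover have "smet c (sgeo' c q v t) (sgeo c q v t) = 0"
      unfolding sgeo_def sgeo'_def k_def[symmetric]
      by (simp add: smet_linear qq vq vv power2_eq_square algebra_simps)
    ultimately show ?thesis using False by (simp add: cs_sn_squared snormal_def)
  qed
  then show "smet c (sgeo' c q v t) (snormal c (sgeo c q v t)) = 0"
    and "c \<noteq> 0 \<Longrightarrow> smet c (sgeo c q v t) (sgeo c q v t) = c" by auto
qed

lemma sgeo_in_space_form:
  assumes c: "c \<in> {1, 0, -1}" and q: "q \<in> space_form c" and v: "smet c v (snormal c q) = 0"
  shows "sgeo c q v t \<in> space_form c"
proof -
  consider "c = 0" | "c = 1" | "c = -1" using c by auto
  then show ?thesis
  proof cases
    case 1
    then show ?thesis using q v
      by (simp add: space_form_def snormal_def sgeo_def space_form_metric_def axis_def)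
  next
    case 2
    then show ?thesis using smet_sgeo(2)[OF assms] by (simp add: space_form_def)
  next
    case 3
    let ?g = "\<lambda>t. sgeo c q v t $ 3"
    \<comment> \<open>The equation of the hyperboloid admits both sheets. Its points have nonzero
      third coordinate, so a connected curve cannot leave the upper one.\<close>
    have nz: "?g t \<noteq> 0" for t
    proof
      assume "?g t = 0"
      moreover have "smet c (sgeo c q v t) (sgeo c q v t) = -1" using smet_sgeo(2)[OF assms] 3 by simp
      ultimately have "(sgeo c q v t $ 1)\<^sup>2 + (sgeo c q v t $ 2)\<^sup>2 = -1"
        using 3 by (simp add: space_form_metric_def power2_eq_square)
      then show False by (metis add_nonneg_nonneg not_one_le_zero neg_0_le_iff_le zero_le_power2)
    qed
    have "isCont (sgeo c q v) t" for t
      using sgeo_has_vector_derivative has_derivative_continuous has_vector_derivative_def by blast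
    then have "continuous_on UNIV ?g"
      by (intro continuous_on_component continuous_at_imp_continuous_on) auto
    then have con: "connected (range ?g)" using connected_continuous_image connected_UNIV by blast
    have g0: "?g 0 > 0" using q 3 by (simp add: space_form_def)
    have "?g t > 0"
    proof (rule ccontr)
      assume "\<not> ?g t > 0"
      then have "0 \<in> {?g t..?g 0}" using g0 by simp
      then have "0 \<in> range ?g" using connected_contains_Icc[OF con, of "?g t" "?g 0"] by blast
      then show False using nz by force
    qed
    then show ?thesis using smet_sgeo(2)[OF assms, of t] 3 by (simp add: space_form_def)
  qed
qed

section \<open>Uniqueness of geodesics in a space form\<close>

lemma second_order_ode_unique:
  fixes a :: "real \<Rightarrow> 'a::euclidean_space"
  assumes a: "\<And>t. (a has_vector_derivative a' t) (at t)"
    and a': "\<And>t. (a' has_vector_derivative - k *\<^sub>R a t) (at t)"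
  shows "a t = cs k t *\<^sub>R a 0 + sn k t *\<^sub>R a' 0"
proof -
  \<comment> \<open>\<open>F\<close> and \<open>G\<close> recover \<open>a 0\<close> and
    \<open>a' 0\<close> from the state at time \<open>t\<close> by the inverse of the fundamental
    matrix, which has determinant 1 by \<open>cs_sn_squared\<close>; along a solution they are
    constant.\<close>
  define F where "F = (\<lambda>t. cs k t *\<^sub>R a t - sn k t *\<^sub>R a' t)"
  define G where "G = (\<lambda>t. (k * sn k t) *\<^sub>R a t + cs k t *\<^sub>R a' t)"
  have "(F has_vector_derivative (cs k t *\<^sub>R a' t + (- k * sn k t) *\<^sub>R a t -
      (sn k t *\<^sub>R (- k *\<^sub>R a t) + cs k t *\<^sub>R a' t))) (at t)" for t
    unfolding F_def
    by (intro has_vector_derivative_diff has_vector_derivative_scaleR DERIV_cs DERIV_sn a a')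
  then have F: "(F has_vector_derivative 0) (at t)" for t by (simp add: algebra_simps)
  have "(G has_vector_derivative ((k * sn k t) *\<^sub>R a' t + (k * cs k t) *\<^sub>R a t +
      (cs k t *\<^sub>R (- k *\<^sub>R a t) + (- k * sn k t) *\<^sub>R a' t))) (at t)" for t
    unfolding G_def
    by (intro has_vector_derivative_add has_vector_derivative_scaleR DERIV_cmult DERIV_cs DERIV_sn a a')
  then have G: "(G has_vector_derivative 0) (at t)" for t by (simp add: algebra_simps)
  have const: "H s = H 0" if "\<And>t. (H has_vector_derivative 0) (at t)" for H :: "real \<Rightarrow> 'a" and s
    using has_derivative_zero_unique[of UNIV H s 0] that
    by (auto simp: has_vector_derivative_def)
  have "a t = ((cs k t)\<^sup>2 + k * (sn k t)\<^sup>2) *\<^sub>R a t" by (simp add: cs_sn_squared)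
  also have "\<dots> = cs k t *\<^sub>R F t + sn k t *\<^sub>R G t"
    by (simp add: F_def G_def power2_eq_square algebra_simps)
  also have "\<dots> = cs k t *\<^sub>R F 0 + sn k t *\<^sub>R G 0" using const[OF F] const[OF G] by metis
  finally show ?thesis by (simp add: F_def G_def)
qed

lemma space_form_curve_tangent:
  assumes c: "c \<in> {1, 0, -1}" and e: "0 < e" "\<And>t. t \<in> {-e<..<e} \<Longrightarrow> a (s + t) \<in> space_form c"
    and a: "(a has_vector_derivative v) (at (s::real))"
  shows "smet c v (snormal c (a s)) = 0"
proof -
  have nb: "open {s-e<..<s+e}" "s \<in> {s-e<..<s+e}" using e by auto
  have in': "a t \<in> space_form c" if "t \<in> {s-e<..<s+e}" for t
    using e(2)[of "t - s"] that by simp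
  show ?thesis
  proof (cases "c = 0")
    case True
    have "((\<lambda>t. a t $ 3) has_vector_derivative v $ 3) (at s)"
      using a by (rule bounded_linear.has_vector_derivative[OF bounded_linear_vec_nth])
    moreover have "((\<lambda>t. a t $ 3) has_vector_derivative 0) (at s)"
      by (rule has_vector_derivative_transform_within_open[OF has_vector_derivative_const nb])
        (use in' True in \<open>auto simp: space_form_def\<close>)
    ultimately have "v $ 3 = 0" by (rule vector_derivative_unique_at)
    then show ?thesis using True by (simp add: snormal_def space_form_metric_def axis_def)
  next
    case False
    have "((\<lambda>t. smet c (a t) (a t)) has_vector_derivative (smet c (a s) v + smet c v (a s))) (at s)"
      by (rule smet.has_vector_derivative[OF a a])
    moreover have "((\<lambda>t. smet c (a t) (a t)) has_vector_derivative 0) (at s)"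
      by (rule has_vector_derivative_transform_within_open[OF has_vector_derivative_const nb])
        (use in' False c in \<open>auto simp: smet_self\<close>)
    ultimately have "smet c (a s) v + smet c v (a s) = 0" by (rule vector_derivative_unique_at)
    then show ?thesis using False by (simp add: snormal_def smet_commute)
  qed
qed

text \<open>On a quadric, differentiating the orthogonality of velocity and position shows that the
  acceleration is \<open>- c\<close> times the squared speed times the position; as the speed is
  constant, the geodesic equation becomes linear. In the plane the acceleration is zero.\<close>

lemma space_form_geodesic_unique:
  fixes a :: "real \<Rightarrow> real^3"
  assumes c: "c \<in> {1, 0, -1}" and aQ: "\<And>t. a t \<in> space_form c"
    and a: "\<And>t. (a has_vector_derivative a' t) (at t)"
    and a': "\<And>t. (a' has_vector_derivative a'' t) (at t)"
    and geo: "\<And>t. a'' t = (ssign c * smet c (a'' t) (snormal c (a t))) *\<^sub>R snormal c (a t)"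
  shows "a t = sgeo c (a 0) (a' 0) t"
proof -
  have tan: "smet c (a' t) (snormal c (a t)) = 0" for t
    by (rule space_form_curve_tangent[OF c zero_less_one _ a]) (simp add: aQ)
  have ode: "a'' t = - (c * smet c (a' 0) (a' 0)) *\<^sub>R a t" for t
  proof (cases "c = 0")
    case True
    have "((\<lambda>t. smet c (a' t) (snormal c (a t))) has_vector_derivative smet c (a'' t) (axis 3 1)) (at t)"
      using True bounded_linear.has_vector_derivative[OF smet.bounded_linear_left a', of c "axis 3 1" t]
      by (simp add: snormal_def)
    moreover have "(\<lambda>t. smet c (a' t) (snormal c (a t))) = (\<lambda>t. 0)" using tan by simp
    ultimately have "((\<lambda>t. 0::real) has_vector_derivative smet c (a'' t) (axis 3 1)) (at t)" by simp
    then have "smet c (a'' t) (axis 3 1) = 0"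
      using vector_derivative_unique_at has_vector_derivative_const by blast
    then show ?thesis using geo[of t] True by (simp add: snormal_def)
  next
    case False
    then have ta: "smet c (a' t) (a t) = 0" for t using tan[of t] by (simp add: snormal_def)
    have sc: "ssign c = c" using c False by (auto simp: ssign_def)
    have "((\<lambda>t. smet c (a' t) (a t)) has_vector_derivative (smet c (a' t) (a' t) + smet c (a'' t) (a t))) (at t)" for t
      by (rule smet.has_vector_derivative[OF a' a])
    moreover have "(\<lambda>t. smet c (a' t) (a t)) = (\<lambda>t. 0)" using ta by simp
    ultimately have "((\<lambda>t. 0::real) has_vector_derivative (smet c (a' t) (a' t) + smet c (a'' t) (a t))) (at t)" for t by simp
    then have "smet c (a' t) (a' t) + smet c (a'' t) (a t) = 0" for t
      using vector_derivative_unique_at has_vector_derivative_const by blast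
    then have "smet c (a'' t) (a t) = - smet c (a' t) (a' t)" for t by (simp add: eq_neg_iff_add_eq_0 add.commute)
    then have a'': "a'' t = (- (c * smet c (a' t) (a' t))) *\<^sub>R a t" for t
      using geo[of t] False sc by (simp add: snormal_def)
    have "((\<lambda>t. smet c (a' t) (a' t)) has_vector_derivative (smet c (a' t) (a'' t) + smet c (a'' t) (a' t))) (at t)" for t
      by (rule smet.has_vector_derivative[OF a' a'])
    moreover have "smet c (a' t) (a'' t) + smet c (a'' t) (a' t) = 0" for t
      unfolding a'' using ta[of t] by (simp add: smet_linear smet_commute[of c "a t"])
    ultimately have "((\<lambda>t. smet c (a' t) (a' t)) has_vector_derivative 0) (at t)" for t by simp
    then have "smet c (a' t) (a' t) = smet c (a' 0) (a' 0)"
      using has_derivative_zero_unique[of UNIV "\<lambda>t. smet c (a' t) (a' t)" t 0]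
      by (auto simp: has_vector_derivative_def)
    then show ?thesis using a''[of t] by simp
  qed
  have "(a' has_vector_derivative - (c * smet c (a' 0) (a' 0)) *\<^sub>R a t) (at t)" for t
    using a'[of t] ode[of t] by simp
  from second_order_ode_unique[OF a this, of t] show ?thesis by (simp add: sgeo_def)
qed

section \<open>The product of two space forms\<close>

definition tangent_to :: "real \<Rightarrow> real \<Rightarrow> (real^3) \<times> (real^3) \<Rightarrow> (real^3) \<times> (real^3) \<Rightarrow> bool" where
  "tangent_to c1 c2 q v \<longleftrightarrow> smet c1 (fst v) (snormal c1 (fst q)) = 0 \<and> smet c2 (snd v) (snormal c2 (snd q)) = 0"

lemma tangent_space_product:
  assumes c: "c1 \<in> {1, 0, -1}" "c2 \<in> {1, 0, -1}" and q: "q \<in> space_form c1 \<times> space_form c2"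
  shows "v \<in> tangent_space (space_form c1 \<times> space_form c2) q \<longleftrightarrow> tangent_to c1 c2 q v"
proof
  assume "v \<in> tangent_space (space_form c1 \<times> space_form c2) q"
  then obtain a e where a: "0 < e" "\<And>t. t \<in> {-e<..<e} \<Longrightarrow> a t \<in> space_form c1 \<times> space_form c2"
    "a 0 = q" "(a has_vector_derivative v) (at (0::real))"
    unfolding tangent_space_def by blast
  have "((\<lambda>t. fst (a t)) has_vector_derivative fst v) (at 0)" "((\<lambda>t. snd (a t)) has_vector_derivative snd v) (at 0)"
    using a(4) bounded_linear.has_vector_derivative[OF bounded_linear_fst]
      bounded_linear.has_vector_derivative[OF bounded_linear_snd] by blast+
  then have "smet c1 (fst v) (snormal c1 (fst (a 0))) = 0" "smet c2 (snd v) (snormal c2 (snd (a 0))) = 0"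
    using a(1,2) by (auto intro!: space_form_curve_tangent[OF c(1) a(1)] space_form_curve_tangent[OF c(2) a(1)]
      simp: mem_Times_iff)
  then show "tangent_to c1 c2 q v" using a(3) by (simp add: tangent_to_def)
next
  assume "tangent_to c1 c2 q v"
  then have v: "smet c1 (fst v) (snormal c1 (fst q)) = 0" "smet c2 (snd v) (snormal c2 (snd q)) = 0"
    by (auto simp: tangent_to_def)
  let ?a = "\<lambda>t. (sgeo c1 (fst q) (fst v) t, sgeo c2 (snd q) (snd v) t)"
  have "(?a has_vector_derivative (sgeo' c1 (fst q) (fst v) 0, sgeo' c2 (snd q) (snd v) 0)) (at 0)"
    by (intro has_vector_derivative_Pair sgeo_has_vector_derivative)
  then have "(?a has_vector_derivative v) (at 0)" by simp
  moreover have "\<forall>t\<in>{-1<..<1}. ?a t \<in> space_form c1 \<times> space_form c2"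
    using sgeo_in_space_form[OF c(1) _ v(1)] sgeo_in_space_form[OF c(2) _ v(2)] q by (auto simp: mem_Times_iff)
  ultimately show "v \<in> tangent_space (space_form c1 \<times> space_form c2) q"
    unfolding tangent_space_def mem_Collect_eq
    by (intro exI[of _ ?a] exI[of _ "1::real"]) auto
qed

text \<open>For uniqueness in the definite description: the difference \<open>d\<close> of two
  candidates is tangent and orthogonal to itself, and the metric is definite on tangent
  vectors.\<close>

lemma tangential_part_product:
  assumes c: "c1 \<in> {1, 0, -1}" "c2 \<in> {1, 0, -1}" and q: "q \<in> space_form c1 \<times> space_form c2"
    and u: "tangent_to c1 c2 q u"
  shows "tangential_part (product_metric c1 c2) (space_form c1 \<times> space_form c2) q
    (u + (\<alpha> *\<^sub>R snormal c1 (fst q), \<beta> *\<^sub>R snormal c2 (snd q))) = u"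
  unfolding tangential_part_def
proof (rule the_equality)
  let ?w = "u + (\<alpha> *\<^sub>R snormal c1 (fst q), \<beta> *\<^sub>R snormal c2 (snd q))"
  note T = tangent_space_product[OF c q]
  have orth: "product_metric c1 c2 (?w - u) t = 0" if "tangent_to c1 c2 q t" for t
    using that by (simp add: product_metric_def smet_linear tangent_to_def smet_commute[of _ "snormal _ _"])
  then show "u \<in> tangent_space (space_form c1 \<times> space_form c2) q \<and>
    (\<forall>t\<in>tangent_space (space_form c1 \<times> space_form c2) q. product_metric c1 c2 (?w - u) t = 0)"
    using T u by blast
  fix u'
  assume u': "u' \<in> tangent_space (space_form c1 \<times> space_form c2) q \<and>
    (\<forall>t\<in>tangent_space (space_form c1 \<times> space_form c2) q. product_metric c1 c2 (?w - u') t = 0)"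
  define d where "d = u - u'"
  have d: "tangent_to c1 c2 q d"
    using u u' T unfolding d_def tangent_to_def by (simp add: smet_linear)
  then have "product_metric c1 c2 (?w - u') d = 0" using u' T by blast
  then have "product_metric c1 c2 d d = 0" using orth[OF d]
    by (simp add: product_metric_def d_def smet_linear)
  then have "smet c1 (fst d) (fst d) + smet c2 (snd d) (snd d) = 0" by (simp add: product_metric_def)
  moreover have "fst d \<noteq> 0 \<Longrightarrow> smet c1 (fst d) (fst d) > 0"
    using smet_tangent_pos[OF c(1), of "fst q" "fst d"] q d by (simp add: tangent_to_def mem_Times_iff)
  moreover have "snd d \<noteq> 0 \<Longrightarrow> smet c2 (snd d) (snd d) > 0"
    using smet_tangent_pos[OF c(2), of "snd q" "snd d"] q d by (simp add: tangent_to_def mem_Times_iff)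
  ultimately have "fst d = 0 \<and> snd d = 0"
    by (metis add.left_neutral add.right_neutral add_pos_pos less_irrefl smet.zero_left)
  then have "d = 0" by (simp add: prod_eq_iff)
  then show "u' = u" by (simp add: d_def)
qed

text \<open>As \<open>ssign c\<close> is its own inverse, multiplying by it divides by the square of
  the normal vector.\<close>

lemma tangential_part_product_eq:
  assumes c: "c1 \<in> {1, 0, -1}" "c2 \<in> {1, 0, -1}" and q: "q \<in> space_form c1 \<times> space_form c2"
  shows "tangential_part (product_metric c1 c2) (space_form c1 \<times> space_form c2) q w =
    w - ((ssign c1 * smet c1 (fst w) (snormal c1 (fst q))) *\<^sub>R snormal c1 (fst q),
         (ssign c2 * smet c2 (snd w) (snormal c2 (snd q))) *\<^sub>R snormal c2 (snd q))"
proof -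
  let ?n = "((ssign c1 * smet c1 (fst w) (snormal c1 (fst q))) *\<^sub>R snormal c1 (fst q),
         (ssign c2 * smet c2 (snd w) (snormal c2 (snd q))) *\<^sub>R snormal c2 (snd q))"
  have s: "ssign c * ssign c = 1" "ssign c * (x * ssign c) = x" for c x by (auto simp: ssign_def)
  have "tangent_to c1 c2 q (w - ?n)"
    using q smet_snormal[OF c(1), of "fst q"] smet_snormal[OF c(2), of "snd q"] s
    by (simp add: tangent_to_def smet_linear mem_Times_iff mult.assoc)
  from tangential_part_product[OF c q this,
      of "ssign c1 * smet c1 (fst w) (snormal c1 (fst q))" "ssign c2 * smet c2 (snd w) (snormal c2 (snd q))"]
  show ?thesis by simp
qed

section \<open>Geodesics and the exponential map of the product\<close>

lemma differential_UNIV_has_vector_derivative: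
  fixes g :: "real \<Rightarrow> 'b::real_normed_vector"
  assumes "g differentiable (at t)"
  shows "(g has_vector_derivative differential UNIV g t 1) (at t)"
proof -
  have d: "(g has_derivative frechet_derivative g (at t)) (at t)"
    using assms frechet_derivative_works by blast
  have "frechet_derivative g (at t) h = h *\<^sub>R frechet_derivative g (at t) 1" for h
    using linear_scale[OF has_derivative_linear[OF d], of h 1] by simp
  then show ?thesis using d unfolding differential_def has_vector_derivative_def
    by (metis (no_types, lifting) ext)
qed

lemma geodesic_product_unique:
  assumes c: "c1 \<in> {1, 0, -1}" "c2 \<in> {1, 0, -1}"
    and \<gamma>: "geodesic (product_metric c1 c2) (space_form c1 \<times> space_form c2) \<gamma>"
      "\<gamma> 0 = q" "vector_derivative \<gamma> (at 0) = v"
  shows "\<gamma> t = (sgeo c1 (fst q) (fst v) t, sgeo c2 (snd q) (snd v) t)"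
proof -
  define \<gamma>' where "\<gamma>' = (\<lambda>s. vector_derivative \<gamma> (at s))"
  define \<gamma>'' where "\<gamma>'' = (\<lambda>s. differential UNIV \<gamma>' s 1)"
  have sm: "smooth_on UNIV \<gamma>" and P: "\<And>s. \<gamma> s \<in> space_form c1 \<times> space_form c2"
    and tp: "\<And>s. tangential_part (product_metric c1 c2) (space_form c1 \<times> space_form c2) (\<gamma> s) (\<gamma>'' s) = 0"
    using \<gamma>(1) unfolding geodesic_def covariant_derivative_def \<gamma>'_def \<gamma>''_def by blast+
  have d1: "(\<gamma> has_derivative frechet_derivative \<gamma> (at s)) (at s)" for s
    using smooth_on_has_derivative[OF sm] by blast
  have dif: "\<gamma> differentiable (at s)" for s
    using d1 unfolding differentiable_def by blast
  have g1: "(\<gamma> has_vector_derivative \<gamma>' s) (at s)" for s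
    using dif vector_derivative_works unfolding \<gamma>'_def by blast
  have "\<gamma>' s = frechet_derivative \<gamma> (at s) 1" for s
    using has_derivative_unique[OF d1 g1[unfolded has_vector_derivative_def]] by simp
  then have "\<gamma>' = (\<lambda>s. frechet_derivative \<gamma> (at s) 1)" by blast
  then have "\<gamma>' differentiable (at s)" for s
    using smooth_on_derivative_differentiable[OF sm, of s 1] by simp
  then have g2: "(\<gamma>' has_vector_derivative \<gamma>'' s) (at s)" for s
    unfolding \<gamma>''_def by (rule differential_UNIV_has_vector_derivative)
  have e: "\<gamma>'' s = ((ssign c1 * smet c1 (fst (\<gamma>'' s)) (snormal c1 (fst (\<gamma> s)))) *\<^sub>R snormal c1 (fst (\<gamma> s)),
         (ssign c2 * smet c2 (snd (\<gamma>'' s)) (snormal c2 (snd (\<gamma> s)))) *\<^sub>R snormal c2 (snd (\<gamma> s)))" for s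
    using tp[of s] unfolding tangential_part_product_eq[OF c P] by simp
  note bf = bounded_linear.has_vector_derivative[OF bounded_linear_fst]
    and bs = bounded_linear.has_vector_derivative[OF bounded_linear_snd]
  have e1: "fst (\<gamma>'' s) = (ssign c1 * smet c1 (fst (\<gamma>'' s)) (snormal c1 (fst (\<gamma> s)))) *\<^sub>R snormal c1 (fst (\<gamma> s))" for s
    using arg_cong[OF e, of fst] by simp
  have e2: "snd (\<gamma>'' s) = (ssign c2 * smet c2 (snd (\<gamma>'' s)) (snormal c2 (snd (\<gamma> s)))) *\<^sub>R snormal c2 (snd (\<gamma> s))" for s
    using arg_cong[OF e, of snd] by simp
  have "fst (\<gamma> t) = sgeo c1 (fst (\<gamma> 0)) (fst (\<gamma>' 0)) t"
    by (rule space_form_geodesic_unique[OF c(1) _ bf[OF g1] bf[OF g2] e1])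
      (use P in \<open>simp add: mem_Times_iff\<close>)
  moreover have "snd (\<gamma> t) = sgeo c2 (snd (\<gamma> 0)) (snd (\<gamma>' 0)) t"
    by (rule space_form_geodesic_unique[OF c(2) _ bs[OF g1] bs[OF g2] e2])
      (use P in \<open>simp add: mem_Times_iff\<close>)
  ultimately show ?thesis using \<gamma>(2,3) by (simp add: prod_eq_iff \<gamma>'_def)
qed

lemma geodesic_product:
  assumes c: "c1 \<in> {1, 0, -1}" "c2 \<in> {1, 0, -1}" and q: "q \<in> space_form c1 \<times> space_form c2"
    and v: "tangent_to c1 c2 q v"
  shows "geodesic (product_metric c1 c2) (space_form c1 \<times> space_form c2)
    (\<lambda>t. (sgeo c1 (fst q) (fst v) t, sgeo c2 (snd q) (snd v) t))" (is "geodesic ?B ?P ?g")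
proof -
  let ?k1 = "c1 * smet c1 (fst v) (fst v)" and ?k2 = "c2 * smet c2 (snd v) (snd v)"
  have P: "?g t \<in> ?P" for t
    using sgeo_in_space_form[OF c(1)] sgeo_in_space_form[OF c(2)] q v by (auto simp: mem_Times_iff tangent_to_def)
  have "smooth_on UNIV ?g"
    unfolding smooth_on_def sgeo_def by (intro allI Ck_on_Pair Ck_on_cs_sn)
  moreover have "covariant_derivative ?B ?P UNIV ?g (\<lambda>s. vector_derivative ?g (at s)) t 1 = 0" for t
  proof -
    let ?g' = "\<lambda>t. (sgeo' c1 (fst q) (fst v) t, sgeo' c2 (snd q) (snd v) t)"
    let ?w = "(- ?k1 *\<^sub>R sgeo c1 (fst q) (fst v) t, - ?k2 *\<^sub>R sgeo c2 (snd q) (snd v) t)"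
    have g': "(\<lambda>s. vector_derivative ?g (at s)) = ?g'"
      by (intro ext vector_derivative_at has_vector_derivative_Pair sgeo_has_vector_derivative)
    have "(?g' has_vector_derivative ?w) (at t)"
      by (intro has_vector_derivative_Pair sgeo'_has_vector_derivative)
    then have "differential UNIV ?g' t 1 = ?w"
      unfolding differential_def has_vector_derivative_def
      using frechet_derivative_at by (metis (no_types, lifting) scaleR_one)
    \<comment> \<open>\<open>snormal\<close> may replace the point: they agree for
      \<open>c \<noteq> 0\<close>, and for \<open>c = 0\<close> the coefficient vanishes.\<close>
    also have "?w = 0 + (- ?k1 *\<^sub>R snormal c1 (fst (?g t)), - ?k2 *\<^sub>R snormal c2 (snd (?g t)))"
      by (simp add: snormal_def)
    finally have w: "differential UNIV ?g' t 1 = \<dots>" .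
    have "tangent_to c1 c2 (?g t) 0" by (simp add: tangent_to_def smet_linear)
    then show ?thesis
      unfolding covariant_derivative_def g' w by (rule tangential_part_product[OF c P])
  qed
  ultimately show ?thesis unfolding geodesic_def using P by blast
qed

lemma riemannian_exp_product:
  assumes c: "c1 \<in> {1, 0, -1}" "c2 \<in> {1, 0, -1}" and q: "q \<in> space_form c1 \<times> space_form c2"
    and v: "tangent_to c1 c2 q v"
  shows "riemannian_exp (product_metric c1 c2) (space_form c1 \<times> space_form c2) q v =
    (sgeo c1 (fst q) (fst v) 1, sgeo c2 (snd q) (snd v) 1)"
  unfolding riemannian_exp_def
proof (rule the_equality)
  let ?g = "\<lambda>t. (sgeo c1 (fst q) (fst v) t, sgeo c2 (snd q) (snd v) t)"
  have "(?g has_vector_derivative (sgeo' c1 (fst q) (fst v) 0, sgeo' c2 (snd q) (snd v) 0)) (at 0)"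
    by (intro has_vector_derivative_Pair sgeo_has_vector_derivative)
  then have "vector_derivative ?g (at 0) = v" by (simp add: vector_derivative_at)
  then show "\<exists>\<gamma>. geodesic (product_metric c1 c2) (space_form c1 \<times> space_form c2) \<gamma> \<and> \<gamma> 0 = q \<and>
      vector_derivative \<gamma> (at 0) = v \<and> \<gamma> 1 = (sgeo c1 (fst q) (fst v) 1, sgeo c2 (snd q) (snd v) 1)"
    using geodesic_product[OF c q v] by (intro exI[of _ ?g]) simp
qed (use geodesic_product_unique[OF c] in blast)

section \<open>Trace, mean curvature and principal curvatures in a chart\<close>

text \<open>\<open>trace_on\<close> uses an unspecified basis \<open>E\<close>. Expanding the
  vectors \<open>L (axis i 1)\<close> in \<open>E\<close>, and the images of \<open>E\<close> in the
  \<open>L (axis i 1)\<close>, leads to one double sum for both traces.\<close>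

lemma trace_on_range:
  fixes L :: "real^'n \<Rightarrow> 'a::euclidean_space" and K :: "real^'n^'n"
  assumes L: "linear L" "inj L" and T: "\<And>w. T (L w) = L (K *v w)"
  shows "trace_on (range L) T = trace K"
proof -
  define E where "E = (SOME E. independent E \<and> span E = range L)"
  have sub: "subspace (range L)" using L(1) linear_subspace_image subspace_UNIV by blast
  obtain E0 where "E0 \<subseteq> range L" "independent E0" "range L \<subseteq> span E0"
    by (rule maximal_independent_subset)
  then have "independent E0 \<and> span E0 = range L"
    using span_minimal[OF _ sub] by blast
  then have E: "independent E" "span E = range L"
    unfolding E_def using someI[of "\<lambda>E. independent E \<and> span E = range L"] by blast+
  have fE: "finite E" using E(1) independent_imp_finite by blast
  obtain \<xi> where \<xi>: "linear \<xi>" "\<And>w. \<xi> (L w) = w"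
    using linear_injective_left_inverse[OF L] by (auto simp: fun_eq_iff)
  have L\<xi>: "L (\<xi> v) = v" if "v \<in> range L" for v using that \<xi>(2) by auto
  \<comment> \<open>\<open>T\<close> is known on the range of \<open>L\<close> only;
    \<open>T'\<close> agrees with it there and is linear on the whole space.\<close>
  define T' where "T' = (\<lambda>v. L (K *v \<xi> v))"
  have lT': "linear T'"
    unfolding T'_def using linear_compose[OF linear_compose[OF \<xi>(1) matrix_vector_mul_linear] L(1)]
    by (simp add: o_def)
  have T'_in: "T' v \<in> range L" for v unfolding T'_def by blast
  have TT': "T e = T' e" if "e \<in> E" for e
    using that L\<xi>[of e] T[of "\<xi> e"] span_base[of e E] unfolding E(2) T'_def by simp
  have rep_sum: "v = (\<Sum>e\<in>E. representation E v e *\<^sub>R e)" if "v \<in> range L" for v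
    using real_vector.sum_representation_eq[OF E(1) _ fE order_refl, of v] that E(2) by simp
  have "trace K = (\<Sum>i\<in>UNIV. (\<xi> (T' (L (axis i 1)))) $ i)"
    unfolding trace_def T'_def \<xi>(2) by (simp add: matrix_vector_mul_component inner_axis)
  also have "\<dots> = (\<Sum>i\<in>UNIV. \<Sum>e\<in>E. representation E (L (axis i 1)) e * (\<xi> (T' e)) $ i)"
  proof (rule sum.cong[OF refl])
    fix i :: 'n
    have "T' (L (axis i 1)) = T' (\<Sum>e\<in>E. representation E (L (axis i 1)) e *\<^sub>R e)"
      using rep_sum[of "L (axis i 1)"] by simp
    also have "\<dots> = (\<Sum>e\<in>E. representation E (L (axis i 1)) e *\<^sub>R T' e)"
      using lT' by (simp add: linear_sum linear_scale)
    finally show "(\<xi> (T' (L (axis i 1)))) $ i = (\<Sum>e\<in>E. representation E (L (axis i 1)) e * (\<xi> (T' e)) $ i)"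
      using \<xi>(1) by (simp add: linear_sum linear_scale)
  qed
  also have "\<dots> = (\<Sum>e\<in>E. \<Sum>i\<in>UNIV. (\<xi> (T' e)) $ i * representation E (L (axis i 1)) e)"
    by (subst sum.swap) (simp add: mult.commute)
  also have "\<dots> = (\<Sum>e\<in>E. representation E (T' e) e)"
  proof (rule sum.cong[OF refl])
    fix e
    have "T' e = L (\<xi> (T' e))" using L\<xi>[OF T'_in] by simp
    also have "\<xi> (T' e) = (\<Sum>i\<in>UNIV. (\<xi> (T' e)) $ i *\<^sub>R axis i 1)"
      using basis_expansion[of "\<xi> (T' e)"] by (simp add: scalar_mult_eq_scaleR)
    also have "L \<dots> = (\<Sum>i\<in>UNIV. (\<xi> (T' e)) $ i *\<^sub>R L (axis i 1))"
      using L(1) by (simp add: linear_sum linear_scale)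
    also have "representation E \<dots> e = (\<Sum>i\<in>UNIV. representation E ((\<xi> (T' e)) $ i *\<^sub>R L (axis i 1)) e)"
      using E(1) subspace_scale[OF sub] unfolding E(2)[symmetric]
      by (subst real_vector.representation_sum) (auto simp: E(2))
    also have "\<dots> = (\<Sum>i\<in>UNIV. (\<xi> (T' e)) $ i * representation E (L (axis i 1)) e)"
      using E by (subst real_vector.representation_scale) auto
    finally show "(\<Sum>i\<in>UNIV. (\<xi> (T' e)) $ i * representation E (L (axis i 1)) e) = representation E (T' e) e" by simp
  qed
  also have "\<dots> = (\<Sum>e\<in>E. representation E (T e) e)" using TT' by simp
  finally show ?thesis unfolding trace_on_def Let_def E_def by simp
qed

lemma minus_matrix_vector_mult: "- A *v x = - (A *v x)" for A :: "real^'n^'m"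
  by (simp add: matrix_vector_mult_def vec_eq_iff sum_negf)

lemma matrix_vector_mult_uminus: "A *v - x = - (A *v x)" for A :: "real^'n^'m"
  by (simp add: matrix_vector_mult_def vec_eq_iff sum_negf)

text \<open>\<open>L\<close> is the derivative of a chart, \<open>F\<close> a frame of the ambient tangent space along the hypersurface.\<close>

lemma shape_operator_chart:
  fixes L :: "real^3 \<Rightarrow> 'a::euclidean_space" and \<Phi> \<Psi> :: "real^3^3"
  assumes L: "linear L" "inj L" "tangent_space M p = range L"
    and F: "linear F" "inj F"
    and inj: "inj_on (differential M f p) (tangent_space M p)"
    and df: "\<And>w. differential M f p (L w) = F (\<Phi> *v w)"
    and cd: "\<And>w. covariant_derivative B P M f N p (L w) = F (\<Psi> *v w)"
  shows "invertible \<Phi>"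
    and "shape_operator B P M f N p (L w) = L (- (matrix_inv \<Phi> ** \<Psi>) *v w)"
    and "mean_curvature B P M f N p = - trace (\<Psi> ** matrix_inv \<Phi>) / 3"
    and "principal_multiplicity B P M f N p k = dim {z. - (matrix_inv \<Phi> ** \<Psi>) *v z = k *\<^sub>R z}"
proof -
  have "inj ((*v) \<Phi>)"
  proof (rule injI)
    fix a b assume "\<Phi> *v a = \<Phi> *v b"
    then have "differential M f p (L a) = differential M f p (L b)" using df by simp
    then have "L a = L b" using inj L(3) by (metis inj_onD rangeI)
    then show "a = b" using L(2) by (simp add: inj_eq)
  qed
  then show inv: "invertible \<Phi>"
    using invertible_left_inverse matrix_left_invertible_injective by blast
  have mi: "\<Phi> ** matrix_inv \<Phi> = mat 1" "matrix_inv \<Phi> ** \<Phi> = mat 1"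
    using someI_ex[OF inv[unfolded invertible_def]] unfolding matrix_inv_def by blast+
  have so: "shape_operator B P M f N p (L w) = L (- (matrix_inv \<Phi> ** \<Psi>) *v w)" for w
    unfolding shape_operator_def
  proof (rule the_equality)
    have "\<Phi> *v (- (matrix_inv \<Phi> ** \<Psi>) *v w) = - (\<Psi> *v w)"
      using mi by (simp add: minus_matrix_vector_mult matrix_vector_mult_uminus matrix_vector_mul_assoc matrix_mul_assoc)
    then show "L (- (matrix_inv \<Phi> ** \<Psi>) *v w) \<in> tangent_space M p \<and>
        differential M f p (L (- (matrix_inv \<Phi> ** \<Psi>) *v w)) = - covariant_derivative B P M f N p (L w)"
      using L(3) df cd F(1) by (simp add: linear_neg)
    then show "v = L (- (matrix_inv \<Phi> ** \<Psi>) *v w)"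
      if "v \<in> tangent_space M p \<and> differential M f p v = - covariant_derivative B P M f N p (L w)" for v
      using that inj by (metis inj_onD)
  qed
  then show "shape_operator B P M f N p (L w) = L (- (matrix_inv \<Phi> ** \<Psi>) *v w)" .
  have "dim (range L) = 3"
    using dim_image_eq[OF L(1), of UNIV] L(2) by simp
  \<comment> \<open>Cyclicity moves the inverse to the right, the form in which the derivative of
    the determinant produces it.\<close>
  moreover have "trace (- (matrix_inv \<Phi> ** \<Psi>)) = - trace (\<Psi> ** matrix_inv \<Phi>)"
    by (simp add: trace_def sum_negf flip: trace_mul_sym[of \<Psi>, unfolded trace_def])
  ultimately show "mean_curvature B P M f N p = - trace (\<Psi> ** matrix_inv \<Phi>) / 3"
    unfolding mean_curvature_def L(3) trace_on_range[OF L(1,2) so] by simp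
  have "{v \<in> range L. shape_operator B P M f N p v = k *\<^sub>R v} = L ` {z. - (matrix_inv \<Phi> ** \<Psi>) *v z = k *\<^sub>R z}"
    using so L by (auto simp: linear_scale[OF L(1), symmetric] inj_eq simp del: linear_scale)
  then show "principal_multiplicity B P M f N p k = dim {z. - (matrix_inv \<Phi> ** \<Psi>) *v z = k *\<^sub>R z}"
    unfolding principal_multiplicity_def L(3)
    using dim_image_eq[OF L(1) inj_on_subset[OF L(2) subset_UNIV]] by presburger
qed

section \<open>Variation through normal geodesics\<close>

text \<open>\<open>\<phi>\<close> and \<open>\<nu>\<close> are the components in one factor of the immersion and of its unit normal, read in
  a chart; \<open>e\<close>, \<open>n\<close> is an orthonormal frame of the factor at \<open>\<phi> u\<close> with \<open>\<nu> u = b *\<^sub>R n\<close>. The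
  vector \<open>n_at r\<close> is the parallel transport of \<open>n\<close> along the geodesic with initial velocity \<open>\<nu> u\<close>,
  and \<open>e\<close>, being orthogonal to the plane of this geodesic, is parallel itself.\<close>

locale space_form_variation =
  fixes c :: real and U :: "'a::real_normed_vector set" and u :: 'a
    and \<phi> \<nu> :: "'a \<Rightarrow> real^3" and \<phi>' \<nu>' :: "'a \<Rightarrow> real^3" and e n :: "real^3" and b :: real
  assumes c: "c \<in> {1, 0, -1}" and U: "open U" "u \<in> U"
    and \<phi>_in: "\<And>z. z \<in> U \<Longrightarrow> \<phi> z \<in> space_form c"
    and \<nu>_tangent: "\<And>z. z \<in> U \<Longrightarrow> smet c (\<nu> z) (snormal c (\<phi> z)) = 0"
    and \<phi>': "(\<phi> has_derivative \<phi>') (at u)" and \<nu>': "(\<nu> has_derivative \<nu>') (at u)"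
    and e_tangent: "smet c e (snormal c (\<phi> u)) = 0" and n_tangent: "smet c n (snormal c (\<phi> u)) = 0"
    and ee: "smet c e e = 1" and nn: "smet c n n = 1" and en: "smet c e n = 0"
    and \<nu>_eq: "\<nu> u = b *\<^sub>R n"
    and expand: "\<And>w. smet c w (snormal c (\<phi> u)) = 0 \<Longrightarrow> w = smet c w e *\<^sub>R e + smet c w n *\<^sub>R n"
begin

abbreviation q where "q \<equiv> \<phi> u"
abbreviation k where "k \<equiv> c * b\<^sup>2"

definition n_at :: "real \<Rightarrow> real^3" where
  "n_at r = cs k r *\<^sub>R n - (c * b * sn k r) *\<^sub>R q"

lemma q_orthogonal:
  assumes "c \<noteq> 0"
  shows "smet c q q = c" "smet c e q = 0" "smet c n q = 0" "smet c q e = 0" "smet c q n = 0"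
proof -
  have "snormal c q = q" using assms by (simp add: snormal_def)
  then show eq: "smet c e q = 0" and nq: "smet c n q = 0" using e_tangent n_tangent by simp_all
  show "smet c q e = 0" "smet c q n = 0" using eq nq smet_commute by metis+
  show "smet c q q = c" using smet_self[OF \<phi>_in[OF U(2)]] c assms by simp
qed

lemma cc: "c \<noteq> 0 \<Longrightarrow> c * c = 1"
  using c by auto

lemma smet_\<nu>: "c * smet c (\<nu> u) (\<nu> u) = k"
  by (simp add: \<nu>_eq smet_linear nn power2_eq_square)

lemma \<phi>'_tangent: "smet c (\<phi>' w) (snormal c q) = 0"
proof -
  have l: "((\<lambda>t. u + t *\<^sub>R w) has_derivative (\<lambda>h. h *\<^sub>R w)) (at (0::real))"
    by (auto intro!: derivative_eq_intros)
  have "((\<lambda>t. \<phi> (u + t *\<^sub>R w)) has_derivative (\<lambda>h. \<phi>' (h *\<^sub>R w))) (at 0)"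
    using has_derivative_compose[OF l, of \<phi> \<phi>'] \<phi>' by simp
  then have d: "((\<lambda>t. \<phi> (u + t *\<^sub>R w)) has_vector_derivative \<phi>' w) (at 0)"
    unfolding has_vector_derivative_def using linear_scale[OF has_derivative_linear[OF \<phi>']] by simp
  have "continuous (at 0) (\<lambda>t::real. u + t *\<^sub>R w)" by (intro continuous_intros)
  then have "\<forall>\<^sub>F t in at (0::real). u + t *\<^sub>R w \<in> U"
    using U by (simp add: continuous_at topological_tendstoD)
  then obtain \<delta> where \<delta>: "\<delta> > 0" "\<And>t::real. t \<noteq> 0 \<Longrightarrow> dist t 0 < \<delta> \<Longrightarrow> u + t *\<^sub>R w \<in> U"
    unfolding eventually_at by auto
  have "\<phi> (u + (0 + t) *\<^sub>R w) \<in> space_form c" if "t \<in> {-\<delta><..<\<delta>}" for t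
    using that \<delta>(2)[of t] U(2) \<phi>_in by (cases "t = 0") (auto simp: dist_real_def)
  from space_form_curve_tangent[OF c \<delta>(1) this d] show ?thesis by simp
qed

lemma \<phi>'_eq: "\<phi>' w = smet c (\<phi>' w) e *\<^sub>R e + smet c (\<phi>' w) n *\<^sub>R n"
  by (rule expand[OF \<phi>'_tangent])

text \<open>The component along \<open>q\<close> comes from differentiating the tangency of
  \<open>\<nu>\<close>. For the plane the normal is constant and there is no such component.\<close>

lemma \<nu>'_eq: "\<nu>' w = smet c (\<nu>' w) e *\<^sub>R e + smet c (\<nu>' w) n *\<^sub>R n - (c * b * smet c (\<phi>' w) n) *\<^sub>R q"
proof (cases "c = 0")
  case True
  have "((\<lambda>z. smet c (\<nu> z) (axis 3 1)) has_derivative (\<lambda>w. smet c (\<nu>' w) (axis 3 1))) (at u)"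
    by (rule bounded_linear.has_derivative[OF smet.bounded_linear_left \<nu>'])
  moreover have "((\<lambda>z. smet c (\<nu> z) (axis 3 1)) has_derivative (\<lambda>w. 0)) (at u)"
    by (rule has_derivative_transform_within_open[OF has_derivative_const U])
      (use \<nu>_tangent True in \<open>simp add: snormal_def\<close>)
  ultimately have "(\<lambda>w. smet c (\<nu>' w) (axis 3 1)) = (\<lambda>w. 0)" by (rule has_derivative_unique)
  then have "smet c (\<nu>' w) (snormal c q) = 0" using True by (auto simp: snormal_def fun_eq_iff)
  from expand[OF this] show ?thesis using True by simp
next
  case False
  have "((\<lambda>z. smet c (\<nu> z) (\<phi> z)) has_derivative (\<lambda>w. smet c (\<nu> u) (\<phi>' w) + smet c (\<nu>' w) q)) (at u)"
    by (rule smet.FDERIV[OF \<nu>' \<phi>'])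
  moreover have "((\<lambda>z. smet c (\<nu> z) (\<phi> z)) has_derivative (\<lambda>w. 0)) (at u)"
    by (rule has_derivative_transform_within_open[OF has_derivative_const U])
      (use \<nu>_tangent False in \<open>simp add: snormal_def\<close>)
  ultimately have "(\<lambda>w. smet c (\<nu> u) (\<phi>' w) + smet c (\<nu>' w) q) = (\<lambda>w. 0)" by (rule has_derivative_unique)
  then have "smet c (\<nu> u) (\<phi>' w) + smet c (\<nu>' w) q = 0" by meson
  then have o: "smet c (\<nu>' w) q = - (b * smet c (\<phi>' w) n)"
    by (simp add: \<nu>_eq smet_linear smet_commute[of c n])
  let ?z = "\<nu>' w + (c * b * smet c (\<phi>' w) n) *\<^sub>R q"
  have "smet c ?z (snormal c q) = 0"
    using False o q_orthogonal cc by (simp add: snormal_def smet_linear algebra_simps)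
  from expand[OF this] have "?z = smet c (\<nu>' w) e *\<^sub>R e + smet c (\<nu>' w) n *\<^sub>R n"
    using q_orthogonal[OF False] by (simp add: smet_linear)
  then show ?thesis by (simp add: eq_diff_eq)
qed

lemma smet_derivatives:
  "smet c (\<phi>' w) (\<nu>' w') = smet c (\<phi>' w) e * smet c (\<nu>' w') e + smet c (\<phi>' w) n * smet c (\<nu>' w') n"
  "smet c (\<nu> u) (\<phi>' w) = b * smet c (\<phi>' w) n"
  "smet c (\<nu> u) (\<nu>' w) = b * smet c (\<nu>' w) n"
proof -
  have "c * smet c (\<phi>' w) q = 0"
    using \<phi>'_tangent[of w] by (simp add: snormal_def split: if_splits)
  then have "(c * b * smet c (\<phi>' w') n) * smet c (\<phi>' w) q = 0" by auto
  then show "smet c (\<phi>' w) (\<nu>' w') = smet c (\<phi>' w) e * smet c (\<nu>' w') e + smet c (\<phi>' w) n * smet c (\<nu>' w') n"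
    using arg_cong[OF \<nu>'_eq, of "smet c (\<phi>' w)" w'] by (simp add: smet_linear mult.commute mult.left_commute)
  show "smet c (\<nu> u) (\<phi>' w) = b * smet c (\<phi>' w) n" "smet c (\<nu> u) (\<nu>' w) = b * smet c (\<nu>' w) n"
    by (simp_all add: \<nu>_eq smet_linear smet_commute[of c n])
qed

section \<open>Derivatives of the geodesics with respect to their initial data\<close>

lemma curvature_has_derivative:
  "((\<lambda>z. c * smet c (\<nu> z) (\<nu> z) * r\<^sup>2) has_derivative (\<lambda>w. 2 * c * b * smet c (\<nu>' w) n * r\<^sup>2)) (at u)"
proof -
  have "((\<lambda>z. smet c (\<nu> z) (\<nu> z)) has_derivative (\<lambda>w. smet c (\<nu> u) (\<nu>' w) + smet c (\<nu>' w) (\<nu> u))) (at u)"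
    by (rule smet.FDERIV[OF \<nu>' \<nu>'])
  then have "((\<lambda>z. smet c (\<nu> z) (\<nu> z)) has_derivative (\<lambda>w. 2 * b * smet c (\<nu>' w) n)) (at u)"
    by (simp add: smet_commute[of c _ "\<nu> u"] smet_derivatives mult.assoc)
  from has_derivative_mult_left[OF has_derivative_mult_right[OF this, of c], of "r\<^sup>2"]
  show ?thesis by (simp add: mult_ac)
qed

lemma gcos_has_derivative:
  "((\<lambda>z. cs (c * smet c (\<nu> z) (\<nu> z)) r) has_derivative (\<lambda>w. - (c * b * smet c (\<nu>' w) n * r) * sn k r)) (at u)"
proof -
  have "((\<lambda>z. gcos (c * smet c (\<nu> z) (\<nu> z) * r\<^sup>2)) has_derivative
      (\<lambda>w. 2 * c * b * smet c (\<nu>' w) n * r\<^sup>2 * (- gsin (k * r\<^sup>2) / 2))) (at u)"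
    using DERIV_compose_FDERIV[OF _ curvature_has_derivative, of gcos "- gsin (k * r\<^sup>2) / 2" r]
      DERIV_gcos[of "k * r\<^sup>2"] smet_\<nu> by simp
  then show ?thesis by (simp add: cs_def sn_def power2_eq_square mult_ac)
qed

text \<open>The derivative of \<open>sn\<close> in the curvature parameter involves \<open>gsin'\<close>; multiplied by \<open>b\<close>, as it
  always occurs, it is elementary.\<close>

lemma gsin_has_derivative:
  obtains s' where
    "((\<lambda>z. sn (c * smet c (\<nu> z) (\<nu> z)) r) has_derivative (\<lambda>w. smet c (\<nu>' w) n * s')) (at u)"
    "b * s' = r * cs k r - sn k r"
proof
  let ?s' = "2 * c * b * r ^ 3 * gsin' (k * r\<^sup>2)"
  have "((\<lambda>z. gsin (c * smet c (\<nu> z) (\<nu> z) * r\<^sup>2)) has_derivative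
      (\<lambda>w. 2 * c * b * smet c (\<nu>' w) n * r\<^sup>2 * gsin' (k * r\<^sup>2))) (at u)"
    using DERIV_compose_FDERIV[OF _ curvature_has_derivative, of gsin "gsin' (k * r\<^sup>2)" r]
      DERIV_gsin[of "k * r\<^sup>2"] smet_\<nu> by simp
  from has_derivative_mult_right[OF this, of r]
  show "((\<lambda>z. sn (c * smet c (\<nu> z) (\<nu> z)) r) has_derivative (\<lambda>w. smet c (\<nu>' w) n * ?s')) (at u)"
    by (simp add: sn_def power2_eq_square power3_eq_cube mult_ac)
  have "b * ?s' = r * (2 * (k * r\<^sup>2) * gsin' (k * r\<^sup>2))"
    by (simp add: power2_eq_square power3_eq_cube mult_ac)
  then show "b * ?s' = r * cs k r - sn k r"
    unfolding gsin'_eq by (simp add: cs_def sn_def algebra_simps)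
qed

text \<open>A Jacobi field: its \<open>e\<close>-component solves y'' = - k y, and its component in
  the geodesic's own direction is affine in \<open>r\<close>.\<close>

lemma sgeo_has_derivative:
  "((\<lambda>z. sgeo c (\<phi> z) (\<nu> z) r) has_derivative
    (\<lambda>w. (cs k r * smet c (\<phi>' w) e + sn k r * smet c (\<nu>' w) e) *\<^sub>R e
       + (smet c (\<phi>' w) n + r * smet c (\<nu>' w) n) *\<^sub>R n_at r)) (at u)"
proof -
  obtain s' where s': "((\<lambda>z. sn (c * smet c (\<nu> z) (\<nu> z)) r) has_derivative (\<lambda>w. smet c (\<nu>' w) n * s')) (at u)"
    "b * s' = r * cs k r - sn k r" by (rule gsin_has_derivative)
  have "((\<lambda>z. sgeo c (\<phi> z) (\<nu> z) r) has_derivative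
     (\<lambda>w. (cs k r *\<^sub>R \<phi>' w + (- (c * b * smet c (\<nu>' w) n * r) * sn k r) *\<^sub>R q) +
          (sn k r *\<^sub>R \<nu>' w + (smet c (\<nu>' w) n * s') *\<^sub>R \<nu> u))) (at u)"
    unfolding sgeo_def smet_\<nu>[symmetric]
    by (intro has_derivative_add has_derivative_scaleR \<phi>' \<nu>' s'(1)[unfolded smet_\<nu>[symmetric]]
      gcos_has_derivative[unfolded smet_\<nu>[symmetric]])
  moreover have "(cs k r *\<^sub>R \<phi>' w + (- (c * b * smet c (\<nu>' w) n * r) * sn k r) *\<^sub>R q) +
          (sn k r *\<^sub>R \<nu>' w + (smet c (\<nu>' w) n * s') *\<^sub>R \<nu> u)
     = (cs k r * smet c (\<phi>' w) e + sn k r * smet c (\<nu>' w) e) *\<^sub>R e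
       + (smet c (\<phi>' w) n + r * smet c (\<nu>' w) n) *\<^sub>R n_at r" for w
  proof -
    define x y X Y where "x = smet c (\<phi>' w) e" "y = smet c (\<phi>' w) n" "X = smet c (\<nu>' w) e" "Y = smet c (\<nu>' w) n"
    note d = this
    have "(cs k r *\<^sub>R \<phi>' w + (- (c * b * Y * r) * sn k r) *\<^sub>R q) + (sn k r *\<^sub>R \<nu>' w + (Y * s') *\<^sub>R \<nu> u)
      = (cs k r *\<^sub>R (x *\<^sub>R e + y *\<^sub>R n) + (- (c * b * Y * r) * sn k r) *\<^sub>R q)
        + (sn k r *\<^sub>R (X *\<^sub>R e + Y *\<^sub>R n - (c * b * y) *\<^sub>R q) + (Y * s') *\<^sub>R (b *\<^sub>R n))"
      using \<phi>'_eq[of w] \<nu>'_eq[of w] \<nu>_eq unfolding d by simp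
    also have "\<dots> = (cs k r * x + sn k r * X) *\<^sub>R e + (cs k r * y + sn k r * Y + Y * (b * s')) *\<^sub>R n
        - (c * b * sn k r * (y + r * Y)) *\<^sub>R q"
      by (simp add: algebra_simps)
    \<comment> \<open>The term \<open>sn k r * Y\<close> cancels against the derivative of
      \<open>sn\<close> in its curvature parameter.\<close>
    also have "cs k r * y + sn k r * Y + Y * (b * s') = (y + r * Y) * cs k r"
      unfolding s'(2) by (simp add: algebra_simps)
    finally show ?thesis unfolding d[symmetric] n_at_def by (simp add: algebra_simps)
  qed
  ultimately show ?thesis by simp
qed

text \<open>The coefficients of \<open>e\<close> and \<open>n_at r\<close> are the
  \<open>r\<close>-derivatives of those in \<open>sgeo_has_derivative\<close>. The last term is
  normal to the space form, or zero for \<open>c = 0\<close>, and disappears in the Levi-Civita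
  projection.\<close>

lemma sgeo'_has_derivative:
  "((\<lambda>z. sgeo' c (\<phi> z) (\<nu> z) r) has_derivative
    (\<lambda>w. (- k * sn k r * smet c (\<phi>' w) e + cs k r * smet c (\<nu>' w) e) *\<^sub>R e + smet c (\<nu>' w) n *\<^sub>R n_at r
       - (c * b * (smet c (\<phi>' w) n + r * smet c (\<nu>' w) n)) *\<^sub>R sgeo c q (\<nu> u) r)) (at u)"
proof -
  obtain s' where s': "((\<lambda>z. sn (c * smet c (\<nu> z) (\<nu> z)) r) has_derivative (\<lambda>w. smet c (\<nu>' w) n * s')) (at u)"
    "b * s' = r * cs k r - sn k r" by (rule gsin_has_derivative)
  have k': "((\<lambda>z. - (c * smet c (\<nu> z) (\<nu> z))) has_derivative (\<lambda>w. - (2 * c * b * smet c (\<nu>' w) n))) (at u)"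
    using has_derivative_minus[OF curvature_has_derivative[of 1]] by simp
  have "((\<lambda>z. sgeo' c (\<phi> z) (\<nu> z) r) has_derivative
     (\<lambda>w. ((- (c * smet c (\<nu> u) (\<nu> u)) * sn (c * smet c (\<nu> u) (\<nu> u)) r) *\<^sub>R \<phi>' w
          + (- (c * smet c (\<nu> u) (\<nu> u)) * (smet c (\<nu>' w) n * s')
            + - (2 * c * b * smet c (\<nu>' w) n) * sn (c * smet c (\<nu> u) (\<nu> u)) r) *\<^sub>R q)
        + (cs (c * smet c (\<nu> u) (\<nu> u)) r *\<^sub>R \<nu>' w + (- (c * b * smet c (\<nu>' w) n * r) * sn k r) *\<^sub>R \<nu> u))) (at u)"
    unfolding sgeo'_def
    by (intro has_derivative_add has_derivative_scaleR has_derivative_mult k' \<phi>' \<nu>' s'(1) gcos_has_derivative)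
  moreover have "((- (c * smet c (\<nu> u) (\<nu> u)) * sn (c * smet c (\<nu> u) (\<nu> u)) r) *\<^sub>R \<phi>' w
          + (- (c * smet c (\<nu> u) (\<nu> u)) * (smet c (\<nu>' w) n * s')
            + - (2 * c * b * smet c (\<nu>' w) n) * sn (c * smet c (\<nu> u) (\<nu> u)) r) *\<^sub>R q)
        + (cs (c * smet c (\<nu> u) (\<nu> u)) r *\<^sub>R \<nu>' w + (- (c * b * smet c (\<nu>' w) n * r) * sn k r) *\<^sub>R \<nu> u)
     = (- k * sn k r * smet c (\<phi>' w) e + cs k r * smet c (\<nu>' w) e) *\<^sub>R e + smet c (\<nu>' w) n *\<^sub>R n_at r
       - (c * b * (smet c (\<phi>' w) n + r * smet c (\<nu>' w) n)) *\<^sub>R sgeo c q (\<nu> u) r" for w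
  proof -
    define x y X Y where "x = smet c (\<phi>' w) e" "y = smet c (\<phi>' w) n" "X = smet c (\<nu>' w) e" "Y = smet c (\<nu>' w) n"
    note d = this
    define C S K where "C = cs k r" "S = sn k r" "K = k"
    note D = this
    have bs: "b * s' = r * C - S" using s'(2) D by simp
    have K: "K = c * b * b" by (simp add: D power2_eq_square)
    have "((- K * S) *\<^sub>R \<phi>' w + (- K * (Y * s') + - (2 * c * b * Y) * S) *\<^sub>R q)
        + (C *\<^sub>R \<nu>' w + (- (c * b * Y * r) * S) *\<^sub>R \<nu> u)
      = ((- K * S) *\<^sub>R (x *\<^sub>R e + y *\<^sub>R n) + (- K * (Y * s') + - (2 * c * b * Y) * S) *\<^sub>R q)
        + (C *\<^sub>R (X *\<^sub>R e + Y *\<^sub>R n - (c * b * y) *\<^sub>R q) + (- (c * b * Y * r) * S) *\<^sub>R (b *\<^sub>R n))"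
      using \<phi>'_eq[of w] \<nu>'_eq[of w] \<nu>_eq unfolding d by simp
    also have "\<dots> = (- K * S * x + C * X) *\<^sub>R e + (Y * C - c * b * (y + r * Y) * (S * b)) *\<^sub>R n
        - (c * b * (Y * (b * s') + 2 * Y * S + C * y)) *\<^sub>R q"
      unfolding K by (simp add: algebra_simps)
    also have "c * b * (Y * (b * s') + 2 * Y * S + C * y) = Y * (c * b * S) + c * b * (y + r * Y) * C"
      unfolding bs by (simp add: algebra_simps)
    also have "(- K * S * x + C * X) *\<^sub>R e + (Y * C - c * b * (y + r * Y) * (S * b)) *\<^sub>R n
        - (Y * (c * b * S) + c * b * (y + r * Y) * C) *\<^sub>R q
      = (- K * S * x + C * X) *\<^sub>R e + Y *\<^sub>R (C *\<^sub>R n - (c * b * S) *\<^sub>R q)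
        - (c * b * (y + r * Y)) *\<^sub>R (C *\<^sub>R q + S *\<^sub>R (b *\<^sub>R n))"
      by (simp add: algebra_simps)
    finally show ?thesis
      unfolding d D smet_\<nu> n_at_def sgeo_def \<nu>_eq[symmetric] .
  qed
  ultimately show ?thesis by simp
qed

section \<open>The transported frame is tangent and orthonormal\<close>

lemma e_tangent_at: "smet c e (snormal c (sgeo c q (\<nu> u) r)) = 0"
  using e_tangent q_orthogonal en by (auto simp: snormal_def sgeo_def smet_linear \<nu>_eq)

lemma n_at_tangent: "smet c (n_at r) (snormal c (sgeo c q (\<nu> u) r)) = 0"
proof (cases "c = 0")
  case True
  then show ?thesis using n_tangent unfolding n_at_def by (simp add: snormal_def smet_linear)
next
  case False
  then show ?thesis
    using q_orthogonal[OF False] nn cc[OF False] unfolding sgeo_def smet_\<nu>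
    by (simp add: n_at_def snormal_def smet_linear \<nu>_eq algebra_simps)
qed

lemma n_at_orthonormal: "smet c e (n_at r) = 0" "smet c (n_at r) (n_at r) = 1"
proof -
  show "smet c e (n_at r) = 0"
    unfolding n_at_def using en q_orthogonal(2) by (cases "c = 0") (auto simp: smet_linear)
  show "smet c (n_at r) (n_at r) = 1"
  proof (cases "c = 0")
    case True
    then show ?thesis using nn unfolding n_at_def by (simp add: smet_linear)
  next
    case False
    have "smet c (n_at r) (n_at r) = (cs k r)\<^sup>2 + c * (c * c) * b\<^sup>2 * (sn k r)\<^sup>2"
      using q_orthogonal[OF False] nn
      by (simp add: n_at_def smet_linear power2_eq_square algebra_simps)
    then show ?thesis using cc[OF False] cs_sn_squared[of k r] by simp
  qed
qed

end

section \<open>The differentials of the parallel hypersurfaces in an adapted frame\<close>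

text \<open>\<open>X\<close> and \<open>Y\<close> will be the matrices of the differentials of the
  immersion and of its normal in the adapted frame. Row \<open>i\<close> evolves by y'' = -
  \<open>a$i\<close> y, as the frame diagonalizes the Jacobi operator.\<close>

definition jac :: "real^3 \<Rightarrow> real^3^3 \<Rightarrow> real^3^3 \<Rightarrow> real \<Rightarrow> real^3^3" where
  "jac a X Y r = (\<chi> i j. cs (a$i) r * X$i$j + sn (a$i) r * Y$i$j)"

definition jac' :: "real^3 \<Rightarrow> real^3^3 \<Rightarrow> real^3^3 \<Rightarrow> real \<Rightarrow> real^3^3" where
  "jac' a X Y r = (\<chi> i j. - a$i * sn (a$i) r * X$i$j + cs (a$i) r * Y$i$j)"

lemma jac_0 [simp]: "jac a X Y 0 = X" "jac' a X Y 0 = Y"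
  by (simp_all add: jac_def jac'_def vec_eq_iff)

lemma jac_mult:
  "(jac a X Y r *v w) $ i = cs (a$i) r * (X *v w) $ i + sn (a$i) r * (Y *v w) $ i"
  "(jac' a X Y r *v w) $ i = - a$i * sn (a$i) r * (X *v w) $ i + cs (a$i) r * (Y *v w) $ i"
  by (simp_all add: jac_def jac'_def matrix_vector_mult_def sum_distrib_left sum.distrib sum_subtractf sum_negf algebra_simps)

text \<open>The sectional curvatures of the planes spanned by the unit normal and the vectors of the
  adapted frame, for \<open>t = |N\<^sub>1|\<^sup>2\<close>.\<close>

definition unit_curvatures :: "real \<Rightarrow> real \<Rightarrow> real \<Rightarrow> real^3" where
  "unit_curvatures c1 c2 t = vector [c1 * t, c2 * (1 - t), 0]"

text \<open>One pair \<open>X\<close>, \<open>Y\<close> at \<open>p\<close> serves all distances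
  \<open>r\<close>. The maps \<open>fr\<close> and \<open>Nr\<close> are prescribed on
  \<open>M\<close> only, so that \<open>f\<close> and \<open>N\<close> themselves are the case
  \<open>r = 0\<close>.\<close>

lemma hypersurface_jacobi_matrices:
  fixes M :: "'a::euclidean_space set" and f N :: "'a \<Rightarrow> (real^3) \<times> (real^3)"
  assumes c: "c1 \<in> {1, 0, -1}" "c2 \<in> {1, 0, -1}"
    and hyp: "hypersurface (product_metric c1 c2) (space_form c1 \<times> space_form c2) M f N" and p: "p \<in> M"
  obtains X Y :: "real^3^3" and t where
    "0 \<le> t" "t \<le> 1" "smet c1 (fst (N p)) (fst (N p)) = t" "smet c2 (snd (N p)) (snd (N p)) = 1 - t"
    "\<And>w w'. (X *v w) \<bullet> (Y *v w') = (X *v w') \<bullet> (Y *v w)"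
    "invertible X"
    "\<And>k. principal_multiplicity (product_metric c1 c2) (space_form c1 \<times> space_form c2) M f N p k
       = dim {z. - (matrix_inv X ** Y) *v z = k *\<^sub>R z}"
    "\<And>r fr Nr. hypersurface (product_metric c1 c2) (space_form c1 \<times> space_form c2) M fr Nr \<Longrightarrow>
       (\<And>z. z \<in> M \<Longrightarrow> fr z = (sgeo c1 (fst (f z)) (fst (N z)) r, sgeo c2 (snd (f z)) (snd (N z)) r)) \<Longrightarrow>
       (\<And>z. z \<in> M \<Longrightarrow> Nr z = (sgeo' c1 (fst (f z)) (fst (N z)) r, sgeo' c2 (snd (f z)) (snd (N z)) r)) \<Longrightarrow>
       invertible (jac (unit_curvatures c1 c2 t) X Y r) \<and>
       mean_curvature (product_metric c1 c2) (space_form c1 \<times> space_form c2) M fr Nr p =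
         - trace (jac' (unit_curvatures c1 c2 t) X Y r ** matrix_inv (jac (unit_curvatures c1 c2 t) X Y r)) / 3"
proof -
  let ?B = "product_metric c1 c2" and ?P = "space_form c1 \<times> space_form c2"
  have M: "manifold3 M" and sf: "smooth_map M f" and sN: "smooth_map M N"
    and fP: "\<And>z. z \<in> M \<Longrightarrow> f z \<in> ?P"
    and NT: "\<And>z. z \<in> M \<Longrightarrow> tangent_to c1 c2 (f z) (N z)"
    and N1: "\<And>z. z \<in> M \<Longrightarrow> ?B (N z) (N z) = 1"
    and Nd: "\<And>z v. z \<in> M \<Longrightarrow> v \<in> tangent_space M z \<Longrightarrow> ?B (N z) (differential M f z v) = 0"
    using hyp tangent_space_product[OF c] unfolding hypersurface_def by blast+
  obtain U :: "(real^3) set" and x u where U: "open U" "u \<in> U" and xu: "x u = p" and xM: "x ` U \<subseteq> M"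
    and sx: "smooth_on U x" and injL: "inj (frechet_derivative x (at u))"
    and TL: "tangent_space M p = range (frechet_derivative x (at u))"
    by (rule manifold3_chart[OF M p])
  define L where "L = frechet_derivative x (at u)"
  have xin: "x z \<in> M" if "z \<in> U" for z using that xM by blast
  have dx: "(x has_derivative L) (at u)" unfolding L_def by (rule smooth_on_has_derivative[OF sx U(2)])
  have linL: "linear L" using dx has_derivative_linear by blast
  define \<phi>' where "\<phi>' = frechet_derivative (\<lambda>z. f (x z)) (at u)"
  define \<nu>' where "\<nu>' = frechet_derivative (\<lambda>z. N (x z)) (at u)"
  have d\<phi>: "((\<lambda>z. f (x z)) has_derivative \<phi>') (at u)"
    unfolding \<phi>'_def by (rule smooth_map_comp_has_derivative[OF sf U xM sx])
  have d\<nu>: "((\<lambda>z. N (x z)) has_derivative \<nu>') (at u)"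
    unfolding \<nu>'_def by (rule smooth_map_comp_has_derivative[OF sN U xM sx])
  have fp: "fst (f p) \<in> space_form c1" "snd (f p) \<in> space_form c2" using fP[OF p] by (auto simp: mem_Times_iff)
  have Np: "smet c1 (fst (N p)) (snormal c1 (fst (f p))) = 0" "smet c2 (snd (N p)) (snormal c2 (snd (f p))) = 0"
    using NT[OF p] by (auto simp: tangent_to_def)
  obtain e1 n1 b1 where fr1: "smet c1 e1 (snormal c1 (fst (f p))) = 0" "smet c1 n1 (snormal c1 (fst (f p))) = 0"
    "smet c1 e1 e1 = 1" "smet c1 n1 n1 = 1" "smet c1 e1 n1 = 0" "fst (N p) = b1 *\<^sub>R n1"
    "\<And>w. smet c1 w (snormal c1 (fst (f p))) = 0 \<Longrightarrow> w = smet c1 w e1 *\<^sub>R e1 + smet c1 w n1 *\<^sub>R n1"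
    by (rule space_form_frame[OF c(1) fp(1) Np(1)]) (rule that)
  obtain e2 n2 b2 where fr2: "smet c2 e2 (snormal c2 (snd (f p))) = 0" "smet c2 n2 (snormal c2 (snd (f p))) = 0"
    "smet c2 e2 e2 = 1" "smet c2 n2 n2 = 1" "smet c2 e2 n2 = 0" "snd (N p) = b2 *\<^sub>R n2"
    "\<And>w. smet c2 w (snormal c2 (snd (f p))) = 0 \<Longrightarrow> w = smet c2 w e2 *\<^sub>R e2 + smet c2 w n2 *\<^sub>R n2"
    by (rule space_form_frame[OF c(2) fp(2) Np(2)]) (rule that)
  interpret V1: space_form_variation c1 U u "\<lambda>z. fst (f (x z))" "\<lambda>z. fst (N (x z))" "\<lambda>w. fst (\<phi>' w)" "\<lambda>w. fst (\<nu>' w)" e1 n1 b1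
    by unfold_locales (use c U fP NT xin fr1 xu in
      \<open>auto simp: mem_Times_iff tangent_to_def intro!: has_derivative_fst d\<phi> d\<nu>\<close>)
  interpret V2: space_form_variation c2 U u "\<lambda>z. snd (f (x z))" "\<lambda>z. snd (N (x z))" "\<lambda>w. snd (\<phi>' w)" "\<lambda>w. snd (\<nu>' w)" e2 n2 b2
    by unfold_locales (use c U fP NT xin fr2 xu in
      \<open>auto simp: mem_Times_iff tangent_to_def intro!: has_derivative_snd d\<phi> d\<nu>\<close>)
  define x1 y1 X1 Y1 where "x1 = (\<lambda>w. smet c1 (fst (\<phi>' w)) e1)" "y1 = (\<lambda>w. smet c1 (fst (\<phi>' w)) n1)"
    "X1 = (\<lambda>w. smet c1 (fst (\<nu>' w)) e1)" "Y1 = (\<lambda>w. smet c1 (fst (\<nu>' w)) n1)"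
  note d1 = this
  define x2 y2 X2 Y2 where "x2 = (\<lambda>w. smet c2 (snd (\<phi>' w)) e2)" "y2 = (\<lambda>w. smet c2 (snd (\<phi>' w)) n2)"
    "X2 = (\<lambda>w. smet c2 (snd (\<nu>' w)) e2)" "Y2 = (\<lambda>w. smet c2 (snd (\<nu>' w)) n2)"
  note d2 = this
  have b: "b1\<^sup>2 + b2\<^sup>2 = 1"
    using N1[OF p] fr1(4,6) fr2(4,6) by (simp add: product_metric_def smet_linear power2_eq_square)
  \<comment> \<open>Stated on all of \<open>U\<close>, not only at \<open>u\<close>, because the
    proof of \<open>sym\<close> differentiates this equation.\<close>
  have tangL: "?B (N (x z)) (frechet_derivative (\<lambda>z. f (x z)) (at z) w) = 0" if z: "z \<in> U" for z w
  proof -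
    have dxz: "(x has_derivative frechet_derivative x (at z)) (at z)" by (rule smooth_on_has_derivative[OF sx z])
    have lz: "((\<lambda>t. z + t *\<^sub>R w) has_derivative (\<lambda>h. h *\<^sub>R w)) (at (0::real))"
      by (auto intro!: derivative_eq_intros)
    have "continuous (at 0) (\<lambda>t::real. z + t *\<^sub>R w)" by (intro continuous_intros)
    then have "\<forall>\<^sub>F t in at (0::real). z + t *\<^sub>R w \<in> U"
      using U z by (simp add: continuous_at topological_tendstoD)
    then obtain \<delta> where \<delta>: "\<delta> > 0" "\<And>t::real. t \<noteq> 0 \<Longrightarrow> dist t 0 < \<delta> \<Longrightarrow> z + t *\<^sub>R w \<in> U"
      unfolding eventually_at by auto
    have "x (z + t *\<^sub>R w) \<in> M" if "t \<in> {-\<delta><..<\<delta>}" for t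
      using that \<delta>(2)[of t] z xin by (cases "t = 0") (auto simp: dist_real_def)
    moreover have "((\<lambda>t. x (z + t *\<^sub>R w)) has_derivative (\<lambda>h. frechet_derivative x (at z) (h *\<^sub>R w))) (at 0)"
      using has_derivative_compose[OF lz, of x] dxz by simp
    then have "((\<lambda>t. x (z + t *\<^sub>R w)) has_vector_derivative frechet_derivative x (at z) w) (at 0)"
      unfolding has_vector_derivative_def using linear_scale[OF has_derivative_linear[OF dxz]] by simp
    ultimately have "frechet_derivative x (at z) w \<in> tangent_space M (x z)"
      unfolding tangent_space_def mem_Collect_eq using \<delta>(1)
      by (intro exI[of _ "\<lambda>t. x (z + t *\<^sub>R w)"] exI[of _ \<delta>]) auto
    moreover have "differential M f (x z) (frechet_derivative x (at z) w) = frechet_derivative (\<lambda>z. f (x z)) (at z) w"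
      by (rule differential_chart[OF sf U(1) z xM dxz smooth_map_comp_has_derivative[OF sf U(1) z xM sx]])
    ultimately show ?thesis using Nd[OF xin[OF z]] by metis
  qed
  have yb: "b1 * y1 w + b2 * y2 w = 0" for w
    using tangL[OF U(2), of w] V1.smet_derivatives(2)[of w] V2.smet_derivatives(2)[of w]
    unfolding \<phi>'_def[symmetric] d1 d2 by (simp add: product_metric_def)
  have Yb: "b1 * Y1 w + b2 * Y2 w = 0" for w
  proof -
    have "((\<lambda>z. smet c1 (fst (N (x z))) (fst (N (x z)))) has_derivative
       (\<lambda>w. smet c1 (fst (N (x u))) (fst (\<nu>' w)) + smet c1 (fst (\<nu>' w)) (fst (N (x u))))) (at u)"
      by (rule smet.FDERIV[OF V1.\<nu>' V1.\<nu>'])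
    moreover have "((\<lambda>z. smet c2 (snd (N (x z))) (snd (N (x z)))) has_derivative
       (\<lambda>w. smet c2 (snd (N (x u))) (snd (\<nu>' w)) + smet c2 (snd (\<nu>' w)) (snd (N (x u))))) (at u)"
      by (rule smet.FDERIV[OF V2.\<nu>' V2.\<nu>'])
    ultimately have "((\<lambda>z. ?B (N (x z)) (N (x z))) has_derivative
       (\<lambda>w. (smet c1 (fst (N (x u))) (fst (\<nu>' w)) + smet c1 (fst (\<nu>' w)) (fst (N (x u))))
          + (smet c2 (snd (N (x u))) (snd (\<nu>' w)) + smet c2 (snd (\<nu>' w)) (snd (N (x u)))))) (at u)"
      unfolding product_metric_def by (rule has_derivative_add)
    moreover have "((\<lambda>z. ?B (N (x z)) (N (x z))) has_derivative (\<lambda>w. 0)) (at u)"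
      by (rule has_derivative_transform_within_open[OF has_derivative_const U]) (simp add: N1 xin)
    ultimately have "(\<lambda>w. (smet c1 (fst (N (x u))) (fst (\<nu>' w)) + smet c1 (fst (\<nu>' w)) (fst (N (x u))))
          + (smet c2 (snd (N (x u))) (snd (\<nu>' w)) + smet c2 (snd (\<nu>' w)) (snd (N (x u))))) = (\<lambda>w. 0)"
      by (rule has_derivative_unique)
    from fun_cong[OF this, of w] show ?thesis
      unfolding d1 d2 using V1.smet_derivatives(3)[of w] V2.smet_derivatives(3)[of w]
      by (simp add: smet_commute[of _ _ "fst (N (x u))"] smet_commute[of _ _ "snd (N (x u))"])
  qed
  \<comment> \<open>By \<open>yb\<close> and \<open>Yb\<close>, the pairs (y1, y2) and (Y1, Y2) are
    orthogonal to the unit vector (b1, b2), so each has a single coordinate along (b2, - b1): the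
    coefficient of the third frame vector (b2 n1, - b1 n2).\<close>
  define \<eta> H where "\<eta> = (\<lambda>w. b2 * y1 w - b1 * y2 w)" "H = (\<lambda>w. b2 * Y1 w - b1 * Y2 w)"
  note dH = this
  have solve: "y = b2 * (b2 * y - b1 * y')" "y' = - (b1 * (b2 * y - b1 * y'))" if "b1 * y + b2 * y' = 0" for y y'
  proof -
    have "b2 * (b2 * y - b1 * y') = (b1\<^sup>2 + b2\<^sup>2) * y - b1 * (b1 * y + b2 * y')"
      by (simp add: power2_eq_square algebra_simps)
    then show "y = b2 * (b2 * y - b1 * y')" using b that by simp
    have "- (b1 * (b2 * y - b1 * y')) = (b1\<^sup>2 + b2\<^sup>2) * y' - b2 * (b1 * y + b2 * y')"
      by (simp add: power2_eq_square algebra_simps)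
    then show "y' = - (b1 * (b2 * y - b1 * y'))" using b that by simp
  qed
  have y: "y1 w = b2 * \<eta> w" "y2 w = - (b1 * \<eta> w)" and Y: "Y1 w = b2 * H w" "Y2 w = - (b1 * H w)" for w
    unfolding dH using solve[OF yb] solve[OF Yb] by blast+
  have lin': "linear \<phi>'" "linear \<nu>'" using d\<phi> d\<nu> has_derivative_linear by blast+
  define X :: "real^3^3" where "X = matrix (\<lambda>w. vector [x1 w, x2 w, \<eta> w])"
  define Y :: "real^3^3" where "Y = matrix (\<lambda>w. vector [X1 w, X2 w, H w])"
  have "linear (\<lambda>w. vector [x1 w, x2 w, \<eta> w] :: real^3)"
    by (rule linearI) (simp_all add: vec_eq_iff forall_3 d1 d2 dH linear_add[OF lin'(1)] linear_scale[OF lin'(1)]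
      smet_linear algebra_simps)
  then have Xw: "X *v w = vector [x1 w, x2 w, \<eta> w]" for w
    unfolding X_def by (simp add: matrix_works)
  have "linear (\<lambda>w. vector [X1 w, X2 w, H w] :: real^3)"
    by (rule linearI) (simp_all add: vec_eq_iff forall_3 d1 d2 dH linear_add[OF lin'(2)] linear_scale[OF lin'(2)]
      smet_linear algebra_simps)
  then have Yw: "Y *v w = vector [X1 w, X2 w, H w]" for w
    unfolding Y_def by (simp add: matrix_works)
  define t where "t = b1\<^sup>2"
  have t: "0 \<le> t" "t \<le> 1" "smet c1 (fst (N p)) (fst (N p)) = t" "smet c2 (snd (N p)) (snd (N p)) = 1 - t"
  proof -
    show "0 \<le> t" "t \<le> 1" using b zero_le_power2[of b2] zero_le_power2[of b1] unfolding t_def by linarith+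
    show "smet c1 (fst (N p)) (fst (N p)) = t"
      using fr1(4,6) by (simp add: smet_linear power2_eq_square t_def)
    have "smet c2 (snd (N p)) (snd (N p)) = b2\<^sup>2"
      using fr2(4,6) by (simp add: smet_linear power2_eq_square)
    then show "smet c2 (snd (N p)) (snd (N p)) = 1 - t" using b unfolding t_def by linarith
  qed
  have inner: "(X *v w) \<bullet> (Y *v w') = ?B (\<phi>' w) (\<nu>' w')" for w w'
  proof -
    have "?B (\<phi>' w) (\<nu>' w') = x1 w * X1 w' + y1 w * Y1 w' + (x2 w * X2 w' + y2 w * Y2 w')"
      unfolding product_metric_def using V1.smet_derivatives(1)[of w w'] V2.smet_derivatives(1)[of w w']
      by (simp add: d1 d2)
    also have "\<dots> = x1 w * X1 w' + x2 w * X2 w' + (b1\<^sup>2 + b2\<^sup>2) * (\<eta> w * H w')"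
      unfolding y Y by (simp add: power2_eq_square algebra_simps)
    finally show ?thesis unfolding b Xw Yw by (simp add: inner_vec_def sum_3)
  qed
  have sym: "(X *v w) \<bullet> (Y *v w') = (X *v w') \<bullet> (Y *v w)" for w w'
  proof -
    define D where "D = (\<lambda>z w. frechet_derivative (\<lambda>z. f (x z)) (at z) w)"
    have der: "((\<lambda>z. f (x z)) has_derivative D z) (at z)" if "z \<in> U" for z
      unfolding D_def using smooth_map_comp_has_derivative[OF sf U(1) that xM sx] by (simp add: eta_contract_eq)
    have "\<exists>L. \<forall>w. ((\<lambda>z. D z w) has_derivative L w) (at u)"
      using smooth_map_comp_derivative_differentiable[OF sf U xM sx] unfolding D_def differentiable_def by metis
    then obtain D2 where D2: "\<And>w. ((\<lambda>z. D z w) has_derivative D2 w) (at u)" by blast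
    have s: "D2 w w' = D2 w' w"
      by (rule symmetric_second_derivative[OF U der D2 D2])
    \<comment> \<open>Differentiating \<open>tangL\<close> expresses the second fundamental form by
      second derivatives of \<open>f\<close> in the chart, which are symmetric.\<close>
    have key: "?B (\<phi>' w) (\<nu>' w') = - ?B (N (x u)) (D2 w w')" for w w'
    proof -
      have "((\<lambda>z. smet c1 (fst (N (x z))) (fst (D z w)) + smet c2 (snd (N (x z))) (snd (D z w))) has_derivative
        (\<lambda>h. (smet c1 (fst (N (x u))) (fst (D2 w h)) + smet c1 (fst (\<nu>' h)) (fst (D u w)))
          + (smet c2 (snd (N (x u))) (snd (D2 w h)) + smet c2 (snd (\<nu>' h)) (snd (D u w))))) (at u)"
        by (intro has_derivative_add smet.FDERIV V1.\<nu>' V2.\<nu>' has_derivative_fst has_derivative_snd D2)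
      moreover have "((\<lambda>z. smet c1 (fst (N (x z))) (fst (D z w)) + smet c2 (snd (N (x z))) (snd (D z w))) has_derivative
        (\<lambda>h. 0)) (at u)"
        by (rule has_derivative_transform_within_open[OF has_derivative_const U])
          (use tangL in \<open>simp add: D_def product_metric_def\<close>)
      ultimately have "(\<lambda>h. (smet c1 (fst (N (x u))) (fst (D2 w h)) + smet c1 (fst (\<nu>' h)) (fst (D u w)))
          + (smet c2 (snd (N (x u))) (snd (D2 w h)) + smet c2 (snd (\<nu>' h)) (snd (D u w)))) = (\<lambda>h. 0)"
        by (rule has_derivative_unique)
      from fun_cong[OF this, of w'] show ?thesis
        unfolding product_metric_def D_def \<phi>'_def
        by (simp add: smet_commute[of _ _ "fst (\<nu>' w')"] smet_commute[of _ _ "snd (\<nu>' w')"])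
    qed
    show ?thesis unfolding inner key s ..
  qed
  define a where "a = unit_curvatures c1 c2 t"
  have a: "a $ 1 = c1 * b1\<^sup>2" "a $ 2 = c2 * b2\<^sup>2" "a $ 3 = 0"
    unfolding a_def unit_curvatures_def t_def b[symmetric] by simp_all
  have core: "invertible (jac a X Y r) \<and>
       mean_curvature ?B ?P M fr Nr p = - trace (jac' a X Y r ** matrix_inv (jac a X Y r)) / 3 \<and>
       (\<forall>k. principal_multiplicity ?B ?P M fr Nr p k
          = dim {z. - (matrix_inv (jac a X Y r) ** jac' a X Y r) *v z = k *\<^sub>R z})"
    if hr: "hypersurface ?B ?P M fr Nr"
      and fr: "\<And>z. z \<in> M \<Longrightarrow> fr z = (sgeo c1 (fst (f z)) (fst (N z)) r, sgeo c2 (snd (f z)) (snd (N z)) r)"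
      and Nr: "\<And>z. z \<in> M \<Longrightarrow> Nr z = (sgeo' c1 (fst (f z)) (fst (N z)) r, sgeo' c2 (snd (f z)) (snd (N z)) r)"
    for r fr Nr
  proof -
    \<comment> \<open>Coordinates with respect to (e1, 0), (0, e2) and (b2 n1, - b1 n2), transported
      to distance \<open>r\<close>.\<close>
    define F :: "real^3 \<Rightarrow> (real^3) \<times> (real^3)" where
      "F = (\<lambda>z. (z$1 *\<^sub>R e1 + (z$3 * b2) *\<^sub>R V1.n_at r, z$2 *\<^sub>R e2 - (z$3 * b1) *\<^sub>R V2.n_at r))"
    have linF: "linear F"
      by (rule linearI) (simp_all add: F_def algebra_simps)
    have injF: "inj F"
    proof (rule linear_injective_0[THEN iffD2, OF linF], intro allI impI)
      fix z assume "F z = 0"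
      then have z1: "z$1 *\<^sub>R e1 + (z$3 * b2) *\<^sub>R V1.n_at r = 0" and z2: "z$2 *\<^sub>R e2 - (z$3 * b1) *\<^sub>R V2.n_at r = 0"
        by (auto simp: F_def prod_eq_iff)
      have "smet c1 e1 (z$1 *\<^sub>R e1 + (z$3 * b2) *\<^sub>R V1.n_at r) = z$1"
        "smet c2 e2 (z$2 *\<^sub>R e2 - (z$3 * b1) *\<^sub>R V2.n_at r) = z$2"
        using V1.ee V1.n_at_orthonormal V2.ee V2.n_at_orthonormal by (simp_all add: smet_linear)
      then have z12: "z$1 = 0" "z$2 = 0" unfolding z1 z2 by (simp_all add: smet_linear)
      have "smet c1 (z$1 *\<^sub>R e1 + (z$3 * b2) *\<^sub>R V1.n_at r) (V1.n_at r) = z$3 * b2"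
        "smet c2 (z$2 *\<^sub>R e2 - (z$3 * b1) *\<^sub>R V2.n_at r) (V2.n_at r) = - (z$3 * b1)"
        using V1.n_at_orthonormal V2.n_at_orthonormal by (simp_all add: smet_linear)
      then have z3: "z$3 * b2 = 0" "z$3 * b1 = 0" unfolding z1 z2 by (simp_all add: smet_linear)
      have "z$3 = z$3 * (b1\<^sup>2 + b2\<^sup>2)" using b by simp
      also have "\<dots> = z$3 * b1 * b1 + z$3 * b2 * b2" by (simp add: power2_eq_square algebra_simps)
      finally have "z$3 = 0" unfolding z3 by simp
      then show "z = 0" using z12 by (simp add: vec_eq_iff forall_3)
    qed
    have srM: "smooth_map M fr" "smooth_map M Nr" and injr: "inj_on (differential M fr p) (tangent_space M p)"
      and frP: "fr p \<in> ?P"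
      using hr p unfolding hypersurface_def by auto
    have "((\<lambda>z. (sgeo c1 (fst (f (x z))) (fst (N (x z))) r, sgeo c2 (snd (f (x z))) (snd (N (x z))) r)) has_derivative
       (\<lambda>w. F (jac a X Y r *v w))) (at u)"
    proof (rule has_derivative_eq_rhs[OF has_derivative_Pair[OF V1.sgeo_has_derivative V2.sgeo_has_derivative]], rule ext)
      fix w
      show "((cs (c1 * b1\<^sup>2) r * smet c1 (fst (\<phi>' w)) e1 + sn (c1 * b1\<^sup>2) r * smet c1 (fst (\<nu>' w)) e1) *\<^sub>R e1 +
         (smet c1 (fst (\<phi>' w)) n1 + r * smet c1 (fst (\<nu>' w)) n1) *\<^sub>R V1.n_at r,
         (cs (c2 * b2\<^sup>2) r * smet c2 (snd (\<phi>' w)) e2 + sn (c2 * b2\<^sup>2) r * smet c2 (snd (\<nu>' w)) e2) *\<^sub>R e2 +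
         (smet c2 (snd (\<phi>' w)) n2 + r * smet c2 (snd (\<nu>' w)) n2) *\<^sub>R V2.n_at r) = F (jac a X Y r *v w)"
        using y[of w] Y[of w] unfolding F_def jac_mult Xw Yw a d1[symmetric] d2[symmetric]
        by (simp add: d1[symmetric, THEN fun_cong] d2[symmetric, THEN fun_cong]) (simp add: algebra_simps)
    qed
    then have "((\<lambda>z. fr (x z)) has_derivative (\<lambda>w. F (jac a X Y r *v w))) (at u)"
      by (rule has_derivative_transform_within_open[OF _ U]) (simp add: fr xin)
    then have df: "differential M fr p (L w) = F (jac a X Y r *v w)" for w
      using differential_chart[OF srM(1) U xM dx] xu by simp
    \<comment> \<open>The part of the derivative of \<open>Nr\<close> that is normal to the product,
      written with \<open>snormal\<close> to match \<open>tangential_part_product\<close>.\<close>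
    let ?N = "\<lambda>w. (- (c1 * b1 * (y1 w + r * Y1 w)) *\<^sub>R snormal c1 (fst (fr p)), - (c2 * b2 * (y2 w + r * Y2 w)) *\<^sub>R snormal c2 (snd (fr p)))"
    have sn: "(c * s) *\<^sub>R snormal c v = (c * s) *\<^sub>R v" for c s v by (simp add: snormal_def)
    have frp: "fst (fr p) = sgeo c1 (fst (f (x u))) (fst (N (x u))) r" "snd (fr p) = sgeo c2 (snd (f (x u))) (snd (N (x u))) r"
      using fr[OF p] xu by simp_all
    have "((\<lambda>z. (sgeo' c1 (fst (f (x z))) (fst (N (x z))) r, sgeo' c2 (snd (f (x z))) (snd (N (x z))) r)) has_derivative
       (\<lambda>w. F (jac' a X Y r *v w) + ?N w)) (at u)"
    proof (rule has_derivative_eq_rhs[OF has_derivative_Pair[OF V1.sgeo'_has_derivative V2.sgeo'_has_derivative]], rule ext)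
      fix w
      have 1: "- (c1 * b1 * (y1 w + r * Y1 w)) *\<^sub>R snormal c1 (fst (fr p)) = - ((c1 * b1 * (y1 w + r * Y1 w)) *\<^sub>R fst (fr p))"
        "- (c2 * b2 * (y2 w + r * Y2 w)) *\<^sub>R snormal c2 (snd (fr p)) = - ((c2 * b2 * (y2 w + r * Y2 w)) *\<^sub>R snd (fr p))"
        unfolding scaleR_minus_left mult.assoc sn by simp_all
      show "((- (c1 * b1\<^sup>2) * sn (c1 * b1\<^sup>2) r * smet c1 (fst (\<phi>' w)) e1 + cs (c1 * b1\<^sup>2) r * smet c1 (fst (\<nu>' w)) e1) *\<^sub>R e1 +
         smet c1 (fst (\<nu>' w)) n1 *\<^sub>R V1.n_at r
         - (c1 * b1 * (smet c1 (fst (\<phi>' w)) n1 + r * smet c1 (fst (\<nu>' w)) n1)) *\<^sub>R sgeo c1 (fst (f (x u))) (fst (N (x u))) r,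
         (- (c2 * b2\<^sup>2) * sn (c2 * b2\<^sup>2) r * smet c2 (snd (\<phi>' w)) e2 + cs (c2 * b2\<^sup>2) r * smet c2 (snd (\<nu>' w)) e2) *\<^sub>R e2 +
         smet c2 (snd (\<nu>' w)) n2 *\<^sub>R V2.n_at r
         - (c2 * b2 * (smet c2 (snd (\<phi>' w)) n2 + r * smet c2 (snd (\<nu>' w)) n2)) *\<^sub>R sgeo c2 (snd (f (x u))) (snd (N (x u))) r)
        = F (jac' a X Y r *v w) + ?N w"
        unfolding 1 unfolding frp[symmetric]
        unfolding F_def jac_mult Xw Yw a
        by (simp add: d1[symmetric, THEN fun_cong] d2[symmetric, THEN fun_cong]) (simp add: Y mult.commute)
    qed
    then have "((\<lambda>z. Nr (x z)) has_derivative (\<lambda>w. F (jac' a X Y r *v w) + ?N w)) (at u)"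
      by (rule has_derivative_transform_within_open[OF _ U]) (simp add: Nr xin)
    then have dN: "differential M Nr p (L w) = F (jac' a X Y r *v w) + ?N w" for w
      using differential_chart[OF srM(2) U xM dx] xu by simp
    have "tangent_to c1 c2 (fr p) (F z)" for z
      unfolding tangent_to_def frp F_def
      using V1.e_tangent_at V1.n_at_tangent V2.e_tangent_at V2.n_at_tangent by (simp add: smet_linear)
    then have cd: "covariant_derivative ?B ?P M fr Nr p (L w) = F (jac' a X Y r *v w)" for w
      unfolding covariant_derivative_def dN by (rule tangential_part_product[OF c frP])
    note so = shape_operator_chart[OF linL injL[folded L_def] TL[folded L_def] linF injF injr df cd]
    show ?thesis using so(1,3,4) by blast
  qed
  have 0: "invertible X \<and> (\<forall>k. principal_multiplicity ?B ?P M f N p k = dim {z. - (matrix_inv X ** Y) *v z = k *\<^sub>R z})"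
    using core[OF hyp, of 0] by simp
  show thesis
    by (rule that[OF t sym]) (use 0 core in \<open>auto simp flip: a_def\<close>)
qed

section \<open>The determinant along the normal geodesics\<close>

text \<open>Jacobi's formula, by expansion of the determinant. In the form D' = W D it involves no
  inverse matrix.\<close>

lemma has_real_derivative_det3:
  fixes D :: "real \<Rightarrow> real^3^3" and W D' :: "real^3^3"
  assumes D: "\<And>i j. ((\<lambda>r. D r $ i $ j) has_real_derivative D' $ i $ j) (at r)" and W: "D' = W ** D r"
  shows "((\<lambda>r. det (D r)) has_real_derivative trace W * det (D r)) (at r)"
proof -
  define a b where "a = (\<lambda>i j. D r $ i $ j)" "b = (\<lambda>i j. D' $ i $ j)"
  note ab = this
  have "((\<lambda>r. det (D r)) has_real_derivative
     (b 1 1 * a 2 2 * a 3 3 + a 1 1 * b 2 2 * a 3 3 + a 1 1 * a 2 2 * b 3 3) +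
     (b 1 2 * a 2 3 * a 3 1 + a 1 2 * b 2 3 * a 3 1 + a 1 2 * a 2 3 * b 3 1) +
     (b 1 3 * a 2 1 * a 3 2 + a 1 3 * b 2 1 * a 3 2 + a 1 3 * a 2 1 * b 3 2) -
     (b 1 1 * a 2 3 * a 3 2 + a 1 1 * b 2 3 * a 3 2 + a 1 1 * a 2 3 * b 3 2) -
     (b 1 2 * a 2 1 * a 3 3 + a 1 2 * b 2 1 * a 3 3 + a 1 2 * a 2 1 * b 3 3) -
     (b 1 3 * a 2 2 * a 3 1 + a 1 3 * b 2 2 * a 3 1 + a 1 3 * a 2 2 * b 3 1)) (at r)"
    unfolding det_3 ab by (auto intro!: derivative_eq_intros D simp: algebra_simps)
  moreover have "b i j = W $ i $ 1 * a 1 j + W $ i $ 2 * a 2 j + W $ i $ 3 * a 3 j" for i j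
    unfolding ab W by (simp add: matrix_matrix_mult_def sum_3)
  moreover have "trace W = W$1$1 + W$2$2 + W$3$3" by (simp add: trace_def sum_3)
  moreover have det: "det (D r) = a 1 1 * a 2 2 * a 3 3 + a 1 2 * a 2 3 * a 3 1 + a 1 3 * a 2 1 * a 3 2 -
      a 1 1 * a 2 3 * a 3 2 - a 1 2 * a 2 1 * a 3 3 - a 1 3 * a 2 2 * a 3 1"
    unfolding det_3 ab by simp
  ultimately show ?thesis unfolding det by (simp add: algebra_simps)
qed

section \<open>Parallel hypersurfaces and the differential equation of the determinant\<close>

lemma DERIV_jac: "((\<lambda>r. jac a X Y r $ i $ j) has_real_derivative jac' a X Y r $ i $ j) (at r)"
  unfolding jac_def jac'_def
  by (auto intro!: derivative_eq_intros DERIV_cs DERIV_sn simp: algebra_simps)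

lemma parallel_map_product:
  assumes c: "c1 \<in> {1, 0, -1}" "c2 \<in> {1, 0, -1}"
    and hyp: "hypersurface (product_metric c1 c2) (space_form c1 \<times> space_form c2) M f N" and z: "z \<in> M"
  shows "parallel_map (product_metric c1 c2) (space_form c1 \<times> space_form c2) f N r z
      = (sgeo c1 (fst (f z)) (fst (N z)) r, sgeo c2 (snd (f z)) (snd (N z)) r)" (is "?p r = ?q r")
    and "parallel_normal (product_metric c1 c2) (space_form c1 \<times> space_form c2) f N r z
      = (sgeo' c1 (fst (f z)) (fst (N z)) r, sgeo' c2 (snd (f z)) (snd (N z)) r)"
proof -
  have fz: "f z \<in> space_form c1 \<times> space_form c2" using hyp z unfolding hypersurface_def by blast
  have Nz: "tangent_to c1 c2 (f z) (N z)"
    using hyp z tangent_space_product[OF c fz] unfolding hypersurface_def by blast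
  have p: "?p r = ?q r" for r
  proof -
    have "tangent_to c1 c2 (f z) (r *\<^sub>R N z)" using Nz by (simp add: tangent_to_def smet_linear)
    from riemannian_exp_product[OF c fz this] show ?thesis
      unfolding parallel_map_def by (simp add: sgeo_scale)
  qed
  then show "?p r = ?q r" .
  have "(?q has_vector_derivative (sgeo' c1 (fst (f z)) (fst (N z)) r, sgeo' c2 (snd (f z)) (snd (N z)) r)) (at r)"
    by (intro has_vector_derivative_Pair sgeo_has_vector_derivative)
  then show "parallel_normal (product_metric c1 c2) (space_form c1 \<times> space_form c2) f N r z
      = (sgeo' c1 (fst (f z)) (fst (N z)) r, sgeo' c2 (snd (f z)) (snd (N z)) r)"
    unfolding parallel_normal_def p by (rule vector_derivative_at)
qed

text \<open>The determinant of the differential of the parallel map, in frames that are parallel along the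
  normal geodesic, in terms of the matrix \<open>A\<close> of the shape operator.\<close>

definition jacobi_det :: "real^3 \<Rightarrow> real^3^3 \<Rightarrow> real \<Rightarrow> real" where
  "jacobi_det a A r = det (jac a (mat 1) (- A) r)"

lemma isoparametric_shape_matrix:
  fixes M :: "'a::euclidean_space set" and f N :: "'a \<Rightarrow> (real^3) \<times> (real^3)"
  assumes c: "c1 \<in> {1, 0, -1}" "c2 \<in> {1, 0, -1}"
    and hyp: "hypersurface (product_metric c1 c2) (space_form c1 \<times> space_form c2) M f N"
    and hypr: "\<And>r. r \<in> {-\<epsilon><..<\<epsilon>} \<Longrightarrow> hypersurface (product_metric c1 c2) (space_form c1 \<times> space_form c2) M
      (parallel_map (product_metric c1 c2) (space_form c1 \<times> space_form c2) f N r)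
      (parallel_normal (product_metric c1 c2) (space_form c1 \<times> space_form c2) f N r)"
    and mean: "\<And>r p. r \<in> {-\<epsilon><..<\<epsilon>} \<Longrightarrow> p \<in> M \<Longrightarrow> mean_curvature (product_metric c1 c2) (space_form c1 \<times> space_form c2) M
      (parallel_map (product_metric c1 c2) (space_form c1 \<times> space_form c2) f N r)
      (parallel_normal (product_metric c1 c2) (space_form c1 \<times> space_form c2) f N r) p = h r"
    and p: "p \<in> M"
  obtains A :: "real^3^3" and t where
    "0 \<le> t" "t \<le> 1" "smet c1 (fst (N p)) (fst (N p)) = t" "smet c2 (snd (N p)) (snd (N p)) = 1 - t"
    "\<And>v w. (A *v v) \<bullet> w = v \<bullet> (A *v w)"
    "\<And>k. principal_multiplicity (product_metric c1 c2) (space_form c1 \<times> space_form c2) M f N p k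
       = dim {z. A *v z = k *\<^sub>R z}"
    "\<And>r. r \<in> {-\<epsilon><..<\<epsilon>} \<Longrightarrow> jacobi_det (unit_curvatures c1 c2 t) A r \<noteq> 0 \<and>
       (jacobi_det (unit_curvatures c1 c2 t) A has_real_derivative
          - 3 * h r * jacobi_det (unit_curvatures c1 c2 t) A r) (at r)"
proof -
  let ?B = "product_metric c1 c2" and ?P = "space_form c1 \<times> space_form c2"
  obtain X Y :: "real^3^3" and t where t: "0 \<le> t" "t \<le> 1" "smet c1 (fst (N p)) (fst (N p)) = t" "smet c2 (snd (N p)) (snd (N p)) = 1 - t"
    and sym: "\<And>w w'. (X *v w) \<bullet> (Y *v w') = (X *v w') \<bullet> (Y *v w)"
    and invX: "invertible X"
    and mult: "\<And>k. principal_multiplicity ?B ?P M f N p k = dim {z. - (matrix_inv X ** Y) *v z = k *\<^sub>R z}"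
    and jac: "\<And>r fr Nr. hypersurface ?B ?P M fr Nr \<Longrightarrow>
       (\<And>z. z \<in> M \<Longrightarrow> fr z = (sgeo c1 (fst (f z)) (fst (N z)) r, sgeo c2 (snd (f z)) (snd (N z)) r)) \<Longrightarrow>
       (\<And>z. z \<in> M \<Longrightarrow> Nr z = (sgeo' c1 (fst (f z)) (fst (N z)) r, sgeo' c2 (snd (f z)) (snd (N z)) r)) \<Longrightarrow>
       invertible (jac (unit_curvatures c1 c2 t) X Y r) \<and>
       mean_curvature ?B ?P M fr Nr p =
         - trace (jac' (unit_curvatures c1 c2 t) X Y r ** matrix_inv (jac (unit_curvatures c1 c2 t) X Y r)) / 3"
    by (rule hypersurface_jacobi_matrices[OF c hyp p]) (rule that; (assumption | blast))
  let ?a = "unit_curvatures c1 c2 t"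
  have mi: "J ** matrix_inv J = mat 1" "matrix_inv J ** J = mat 1" if "invertible J" for J :: "real^3^3"
    using someI_ex[OF that[unfolded invertible_def]] unfolding matrix_inv_def by blast+
  \<comment> \<open>The shape operator in the adapted orthonormal frame. It is conjugate by
    \<open>X\<close> to its chart matrix - X^(-1) Y, but symmetric, as the chart matrix need not
    be.\<close>
  define A where "A = - (Y ** matrix_inv X)"
  have neg: "- B ** C = - (B ** C)" for B C :: "real^3^3"
    by (simp add: matrix_matrix_mult_def vec_eq_iff sum_negf)
  have AX: "A ** X = - Y"
    unfolding A_def neg by (simp add: matrix_mul_assoc[symmetric] mi[OF invX])
  have AXv: "A *v (X *v w) = - (Y *v w)" for w
    using AX by (simp add: matrix_vector_mul_assoc minus_matrix_vector_mult)
  have surj: "X *v (matrix_inv X *v z) = z" and inj: "matrix_inv X *v (X *v z) = z" for z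
    by (simp_all add: matrix_vector_mul_assoc mi[OF invX])
  have symA: "(A *v v) \<bullet> w = v \<bullet> (A *v w)" for v w
  proof -
    have "(A *v v) \<bullet> w = - ((Y *v (matrix_inv X *v v)) \<bullet> (X *v (matrix_inv X *v w)))"
      using AXv[of "matrix_inv X *v v"] surj by simp
    also have "\<dots> = - ((X *v (matrix_inv X *v v)) \<bullet> (Y *v (matrix_inv X *v w)))"
      using sym[of "matrix_inv X *v w" "matrix_inv X *v v"] by (simp add: inner_commute)
    also have "\<dots> = v \<bullet> (A *v w)"
      using AXv[of "matrix_inv X *v w"] surj by simp
    finally show ?thesis .
  qed
  have multA: "principal_multiplicity ?B ?P M f N p k = dim {z. A *v z = k *\<^sub>R z}" for k
  proof -
    have "{z. A *v z = k *\<^sub>R z} = (*v) X ` {z. - (matrix_inv X ** Y) *v z = k *\<^sub>R z}"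
    proof (intro equalityI subsetI)
      fix z assume "z \<in> {z. A *v z = k *\<^sub>R z}"
      then have z: "A *v z = k *\<^sub>R z" by simp
      have "- (matrix_inv X ** Y) *v (matrix_inv X *v z) = matrix_inv X *v (A *v z)"
        using AXv[of "matrix_inv X *v z"] surj
        by (simp add: minus_matrix_vector_mult matrix_vector_mult_uminus flip: matrix_vector_mul_assoc)
      then have "- (matrix_inv X ** Y) *v (matrix_inv X *v z) = k *\<^sub>R (matrix_inv X *v z)"
        unfolding z by (simp add: matrix_vector_mult_scaleR)
      then show "z \<in> (*v) X ` {z. - (matrix_inv X ** Y) *v z = k *\<^sub>R z}"
        using surj by (metis (mono_tags, lifting) image_eqI mem_Collect_eq)
    next
      fix z assume "z \<in> (*v) X ` {z. - (matrix_inv X ** Y) *v z = k *\<^sub>R z}"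
      then obtain y where y: "z = X *v y" "- (matrix_inv X ** Y) *v y = k *\<^sub>R y" by blast
      have "A *v z = X *v (- (matrix_inv X ** Y) *v y)"
        using surj by (simp add: y(1) AXv minus_matrix_vector_mult matrix_vector_mult_uminus flip: matrix_vector_mul_assoc)
      then show "z \<in> {z. A *v z = k *\<^sub>R z}" unfolding y by (simp add: matrix_vector_mult_scaleR)
    qed
    moreover have "inj ((*v) X)" by (metis injI inj)
    ultimately show ?thesis unfolding mult
      using dim_image_eq[OF matrix_vector_mul_linear inj_on_subset[OF _ subset_UNIV], of X] by presburger
  qed
  have detX: "det X \<noteq> 0" using invX invertible_det_nz by blast
  \<comment> \<open>Dividing by \<open>det X\<close> removes the chart and makes the initial value 1
    at every point.\<close>
  have jd: "jacobi_det ?a A r = det (jac ?a X Y r) / det X" for r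
  proof -
    have "jac ?a X Y r = jac ?a (mat 1) (- A) r ** X"
    proof -
      have "(jac ?a (mat 1) (- A) r ** X) $ i $ j = cs (?a$i) r * (mat 1 ** X)$i$j + sn (?a$i) r * ((- A) ** X) $i$j" for i j
        by (simp add: jac_def matrix_matrix_mult_def sum_distrib_left sum.distrib sum_subtractf sum_negf algebra_simps)
      then show ?thesis unfolding neg AX by (simp add: jac_def vec_eq_iff)
    qed
    then have "det (jac ?a X Y r) = jacobi_det ?a A r * det X" by (simp add: det_mul jacobi_det_def)
    then show ?thesis using detX by simp
  qed
  have ode: "jacobi_det ?a A r \<noteq> 0 \<and>
       (jacobi_det ?a A has_real_derivative - 3 * h r * jacobi_det ?a A r) (at r)" if r: "r \<in> {-\<epsilon><..<\<epsilon>}" for r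
  proof -
    let ?J = "jac ?a X Y r" and ?J' = "jac' ?a X Y r"
    have J: "invertible ?J" "h r = - trace (?J' ** matrix_inv ?J) / 3"
      using jac[OF hypr[OF r] parallel_map_product[OF c hyp]] mean[OF r p] by simp_all
    have "?J' = (?J' ** matrix_inv ?J) ** ?J"
      by (simp add: matrix_mul_assoc[symmetric] mi[OF J(1)])
    from has_real_derivative_det3[of "jac ?a X Y", OF DERIV_jac this]
    have "((\<lambda>r. det (jac ?a X Y r)) has_real_derivative - 3 * h r * det ?J) (at r)"
      using J(2) by simp
    then have "((\<lambda>r. det (jac ?a X Y r) / det X) has_real_derivative - 3 * h r * det ?J / det X) (at r)"
      by (rule DERIV_cdivide)
    then have "(jacobi_det ?a A has_real_derivative - 3 * h r * jacobi_det ?a A r) (at r)"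
      unfolding jd[abs_def] by simp
    moreover have "jacobi_det ?a A r \<noteq> 0" using J(1) detX invertible_det_nz unfolding jd by auto
    ultimately show ?thesis by blast
  qed
  show thesis by (rule that[OF t symA multA ode])
qed

lemma jacobi_det_0: "jacobi_det a A 0 = 1"
  by (simp add: jacobi_det_def)

text \<open>The quotient has derivative zero. The coefficient \<open>k\<close> is an arbitrary
  function, because \<open>h\<close> is merely some function of \<open>r\<close>.\<close>

lemma linear_ode_unique:
  fixes g :: "real \<Rightarrow> real"
  assumes g: "\<And>r. r \<in> {-\<epsilon><..<\<epsilon>} \<Longrightarrow> (g has_real_derivative k r * g r) (at r)"
    and g': "\<And>r. r \<in> {-\<epsilon><..<\<epsilon>} \<Longrightarrow> g' r \<noteq> 0 \<and> (g' has_real_derivative k r * g' r) (at r)"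
    and "g 0 = g' 0" and r: "r \<in> {-\<epsilon><..<\<epsilon>}"
  shows "g r = g' r"
proof -
  have d: "((\<lambda>s. g s / g' s) has_real_derivative 0) (at s)" if s: "s \<in> {-\<epsilon><..<\<epsilon>}" for s
    using DERIV_divide[OF g[OF s] conjunct2[OF g'[OF s]] conjunct1[OF g'[OF s]]] by (simp add: algebra_simps)
  have "\<exists>C. \<forall>s\<in>{-\<epsilon><..<\<epsilon>}. g s / g' s = C"
    using d by (intro has_field_derivative_zero_constant) (auto intro: has_field_derivative_at_within)
  then have "g r / g' r = g 0 / g' 0" using r by force
  then show ?thesis using assms(3) g' r g'[of 0] by (auto simp: field_simps)
qed

section \<open>Taylor coefficients of the determinant\<close>

text \<open>The products of \<open>cs\<close> and \<open>sn\<close> for two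
  curvatures \<open>a\<close> and \<open>b\<close> span a space that is closed under differentiation, and so do these
  products together with their multiples by \<open>r\<close>. Differentiation acts on the coefficients, which
  gives the Taylor coefficients at \<open>0\<close> without expanding a series.\<close>

type_synonym quad = "real \<times> real \<times> real \<times> real"

fun quad_val :: "real \<Rightarrow> real \<Rightarrow> quad \<Rightarrow> real \<Rightarrow> real" where
  "quad_val a b (x0, x1, x2, x3) r =
     x0 * (cs a r * cs b r) + x1 * (sn a r * cs b r) + x2 * (cs a r * sn b r) + x3 * (sn a r * sn b r)"

fun quad_deriv :: "real \<Rightarrow> real \<Rightarrow> quad \<Rightarrow> quad" where
  "quad_deriv a b (x0, x1, x2, x3) = (x1 + x2, x3 - a * x0, x3 - b * x0, - b * x1 - a * x2)"

definition lin_val :: "real \<Rightarrow> real \<Rightarrow> quad \<times> quad \<Rightarrow> real \<Rightarrow> real" where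
  "lin_val a b z r = quad_val a b (fst z) r + r * quad_val a b (snd z) r"

definition lin_deriv :: "real \<Rightarrow> real \<Rightarrow> quad \<times> quad \<Rightarrow> quad \<times> quad" where
  "lin_deriv a b z = (quad_deriv a b (fst z) + snd z, quad_deriv a b (snd z))"

lemma quad_val_add: "quad_val a b (x + y) r = quad_val a b x r + quad_val a b y r"
  by (cases x; cases y) (simp add: algebra_simps)

lemma quad_val_0: "quad_val a b x 0 = fst x"
  by (cases x) simp

lemma DERIV_quad_val: "(quad_val a b x has_real_derivative quad_val a b (quad_deriv a b x) r) (at r)"
proof (cases x)
  case (fields x0 x1 x2 x3)
  have "((\<lambda>r. x0 * (cs a r * cs b r) + x1 * (sn a r * cs b r) + x2 * (cs a r * sn b r) + x3 * (sn a r * sn b r))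
    has_real_derivative quad_val a b (quad_deriv a b x) r) (at r)"
    unfolding fields by (auto intro!: derivative_eq_intros DERIV_cs DERIV_sn simp: algebra_simps)
  then show ?thesis unfolding fields by (simp add: quad_val.simps[abs_def])
qed

lemma DERIV_lin_val: "(lin_val a b z has_real_derivative lin_val a b (lin_deriv a b z) r) (at r)"
  unfolding lin_val_def[abs_def]
  by (auto intro!: derivative_eq_intros DERIV_quad_val simp: lin_deriv_def quad_val_add algebra_simps)

text \<open>Each step gives equality of the derivatives on the whole interval, which can be
  differentiated again; only at the end is \<open>r = 0\<close> inserted.\<close>

lemma lin_val_eq_iterate:
  assumes "\<And>r. r \<in> {-\<epsilon><..<\<epsilon>} \<Longrightarrow> lin_val a b z r = lin_val a' b' z' r" and r: "r \<in> {-\<epsilon><..<\<epsilon>}"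
  shows "lin_val a b ((lin_deriv a b ^^ n) z) r = lin_val a' b' ((lin_deriv a' b' ^^ n) z') r"
  using r
proof (induction n arbitrary: r)
  case (Suc n)
  have "((\<lambda>r. lin_val a b ((lin_deriv a b ^^ n) z) r) has_real_derivative
      lin_val a' b' ((lin_deriv a' b' ^^ Suc n) z') r) (at r)"
    by (rule has_field_derivative_transform_within_open[of "lin_val a' b' ((lin_deriv a' b' ^^ n) z')" _ _ "{-\<epsilon><..<\<epsilon>}"])
      (use Suc DERIV_lin_val in simp_all)
  then show ?case using DERIV_lin_val[of a b "(lin_deriv a b ^^ n) z" r] DERIV_unique by fastforce
qed (use assms in simp)

lemma lin_val_0: "lin_val a b z 0 = fst (fst z)"
  by (simp add: lin_val_def quad_val_0)

text \<open>Coefficients of det (diag(cs) - diag(sn) A) when the third curvature is 0, so that the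
  third row has cs = 1 and sn = r. Taking sn in a set of rows contributes the principal minor of A
  on these rows, with a sign for each row; the second component collects the sets that contain row
  3.\<close>

definition shape_state :: "real^3^3 \<Rightarrow> quad \<times> quad" where
  "shape_state A =
    ((1, - A$1$1, - A$2$2, A$1$1 * A$2$2 - A$1$2 * A$2$1),
     (- A$3$3, A$1$1 * A$3$3 - A$1$3 * A$3$1, A$2$2 * A$3$3 - A$2$3 * A$3$2, - det A))"

lemma jacobi_det_eq:
  assumes "a$3 = 0"
  shows "jacobi_det a A r = lin_val (a$1) (a$2) (shape_state A) r"
  unfolding jacobi_det_def det_3 jac_def lin_val_def shape_state_def
  by (simp add: assms mat_def algebra_simps)

text \<open>The second elementary symmetric polynomial of the eigenvalues.\<close>

definition sigma2 :: "real^3^3 \<Rightarrow> real" where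
  "sigma2 A = A$1$1 * A$2$2 - A$1$2 * A$2$1 + (A$1$1 * A$3$3 - A$1$3 * A$3$1) + (A$2$2 * A$3$3 - A$2$3 * A$3$2)"

lemma taylor_coefficients_1_2:
  "fst (fst ((lin_deriv a b ^^ 1) (shape_state A))) = - trace A"
  "fst (fst ((lin_deriv a b ^^ 2) (shape_state A))) = 2 * sigma2 A - (a + b)"
  by (simp_all add: shape_state_def lin_deriv_def trace_def sum_3 sigma2_def numeral_2_eq_2 algebra_simps)

text \<open>The hypotheses say that the derivatives of order 1, 3, 5 and 7 at \<open>0\<close> of a combination
  \<open>x1\<close>, \<open>x2\<close>, \<open>y0\<close>, \<open>y3\<close> of the four odd products vanish, see \<open>taylor_coefficients_odd\<close>. The other
  three coefficients need not vanish.\<close>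

lemma determinant_coefficient_unique:
  fixes a b x1 x2 y0 y3 :: real
  assumes ab: "a = b \<Longrightarrow> a = 0"
    and e1: "x1 + x2 + y0 = 0"
    and e3: "(- a - 3 * b) * x1 + (- 3 * a - b) * x2 + (- 3 * a - 3 * b) * y0 + 6 * y3 = 0"
    and e5: "(a\<^sup>2 + 10 * a * b + 5 * b\<^sup>2) * x1 + (5 * a\<^sup>2 + 10 * a * b + b\<^sup>2) * x2
      + (5 * a\<^sup>2 + 30 * a * b + 5 * b\<^sup>2) * y0 - 20 * (a + b) * y3 = 0"
    and e7: "(- (a ^ 3) - 21 * a\<^sup>2 * b - 35 * a * b\<^sup>2 - 7 * b ^ 3) * x1
      + (- 7 * a ^ 3 - 35 * a\<^sup>2 * b - 21 * a * b\<^sup>2 - b ^ 3) * x2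
      + (- 7 * a ^ 3 - 105 * a\<^sup>2 * b - 105 * a * b\<^sup>2 - 7 * b ^ 3) * y0
      + (42 * a\<^sup>2 + 140 * a * b + 42 * b\<^sup>2) * y3 = 0"
  shows "y3 = 0"
proof -
  have y0: "y0 = - x1 - x2" using e1 by simp
  \<comment> \<open>Once \<open>y0\<close> is eliminated by order 1, \<open>x1\<close> occurs only
    with a factor \<open>a\<close> and \<open>x2\<close> only with a factor
    \<open>b\<close>.\<close>
  define p q where "p = a * x1" "q = b * x2"
  note pq = this
  have f3: "p + q + 3 * y3 = 0"
    using e3 unfolding y0 pq by (simp add: algebra_simps)
  have f5: "(a + 5 * b) * p + (5 * a + b) * q + 5 * (a + b) * y3 = 0"
    using e5 unfolding y0 pq by (simp add: power2_eq_square algebra_simps)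
  have f7: "(6 * a\<^sup>2 + 84 * a * b + 70 * b\<^sup>2) * p + (70 * a\<^sup>2 + 84 * a * b + 6 * b\<^sup>2) * q
      + (42 * a\<^sup>2 + 140 * a * b + 42 * b\<^sup>2) * y3 = 0"
    using e7 unfolding y0 pq by (simp add: power2_eq_square power3_eq_cube algebra_simps)
  have p: "p = - q - 3 * y3" using f3 by simp
  have g5: "4 * (a - b) * q + (2 * a - 10 * b) * y3 = 0"
    using f5 unfolding p by (simp add: algebra_simps)
  have g7: "64 * (a - b) * (a + b) * q + (24 * a\<^sup>2 - 112 * a * b - 168 * b\<^sup>2) * y3 = 0"
    using f7 unfolding p by (simp add: power2_eq_square algebra_simps)
  \<comment> \<open>\<open>16 * (a + b)\<close> times \<open>g5\<close> cancels the
    \<open>q\<close>-term of \<open>g7\<close> and leaves a multiple of \<open>y3\<close> that is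
    nonzero unless \<open>a = b\<close>.\<close>
  have "8 * (a - b)\<^sup>2 * y3 = 16 * (a + b) * (4 * (a - b) * q + (2 * a - 10 * b) * y3)
      - (64 * (a - b) * (a + b) * q + (24 * a\<^sup>2 - 112 * a * b - 168 * b\<^sup>2) * y3)"
    by (simp add: power2_eq_square algebra_simps)
  then have "8 * (a - b)\<^sup>2 * y3 = 0" unfolding g5 g7 by simp
  then show ?thesis
  proof (cases "a = b")
    case True
    \<comment> \<open>Now \<open>a = b = 0\<close>, so \<open>p = q = 0\<close> and order 3 reads
      \<open>3 * y3 = 0\<close>.\<close>
    then show ?thesis using ab f3 unfolding pq by simp
  qed simp
qed

text \<open>\<open>x0\<close>, \<open>x3\<close>, \<open>y1\<close> and \<open>y2\<close> belong to
  products that are even in \<open>r\<close>, so they drop out.\<close>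

lemma taylor_coefficients_odd:
  fixes x0 x1 x2 x3 y0 y1 y2 y3 a b :: real
  defines "z \<equiv> ((x0, x1, x2, x3), (y0, y1, y2, y3))"
  shows "fst (fst ((lin_deriv a b ^^ 3) z)) = (- a - 3 * b) * x1 + (- 3 * a - b) * x2 + (- 3 * a - 3 * b) * y0 + 6 * y3"
    and "fst (fst ((lin_deriv a b ^^ 5) z)) = (a\<^sup>2 + 10 * a * b + 5 * b\<^sup>2) * x1 + (5 * a\<^sup>2 + 10 * a * b + b\<^sup>2) * x2
      + (5 * a\<^sup>2 + 30 * a * b + 5 * b\<^sup>2) * y0 - 20 * (a + b) * y3"
    and "fst (fst ((lin_deriv a b ^^ 7) z)) = (- (a ^ 3) - 21 * a\<^sup>2 * b - 35 * a * b\<^sup>2 - 7 * b ^ 3) * x1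
      + (- 7 * a ^ 3 - 35 * a\<^sup>2 * b - 21 * a * b\<^sup>2 - b ^ 3) * x2
      + (- 7 * a ^ 3 - 105 * a\<^sup>2 * b - 105 * a * b\<^sup>2 - 7 * b ^ 3) * y0
      + (42 * a\<^sup>2 + 140 * a * b + 42 * b\<^sup>2) * y3"
  unfolding z_def
  by (simp_all add: lin_deriv_def numeral_eq_Suc algebra_simps)

section \<open>Eigenvalue multiplicities of symmetric matrices of order three\<close>

text \<open>\<open>v\<close> maximizes the quadratic form on the unit sphere of the invariant
  subspace \<open>S\<close>. Working in \<open>S\<close> allows iteration on orthogonal
  complements.\<close>

lemma symmetric_matrix_eigenvector:
  fixes A :: "real^'n^'n"
  assumes sym: "\<And>v w. (A *v v) \<bullet> w = v \<bullet> (A *v w)"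
    and S: "subspace S" "\<And>v. v \<in> S \<Longrightarrow> A *v v \<in> S" and "v0 \<in> S" "v0 \<noteq> 0"
  obtains v l where "v \<in> S" "norm v = 1" "A *v v = l *\<^sub>R v"
proof -
  let ?K = "S \<inter> sphere 0 1"
  have "compact ?K"
    using closed_subspace[OF S(1)] by (simp add: closed_Int_compact)
  moreover have "v0 /\<^sub>R norm v0 \<in> ?K" using assms by (simp add: subspace_scale)
  then have "?K \<noteq> {}" by blast
  moreover have "continuous_on ?K (\<lambda>v. (A *v v) \<bullet> v)"
    by (intro continuous_on_inner matrix_vector_mult_linear_continuous_on continuous_on_id)
  ultimately obtain v where v: "v \<in> ?K" "\<And>w. w \<in> ?K \<Longrightarrow> (A *v w) \<bullet> w \<le> (A *v v) \<bullet> v"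
    using continuous_attains_sup[of ?K "\<lambda>v. (A *v v) \<bullet> v"] by blast
  define l where "l = (A *v v) \<bullet> v"
  have vS: "v \<in> S" and nv: "norm v = 1" using v(1) by auto
  have vv: "v \<bullet> v = 1" using nv by (simp add: norm_eq_1)
  have max: "(A *v w) \<bullet> w \<le> l * (w \<bullet> w)" if w: "w \<in> S" for w
  proof (cases "w = 0")
    case False
    then have "w /\<^sub>R norm w \<in> ?K" using w S(1) by (simp add: subspace_scale)
    from v(2)[OF this] have "(A *v w) \<bullet> w / (norm w)\<^sup>2 \<le> l"
      by (simp add: matrix_vector_mult_scaleR l_def power2_eq_square divide_inverse mult_ac)
    then show ?thesis using False by (simp add: pos_divide_le_eq power2_norm_eq_inner)
  qed simp
  \<comment> \<open>\<open>d\<close> measures the failure of \<open>v\<close> to be an eigenvector.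
    Moving from \<open>v\<close> in this direction would raise the form to first order by
    \<open>2 * (d \<bullet> d)\<close>, against maximality.\<close>
  define d where "d = A *v v - l *\<^sub>R v"
  have dS: "d \<in> S" unfolding d_def using S vS by (simp add: subspace_diff subspace_scale)
  have dv: "d \<bullet> v = 0" unfolding d_def by (simp add: inner_diff_left l_def vv)
  have Avd: "(A *v v) \<bullet> d = d \<bullet> d"
    using dv unfolding d_def by (simp add: inner_diff_left inner_diff_right inner_commute algebra_simps)
  have ineq: "2 * (d \<bullet> d) \<le> s * (l * (d \<bullet> d) - (A *v d) \<bullet> d)" if s: "s > 0" for s
  proof -
    have "v + s *\<^sub>R d \<in> S" using vS dS S(1) by (simp add: subspace_add subspace_scale)
    from max[OF this] have "l + 2 * s * ((A *v v) \<bullet> d) + s * s * ((A *v d) \<bullet> d) \<le> l * (1 + s * s * (d \<bullet> d))"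
      using dv sym[of d v] vv
      by (simp add: matrix_vector_right_distrib matrix_vector_mult_scaleR inner_add_left inner_add_right
          l_def inner_commute algebra_simps)
    then have "s * (2 * (d \<bullet> d)) \<le> s * (s * (l * (d \<bullet> d) - (A *v d) \<bullet> d))"
      unfolding Avd by (simp add: algebra_simps)
    then show ?thesis using s by simp
  qed
  have "d \<bullet> d \<le> 0"
  proof (rule ccontr)
    assume "\<not> d \<bullet> d \<le> 0"
    then have pos: "d \<bullet> d > 0" by linarith
    \<comment> \<open>With s = (d \<bullet> d) / C the second-order term is at most d \<bullet> d,
      half of the first-order one; the summand 1 keeps \<open>C\<close> positive.\<close>
    define C where "C = \<bar>l * (d \<bullet> d) - (A *v d) \<bullet> d\<bar> + 1"
    have C: "C > 0" unfolding C_def by simp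
    have "2 * (d \<bullet> d) \<le> (d \<bullet> d) / C * (l * (d \<bullet> d) - (A *v d) \<bullet> d)"
      using ineq[of "(d \<bullet> d) / C"] pos C by simp
    also have "\<dots> \<le> (d \<bullet> d) / C * C"
      using pos C by (intro mult_left_mono) (auto simp: C_def)
    finally show False using pos C by (simp del: inner_gt_zero_iff)
  qed
  then have "d \<bullet> d = 0" using inner_ge_zero[of d] by linarith
  then have "d = 0" by simp
  then show thesis using that[of v l] vS nv by (simp add: d_def)
qed

lemma exists_orthogonal:
  fixes B :: "(real^3) set"
  assumes "finite B" "card B < 3"
  obtains z where "z \<noteq> 0" "\<And>y. y \<in> B \<Longrightarrow> z \<bullet> y = 0"
proof -
  have "dim (span B) < DIM(real^3)" using dim_le_card'[OF assms(1)] assms(2) by simp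
  then obtain z where "z \<noteq> 0" "\<And>y. y \<in> span B \<Longrightarrow> orthogonal z y"
    using orthogonal_to_subspace_exists[of B] by (auto simp: dim_span)
  then show thesis using that[of z] by (auto simp: orthogonal_def span_base)
qed

text \<open>By symmetry the orthogonal complement of the eigenvectors found so far is invariant; it
  is nonzero as long as there are fewer than three. The rows of \<open>V\<close> are the
  eigenvectors.\<close>

lemma symmetric_matrix_diagonalization:
  fixes A :: "real^3^3"
  assumes sym: "\<And>v w. (A *v v) \<bullet> w = v \<bullet> (A *v w)"
  obtains V :: "real^3^3" and l :: "real^3"
  where "\<And>i j. V $ i \<bullet> V $ j = (if i = j then 1 else 0)" "\<And>i. A *v (V $ i) = l $ i *\<^sub>R V $ i"
proof -
  have orth: "\<exists>v l. norm v = 1 \<and> A *v v = l *\<^sub>R v \<and> (\<forall>y\<in>B. v \<bullet> y = 0)"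
    if B: "finite B" "card B < 3" "\<And>y. y \<in> B \<Longrightarrow> \<exists>k. A *v y = k *\<^sub>R y" for B :: "(real^3) set"
  proof -
    let ?S = "{v. \<forall>y\<in>B. v \<bullet> y = 0}"
    obtain z where z: "z \<noteq> 0" "\<And>y. y \<in> B \<Longrightarrow> z \<bullet> y = 0" by (rule exists_orthogonal[OF B(1,2)]) (rule that; assumption)
    have "subspace ?S" by (auto simp: subspace_def inner_add_left)
    moreover have "A *v v \<in> ?S" if v: "v \<in> ?S" for v
    proof -
      have "(A *v v) \<bullet> y = 0" if y: "y \<in> B" for y
      proof -
        obtain k where "A *v y = k *\<^sub>R y" using B(3)[OF y] by blast
        then show ?thesis using v y by (simp add: sym)
      qed
      then show ?thesis by blast
    qed
    ultimately obtain v l where "v \<in> ?S" "norm v = 1" "A *v v = l *\<^sub>R v"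
      using symmetric_matrix_eigenvector[OF sym, of ?S z] z by blast
    then show ?thesis by blast
  qed
  obtain v1 l1 where 1: "norm v1 = 1" "A *v v1 = l1 *\<^sub>R v1" using orth[of "{}"] by auto
  obtain v2 l2 where 2: "norm v2 = 1" "A *v v2 = l2 *\<^sub>R v2" "v2 \<bullet> v1 = 0" using orth[of "{v1}"] 1 by auto
  have "card {v1, v2} < 3" by (simp add: card_insert_if)
  then obtain v3 l3 where 3: "norm v3 = 1" "A *v v3 = l3 *\<^sub>R v3" "v3 \<bullet> v1 = 0" "v3 \<bullet> v2 = 0"
    using orth[of "{v1, v2}"] 1 2 by auto
  define V :: "real^3^3" where "V = vector [v1, v2, v3]"
  define l :: "real^3" where "l = vector [l1, l2, l3]"
  have "V $ i \<bullet> V $ j = (if i = j then 1 else 0)" for i j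
    using exhaust_3[of i] exhaust_3[of j] 1 2 3 unfolding V_def
    by (auto simp: norm_eq_1 inner_commute)
  moreover have "A *v (V $ i) = l $ i *\<^sub>R V $ i" for i
    using exhaust_3[of i] 1 2 3 unfolding V_def l_def by auto
  ultimately show thesis by (rule that)
qed

text \<open>A multiset, so that \<open>count\<close> is the multiplicity of an eigenvalue.\<close>

definition spectrum3 :: "real^3 \<Rightarrow> real multiset" where
  "spectrum3 l = {#l$1, l$2, l$3#}"

lemma symmetric_matrix_spectrum:
  fixes A :: "real^3^3"
  assumes sym: "\<And>v w. (A *v v) \<bullet> w = v \<bullet> (A *v w)"
  obtains l where "\<And>k. dim {z. A *v z = k *\<^sub>R z} = count (spectrum3 l) k"
    "trace A = l$1 + l$2 + l$3" "sigma2 A = l$1 * l$2 + l$1 * l$3 + l$2 * l$3" "det A = l$1 * l$2 * l$3"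
proof -
  obtain V :: "real^3^3" and l :: "real^3" where V: "\<And>i j. V $ i \<bullet> V $ j = (if i = j then 1 else 0)"
    and l: "\<And>i. A *v (V $ i) = l $ i *\<^sub>R V $ i"
    by (rule symmetric_matrix_diagonalization[OF sym]) (rule that; assumption)
  have VV: "V ** transpose V = mat 1"
    using V by (simp add: vec_eq_iff matrix_matrix_mult_def transpose_def mat_def inner_vec_def)
  then have VV': "transpose V ** V = mat 1" using matrix_left_right_inverse by blast
  have Vv: "(V *v z) $ i = V $ i \<bullet> z" for z i
    by (simp add: matrix_vector_mul_component)
  have "dim {z. A *v z = k *\<^sub>R z} = count (spectrum3 l) k" for k
  proof -
    have inj: "inj ((*v) V)"
      by (rule injI) (metis VV' matrix_vector_mul_assoc matrix_vector_mul_lid)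
    \<comment> \<open>\<open>V\<close> passes to coordinates in the eigenbasis, where the eigenspace
      of \<open>k\<close> becomes a coordinate subspace.\<close>
    have "(*v) V ` {z. A *v z = k *\<^sub>R z} = {w :: real^3. \<forall>i. i \<notin> {i. l $ i = k} \<longrightarrow> w $ i = 0}"
    proof (intro equalityI subsetI)
      fix w assume "w \<in> (*v) V ` {z. A *v z = k *\<^sub>R z}"
      then obtain z where z: "A *v z = k *\<^sub>R z" "w = V *v z" by blast
      have "l $ i * w $ i = k * w $ i" for i
        using sym[of "V $ i" z] unfolding l z by (simp add: Vv)
      then show "w \<in> {w. \<forall>i. i \<notin> {i. l $ i = k} \<longrightarrow> w $ i = 0}" by force
    next
      fix w :: "real^3" assume w: "w \<in> {w. \<forall>i. i \<notin> {i. l $ i = k} \<longrightarrow> w $ i = 0}"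
      define z where "z = transpose V *v w"
      have wz: "w = V *v z" unfolding z_def matrix_vector_mul_assoc VV by simp
      have "(V *v (A *v z)) $ i = (V *v (k *\<^sub>R z)) $ i" for i
      proof -
        have "(V *v (A *v z)) $ i = l $ i * w $ i"
          unfolding Vv using sym[of "V $ i" z] wz by (simp add: l Vv)
        also have "\<dots> = k * w $ i" using w by (cases "l $ i = k") auto
        finally show ?thesis using wz by (simp add: Vv)
      qed
      then have "V *v (A *v z) = V *v (k *\<^sub>R z)" by (simp add: vec_eq_iff)
      then have "A *v z = k *\<^sub>R z" using inj by (simp add: inj_eq)
      then show "w \<in> (*v) V ` {z. A *v z = k *\<^sub>R z}" using wz by blast
    qed
    then have "dim {z. A *v z = k *\<^sub>R z} = dim {w :: real^3. \<forall>i. i \<notin> {i. l $ i = k} \<longrightarrow> w $ i = 0}"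
      using dim_image_eq[OF matrix_vector_mul_linear inj_on_subset[OF inj subset_UNIV], of "{z. A *v z = k *\<^sub>R z}"]
      by presburger
    also have "\<dots> = card {i. l $ i = k}" using dim_substandard_cart[of "{i. l $ i = k}", where 'a = real] unfolding dim_vec_eq .
    also have "\<dots> = (\<Sum>i\<in>UNIV. if l $ i = k then 1 else 0)" by (simp add: sum.If_cases)
    also have "\<dots> = count (spectrum3 l) k" by (simp add: sum_3 spectrum3_def)
    finally show ?thesis .
  qed
  moreover have cp: "det (mat x - A) = (x - l$1) * (x - l$2) * (x - l$3)" for x
  proof -
    \<comment> \<open>Conjugation by the orthogonal matrix \<open>V\<close> makes
      \<open>mat x - A\<close> diagonal.\<close>
    let ?B = "V ** ((mat x - A) ** transpose V)"
    have "(mat x - A) *v V $ j = (x - l $ j) *\<^sub>R V $ j" for j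
    proof -
      have "mat x *v v = x *\<^sub>R v" for v :: "real^3"
        by (simp add: matrix_vector_mult_def mat_def vec_eq_iff if_distrib[of "\<lambda>a. a * _"] cong: if_cong)
      then show ?thesis using l[of j] by (simp add: matrix_vector_mult_diff_rdistrib scaleR_diff_left)
    qed
    moreover have "?B $ i $ j = V $ i \<bullet> ((mat x - A) *v V $ j)" for i j
      by (simp add: matrix_matrix_mult_def transpose_def inner_vec_def matrix_vector_mult_def)
    ultimately have B: "?B $ i $ j = (if i = j then x - l $ j else 0)" for i j
      using V[of i j] by simp
    have "det ?B = (\<Prod>i\<in>UNIV. ?B $ i $ i)" by (rule det_diagonal) (simp only: B if_False)
    also have "\<dots> = (\<Prod>i\<in>UNIV. x - l $ i)" unfolding B by simp
    also have "\<dots> = (x - l$1) * (x - l$2) * (x - l$3)"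
      unfolding UNIV_3 by (simp add: mult.assoc)
    finally have "det ?B = (x - l$1) * (x - l$2) * (x - l$3)" .
    moreover have "det ?B = (det V * det (transpose V)) * det (mat x - A)" by (simp add: det_mul)
    moreover have "det V * det (transpose V) = 1" using arg_cong[OF VV, of det] by (simp add: det_mul)
    ultimately show ?thesis by simp
  qed
  have cp': "det (mat x - A) = x ^ 3 - trace A * x\<^sup>2 + sigma2 A * x - det A" for x
    by (simp add: det_3 mat_def trace_def sum_3 sigma2_def power2_eq_square power3_eq_cube algebra_simps)
  have "x ^ 3 - trace A * x\<^sup>2 + sigma2 A * x - det A = (x - l$1) * (x - l$2) * (x - l$3)" for x
    using cp[of x] cp'[of x] by simp
  \<comment> \<open>Both cubics are monic, so three values determine the other coefficients.\<close>
  from this[of 0] this[of 1] this[of "-1"]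
  have "det A = l$1 * l$2 * l$3" and 1: "trace A = l$1 + l$2 + l$3" "sigma2 A = l$1 * l$2 + l$1 * l$3 + l$2 * l$3"
    by (simp_all add: algebra_simps)
  ultimately show thesis using that by blast
qed

section \<open>Multisets and elementary symmetric polynomials\<close>

lemma multiset_two_eqI:
  fixes a b c d :: real
  assumes "a + b = c + d" "a * b = c * d"
  shows "{#a, b#} = {#c, d#}"
proof -
  have "(a - c) * (a - d) = a * (a + b - (c + d)) - (a * b - c * d)" by (simp add: algebra_simps)
  then have "a = c \<or> a = d" using assms by simp
  then show ?thesis using assms(1) by (auto simp: add_mset_commute)
qed

lemma multiset_three_eqI:
  fixes a b c x y z :: real
  assumes s: "a + b + c = x + y + z" "a * b + a * c + b * c = x * y + x * z + y * z" "a * b * c = x * y * z"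
  shows "{#a, b, c#} = {#x, y, z#}"
proof -
  \<comment> \<open>The product \<open>b * c\<close> is found from the second symmetric polynomial,
    since the third would not determine it for \<open>a = 0\<close>.\<close>
  have aux: "{#a, b, c#} = {#a, y, z#}" if "a + b + c = a + y + z" "a * b + a * c + b * c = a * y + a * z + y * z" for y z
  proof -
    have bc: "b + c = y + z" using that(1) by simp
    have "b * c = y * z" using that(2) arg_cong[OF bc, of "(*) a"] by (simp add: algebra_simps)
    then have "{#b, c#} = {#y, z#}" by (rule multiset_two_eqI[OF bc])
    then show ?thesis by simp
  qed
  \<comment> \<open>\<open>a\<close> is a root of the cubic with roots \<open>x\<close>,
    \<open>y\<close>, \<open>z\<close>.\<close>
  have "(a - x) * (a - y) * (a - z) = a\<^sup>2 * (a + b + c - (x + y + z))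
      - a * (a * b + a * c + b * c - (x * y + x * z + y * z)) + (a * b * c - x * y * z)"
    by (simp add: power2_eq_square algebra_simps)
  then have "a = x \<or> a = y \<or> a = z" using s by simp
  then consider "a = x" | "a = y" | "a = z" by blast
  then show ?thesis
  proof cases
    case 1
    then show ?thesis using aux[of y z] s by simp
  next
    case 2
    then show ?thesis using aux[of x z] s by (simp add: algebra_simps add_mset_commute)
  next
    case 3
    then show ?thesis using aux[of x y] s by (simp add: algebra_simps add_mset_commute)
  qed
qed

lemma eigenvalue_multiplicities_eq_iff:
  fixes A B :: "real^3^3"
  assumes A: "\<And>v w. (A *v v) \<bullet> w = v \<bullet> (A *v w)" and B: "\<And>v w. (B *v v) \<bullet> w = v \<bullet> (B *v w)"
  shows "(\<forall>k. dim {z. A *v z = k *\<^sub>R z} = dim {z. B *v z = k *\<^sub>R z}) \<longleftrightarrow>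
    trace A = trace B \<and> sigma2 A = sigma2 B \<and> det A = det B"
proof -
  obtain l where l: "\<And>k. dim {z. A *v z = k *\<^sub>R z} = count (spectrum3 l) k"
    "trace A = l$1 + l$2 + l$3" "sigma2 A = l$1 * l$2 + l$1 * l$3 + l$2 * l$3" "det A = l$1 * l$2 * l$3"
    by (rule symmetric_matrix_spectrum[OF A]) (rule that; assumption)
  obtain m where m: "\<And>k. dim {z. B *v z = k *\<^sub>R z} = count (spectrum3 m) k"
    "trace B = m$1 + m$2 + m$3" "sigma2 B = m$1 * m$2 + m$1 * m$3 + m$2 * m$3" "det B = m$1 * m$2 * m$3"
    by (rule symmetric_matrix_spectrum[OF B]) (rule that; assumption)
  have "(\<forall>k. dim {z. A *v z = k *\<^sub>R z} = dim {z. B *v z = k *\<^sub>R z}) \<longleftrightarrow> spectrum3 l = spectrum3 m"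
    unfolding l m by (simp add: multiset_eq_iff)
  also have "\<dots> \<longleftrightarrow> trace A = trace B \<and> sigma2 A = sigma2 B \<and> det A = det B"
  proof
    assume eq: "spectrum3 l = spectrum3 m"
    \<comment> \<open>Trace and determinant are the sum and the product of the multiset;
      \<open>sigma2\<close> is recovered from its sum of squares.\<close>
    have sq: "x\<^sup>2 + y\<^sup>2 + z\<^sup>2 = (x + y + z)\<^sup>2 - 2 * (x * y + x * z + y * z)" for x y z :: real
      by (simp add: power2_eq_square algebra_simps)
    have "sum_mset (spectrum3 l) = sum_mset (spectrum3 m)" "prod_mset (spectrum3 l) = prod_mset (spectrum3 m)"
      "sum_mset (image_mset (\<lambda>x. x\<^sup>2) (spectrum3 l)) = sum_mset (image_mset (\<lambda>x. x\<^sup>2) (spectrum3 m))"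
      unfolding eq by simp_all
    then show "trace A = trace B \<and> sigma2 A = sigma2 B \<and> det A = det B"
      using sq[of "l$1" "l$2" "l$3"] sq[of "m$1" "m$2" "m$3"] unfolding spectrum3_def l m
      by (simp add: algebra_simps)
  next
    assume "trace A = trace B \<and> sigma2 A = sigma2 B \<and> det A = det B"
    then show "spectrum3 l = spectrum3 m" unfolding spectrum3_def l m by (blast intro: multiset_three_eqI)
  qed
  finally show ?thesis .
qed

section \<open>Principal curvatures and the angle function\<close>

lemma multiplicities_eq_iff_angle_eq:
  fixes A B :: "real^3^3"
  assumes c: "c1 \<in> {1, 0, -1}" "c2 \<in> {1, 0, -1}" "c1 \<noteq> c2"
    and A: "\<And>v w. (A *v v) \<bullet> w = v \<bullet> (A *v w)" and B: "\<And>v w. (B *v v) \<bullet> w = v \<bullet> (B *v w)"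
    and t: "0 \<le> t" "t \<le> 1" and "\<epsilon> > 0"
    and eq: "\<And>r. r \<in> {-\<epsilon><..<\<epsilon>} \<Longrightarrow>
      jacobi_det (unit_curvatures c1 c2 t) A r = jacobi_det (unit_curvatures c1 c2 s) B r"
  shows "(\<forall>k. dim {z. A *v z = k *\<^sub>R z} = dim {z. B *v z = k *\<^sub>R z}) \<longleftrightarrow> t = s"
proof -
  define L where "L = (\<lambda>t. lin_deriv (c1 * t) (c2 * (1 - t)))"
  have coeff: "fst (fst ((L t ^^ n) (shape_state A))) = fst (fst ((L s ^^ n) (shape_state B)))" for n
  proof -
    have "lin_val (c1 * t) (c2 * (1 - t)) (shape_state A) r = lin_val (c1 * s) (c2 * (1 - s)) (shape_state B) r"
      if "r \<in> {-\<epsilon><..<\<epsilon>}" for r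
      using eq[OF that] by (simp add: jacobi_det_eq unit_curvatures_def)
    from lin_val_eq_iterate[OF this, of \<epsilon> 0 n] show ?thesis
      using \<open>\<epsilon> > 0\<close> by (simp add: lin_val_0 L_def)
  qed
  have tr: "trace A = trace B"
    using coeff[of 1] unfolding L_def taylor_coefficients_1_2 by simp
  \<comment> \<open>The curvatures add up to \<open>c2 + (c1 - c2) * t\<close>, so for
    \<open>c1 \<noteq> c2\<close> equality of \<open>sigma2\<close> and \<open>t = s\<close> imply
    each other.\<close>
  have s2: "2 * sigma2 A - 2 * sigma2 B = (c1 - c2) * (t - s)"
    using coeff[of 2] unfolding L_def taylor_coefficients_1_2 by (simp add: algebra_simps)
  have "det A = det B" if "t = s"
  proof -
    define a b where "a = c1 * t" "b = c2 * (1 - t)"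
    note ab = this
    note odd = coeff[unfolded L_def shape_state_def, folded that, folded ab]
    \<comment> \<open>A common nonzero value would need \<open>c1\<close> and \<open>c2\<close>
      nonzero of the same sign, hence equal.\<close>
    have "a = b \<Longrightarrow> a = 0" using c t unfolding ab by auto
    moreover have "(B$1$1 - A$1$1) + (B$2$2 - A$2$2) + (B$3$3 - A$3$3) = 0"
      using tr by (simp add: trace_def sum_3)
    \<comment> \<open>The unknowns are the differences of the coefficients in the two states;
      \<open>y3\<close> is \<open>det B - det A\<close>.\<close>
    ultimately have "det B - det A = 0"
    proof (rule determinant_coefficient_unique)
    qed (use odd[of 3] odd[of 5] odd[of 7] in \<open>simp_all only: taylor_coefficients_odd, simp_all add: algebra_simps\<close>)
    then show ?thesis by simp
  qed
  then show ?thesis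
    unfolding eigenvalue_multiplicities_eq_iff[OF A B] using tr s2 c(3) by auto
qed

theorem theorem1:
  fixes c1 c2 :: real
    and M :: "'a::euclidean_space set"
    and f N :: "'a \<Rightarrow> (real^3) \<times> (real^3)"
  assumes "c1 \<in> {1, 0, -1}" and "c2 \<in> {1, 0, -1}" and "c1 \<noteq> c2"
    and "isoparametric (product_metric c1 c2) (space_form c1 \<times> space_form c2) M f N"
  shows "constant_principal_curvatures (product_metric c1 c2) (space_form c1 \<times> space_form c2) M f N
    \<longleftrightarrow> (\<lambda>p. space_form_norm c1 (fst (N p))) constant_on M \<and>
        (\<lambda>p. space_form_norm c2 (snd (N p))) constant_on M"
proof -
  let ?B = "product_metric c1 c2" and ?P = "space_form c1 \<times> space_form c2"
  obtain \<epsilon> h where hyp: "hypersurface ?B ?P M f N" and "\<epsilon> > 0"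
    and par: "\<And>r. r \<in> {-\<epsilon><..<\<epsilon>} \<Longrightarrow> hypersurface ?B ?P M (parallel_map ?B ?P f N r) (parallel_normal ?B ?P f N r)"
    and mean: "\<And>r p. r \<in> {-\<epsilon><..<\<epsilon>} \<Longrightarrow> p \<in> M \<Longrightarrow>
      mean_curvature ?B ?P M (parallel_map ?B ?P f N r) (parallel_normal ?B ?P f N r) p = h r"
    using assms(4) unfolding isoparametric_def by blast
  define t where "t = (\<lambda>p. smet c1 (fst (N p)) (fst (N p)))"
  have shape: "\<exists>A. 0 \<le> t p \<and> t p \<le> 1 \<and> smet c2 (snd (N p)) (snd (N p)) = 1 - t p \<and>
      (\<forall>v w. (A *v v) \<bullet> w = v \<bullet> (A *v w)) \<and>
      (\<forall>k. principal_multiplicity ?B ?P M f N p k = dim {z. A *v z = k *\<^sub>R z}) \<and>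
      (\<forall>r\<in>{-\<epsilon><..<\<epsilon>}. jacobi_det (unit_curvatures c1 c2 (t p)) A r \<noteq> 0 \<and>
         (jacobi_det (unit_curvatures c1 c2 (t p)) A has_real_derivative
            - 3 * h r * jacobi_det (unit_curvatures c1 c2 (t p)) A r) (at r))" if p: "p \<in> M" for p
  proof (rule isoparametric_shape_matrix[OF assms(1,2) hyp par mean p])
    fix A :: "real^3^3" and s
    assume *: "0 \<le> s" "s \<le> 1" "smet c1 (fst (N p)) (fst (N p)) = s" "smet c2 (snd (N p)) (snd (N p)) = 1 - s"
      "\<And>v w. (A *v v) \<bullet> w = v \<bullet> (A *v w)"
      "\<And>k. principal_multiplicity ?B ?P M f N p k = dim {z. A *v z = k *\<^sub>R z}"
      "\<And>r. r \<in> {-\<epsilon><..<\<epsilon>} \<Longrightarrow> jacobi_det (unit_curvatures c1 c2 s) A r \<noteq> 0 \<and>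
         (jacobi_det (unit_curvatures c1 c2 s) A has_real_derivative
            - 3 * h r * jacobi_det (unit_curvatures c1 c2 s) A r) (at r)"
    have "t p = s" using *(3) by (simp add: t_def)
    then show ?thesis using * by (intro exI[of _ A]) blast
  qed
  have iff: "(\<forall>k. principal_multiplicity ?B ?P M f N p k = principal_multiplicity ?B ?P M f N q k) \<longleftrightarrow> t p = t q"
    if pq: "p \<in> M" "q \<in> M" for p q
  proof -
    obtain A where A: "0 \<le> t p" "t p \<le> 1" "\<And>v w. (A *v v) \<bullet> w = v \<bullet> (A *v w)"
      "\<And>k. principal_multiplicity ?B ?P M f N p k = dim {z. A *v z = k *\<^sub>R z}"
      "\<And>r. r \<in> {-\<epsilon><..<\<epsilon>} \<Longrightarrow> (jacobi_det (unit_curvatures c1 c2 (t p)) A has_real_derivative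
            - 3 * h r * jacobi_det (unit_curvatures c1 c2 (t p)) A r) (at r)"
      using shape[OF pq(1)] by blast
    obtain B where B: "\<And>v w. (B *v v) \<bullet> w = v \<bullet> (B *v w)"
      "\<And>k. principal_multiplicity ?B ?P M f N q k = dim {z. B *v z = k *\<^sub>R z}"
      "\<And>r. r \<in> {-\<epsilon><..<\<epsilon>} \<Longrightarrow> jacobi_det (unit_curvatures c1 c2 (t q)) B r \<noteq> 0 \<and>
         (jacobi_det (unit_curvatures c1 c2 (t q)) B has_real_derivative
            - 3 * h r * jacobi_det (unit_curvatures c1 c2 (t q)) B r) (at r)"
      using shape[OF pq(2)] by blast
    \<comment> \<open>Both determinants solve the same linear equation, with coefficient
      \<open>- 3 * h r\<close>, and start at 1.\<close>
    have "jacobi_det (unit_curvatures c1 c2 (t p)) A r = jacobi_det (unit_curvatures c1 c2 (t q)) B r"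
      if "r \<in> {-\<epsilon><..<\<epsilon>}" for r
      by (rule linear_ode_unique[OF A(5) B(3) _ that]) (simp_all add: jacobi_det_0)
    from multiplicities_eq_iff_angle_eq[OF assms(1-3) A(3) B(1) A(1,2) \<open>\<epsilon> > 0\<close> this]
    show ?thesis unfolding A(4) B(2) .
  qed
  \<comment> \<open>Both norms are functions of \<open>t\<close>, and the first one determines
    \<open>t\<close>.\<close>
  have norms: "space_form_norm c1 (fst (N p)) = sqrt (t p)" "space_form_norm c2 (snd (N p)) = sqrt (1 - t p)"
    if "p \<in> M" for p
    using shape[OF that] by (auto simp: space_form_norm_def t_def)
  have "constant_principal_curvatures ?B ?P M f N \<longleftrightarrow> (\<forall>p\<in>M. \<forall>q\<in>M. t p = t q)"
    unfolding constant_principal_curvatures_def using iff by blast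
  also have "\<dots> \<longleftrightarrow> (\<lambda>p. space_form_norm c1 (fst (N p))) constant_on M \<and>
        (\<lambda>p. space_form_norm c2 (snd (N p))) constant_on M"
  proof
    assume "\<forall>p\<in>M. \<forall>q\<in>M. t p = t q"
    then obtain s where "\<And>p. p \<in> M \<Longrightarrow> t p = s" by metis
    then show "(\<lambda>p. space_form_norm c1 (fst (N p))) constant_on M \<and>
        (\<lambda>p. space_form_norm c2 (snd (N p))) constant_on M"
      unfolding constant_on_def using norms by metis
  next
    assume "(\<lambda>p. space_form_norm c1 (fst (N p))) constant_on M \<and>
        (\<lambda>p. space_form_norm c2 (snd (N p))) constant_on M"
    then obtain y where "\<And>p. p \<in> M \<Longrightarrow> sqrt (t p) = y"
      unfolding constant_on_def using norms by metis
    then show "\<forall>p\<in>M. \<forall>q\<in>M. t p = t q" by (metis real_sqrt_eq_iff)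
  qed
  finally show ?thesis .
qed

end
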